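(* Let $q\ge 1$ and $m$ be integers with $m\ge 2(q+1)$, and let $\delta\in(-m,\infty)$ satisfy $x(\delta,m)\le\frac{1}{2q+2}$. Then the infinite preferential attachment clique complex $X(\infty,\delta,m)$ is $q$-homotopy-connected almost surely.
   Context: Preferential attachment graph. Let $m$ be a positive integer, $\delta\in(-m,\infty)$, and $T\ge 2$ an integer. The random graph $G(T,\delta,m)$ has nodes $1,\dots,T$, no self-loops, possibly repeated edges, and is constructed inductively. $G(2,\delta,m)$ is the deterministic graph with nodes $1,2$ and $m$ edges from node $2$ to node $1$. For $T\ge 3$, $G(T,\delta,m)$ is obtained from $G(T-1,\delta,m)$ by adding node $T$ and then adding $m$ edges from $T$ to nodes of $G(T-1,\delta,m)$ one by one: for $1\le\alpha\le m$, if $G(T-1,\delta,m,\alpha-1)$ denotes the graph after the first $\alpha-1$ edges from $T$ have been added, then conditionally on $G(T-1,\delta,m,\alpha-1)$ the $\alpha$-th edge from $T$ points to node $v\in\{1,\dots,T-1\}$ with probability $\frac{d(v)+\delta}{2(T-2)m+\alpha-1+(T-1)\delta}$, where $d(v)$ is the (total) degree of $v$ in $G(T-1,\delta,m,\alpha-1)$, counted with multiplicity. The infinite graph is the increasing union $G(\infty,\delta,m)=\bigcup_{T\ge2}G(T,\delta,m)$. The clique complex $X(\infty,\delta,m)$ is the abstract simplicial complex with the same nodes as $G(\infty,\delta,m)$ in which a finite nonempty set $\{v_0,\dots,v_r\}$ is a simplex if and only if there is at least one edge of $G(\infty,\delta,m)$ between each pair of distinct nodes in it. Put $x(\delta,m)=1-\frac{1}{2+\delta/m}$.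 A nonempty topological space $Y$ is $q$-homotopy-connected if for every $y_0\in Y$ and every integer $0\le r\le q$, every continuous map $f:S^r\to Y$ sending a fixed base point $s_r\in S^r$ to $y_0$ is homotopic, relative to the base point, to the constant map at $y_0$ (equivalently $\pi_r(Y,y_0)$ is trivial for all $0\le r\le q$ and all $y_0$). For a simplicial complex this refers to its geometric realization. *)

theory Defs
  imports
    "HOL-Probability.Probability"
    "HOL-Analysis.Abstract_Euclidean_Space"
    "HOL-Library.Multiset"
begin

section \<open>The preferential attachment process\<close>

text \<open>
  A multigraph is a multiset of edges \<open>(source, target)\<close>.
\<close>

definition multigraph_degree :: "('v \<times> 'v) multiset \<Rightarrow> 'v \<Rightarrow> nat" where
  "multigraph_degree g v =
     size (filter_mset (\<lambda>e. fst e = v) g) + size (filter_mset (\<lambda>e. snd e = v) g)"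

text \<open>
  \<open>E T \<alpha> \<omega>\<close> is the target of the \<open>\<alpha>\<close>-th edge (\<open>1 \<le> \<alpha> \<le> m\<close>) sent by node \<open>T \<ge> 2\<close>.
  \<open>pa_graph m E T \<alpha>\<close> contains all \<open>m\<close> edges of each of the nodes \<open>2, \<dots>, T - 1\<close> and the first \<open>\<alpha>\<close>
  edges of \<open>T\<close>. Thus the graph written \<open>G(T - 1, \<delta>, m, \<alpha>)\<close> in the literature is
  \<open>pa_graph m E T \<alpha>\<close>, and \<open>G(T, \<delta>, m)\<close> is \<open>pa_graph m E T m\<close>.
\<close>

definition pa_graph ::
    "nat \<Rightarrow> (nat \<Rightarrow> nat \<Rightarrow> 'w \<Rightarrow> nat) \<Rightarrow> nat \<Rightarrow> nat \<Rightarrow> 'w \<Rightarrow> (nat \<times> nat) multiset" where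
  "pa_graph m E T \<alpha> \<omega> =
     (\<Sum>s\<in>{2..<T}. \<Sum>\<beta>\<in>{1..m}. {#(s, E s \<beta> \<omega>)#}) + (\<Sum>\<beta>\<in>{1..\<alpha>}. {#(T, E T \<beta> \<omega>)#})"

text \<open>
  The conditioning is on the current multigraph. It takes only countably many values, so
  elementary conditional probabilities suffice.
\<close>

locale preferential_attachment = prob_space M
  for M :: "'w measure" and m :: nat and \<delta> :: real and E :: "nat \<Rightarrow> nat \<Rightarrow> 'w \<Rightarrow> nat" +
  assumes target_measurable:
      "\<And>T \<alpha>. \<lbrakk>2 \<le> T; 1 \<le> \<alpha>; \<alpha> \<le> m\<rbrakk> \<Longrightarrow> E T \<alpha> \<in> measurable M (count_space UNIV)"
    and initial_target:
      "\<And>\<alpha> \<omega>. \<lbrakk>1 \<le> \<alpha>; \<alpha> \<le> m; \<omega> \<in> space M\<rbrakk> \<Longrightarrow> E 2 \<alpha> \<omega> = 1"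
    and target_older:
      "\<And>T \<alpha> \<omega>. \<lbrakk>3 \<le> T; 1 \<le> \<alpha>; \<alpha> \<le> m; \<omega> \<in> space M\<rbrakk> \<Longrightarrow> E T \<alpha> \<omega> \<in> {1..T - 1}"
    and attachment_rule:
      "\<And>T \<alpha> v g. \<lbrakk>3 \<le> T; 1 \<le> \<alpha>; \<alpha> \<le> m; v \<in> {1..T - 1};
          \<P>(\<omega> in M. pa_graph m E T (\<alpha> - 1) \<omega> = g) > 0\<rbrakk> \<Longrightarrow>
        \<P>(\<omega> in M. E T \<alpha> \<omega> = v \<bar> pa_graph m E T (\<alpha> - 1) \<omega> = g) =
          (real (multigraph_degree g v) + \<delta>) /
          (2 * (real T - 2) * real m + real \<alpha> - 1 + (real T - 1) * \<delta>)"

text \<open>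
  The clique complex of the infinite graph only depends on which edges occur, not on their
  multiplicities, so the increasing union is taken over the underlying edge sets.
\<close>

definition pa_infinite_edges ::
    "nat \<Rightarrow> (nat \<Rightarrow> nat \<Rightarrow> 'w \<Rightarrow> nat) \<Rightarrow> 'w \<Rightarrow> (nat \<times> nat) set" where
  "pa_infinite_edges m E \<omega> = (\<Union>T\<in>{2..}. set_mset (pa_graph m E T m \<omega>))"

definition pa_x :: "real \<Rightarrow> nat \<Rightarrow> real" where
  "pa_x \<delta> m = 1 - 1 / (2 + \<delta> / real m)"


section \<open>Clique complexes and their geometric realization\<close>

definition clique_complex :: "'v set \<Rightarrow> ('v \<times> 'v) set \<Rightarrow> 'v set set" where
  "clique_complex V A =
     {\<sigma>. finite \<sigma> \<and> \<sigma> \<noteq> {} \<and> \<sigma> \<subseteq> V \<and> (\<forall>u\<in>\<sigma>. \<forall>v\<in>\<sigma>. u \<noteq> v \<longrightarrow> (u, v) \<in> A \<or> (v, u) \<in> A)}"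

definition pa_clique_complex ::
    "nat \<Rightarrow> (nat \<Rightarrow> nat \<Rightarrow> 'w \<Rightarrow> nat) \<Rightarrow> 'w \<Rightarrow> nat set set" where
  "pa_clique_complex m E \<omega> = clique_complex {1..} (pa_infinite_edges m E \<omega>)"

text \<open>
  Points of the realization are given by their barycentric coordinates.
\<close>

definition closed_face :: "'v set \<Rightarrow> ('v \<Rightarrow> real) set" where
  "closed_face \<sigma> = {x. (\<forall>v. 0 \<le> x v) \<and> (\<forall>v. v \<notin> \<sigma> \<longrightarrow> x v = 0) \<and> (\<Sum>v\<in>\<sigma>. x v) = 1}"

text \<open>
  The realization carries the weak topology (the complexes considered here are not locally finite):
  a set is open iff it meets every closed face in a relatively open set, where a closed face
  has its Euclidean topology, i.e. that of coordinatewise convergence.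
\<close>

definition geometric_realization :: "'v set set \<Rightarrow> ('v \<Rightarrow> real) topology" where
  "geometric_realization K =
     topology (\<lambda>U. U \<subseteq> (\<Union>\<sigma>\<in>K. closed_face \<sigma>) \<and>
       (\<forall>\<sigma>\<in>K. openin (subtopology (powertop_real UNIV) (closed_face \<sigma>)) (U \<inter> closed_face \<sigma>)))"

lemma openin_geometric_realization:
  "openin (geometric_realization K) U \<longleftrightarrow>
     U \<subseteq> (\<Union>\<sigma>\<in>K. closed_face \<sigma>) \<and>
     (\<forall>\<sigma>\<in>K. openin (subtopology (powertop_real UNIV) (closed_face \<sigma>)) (U \<inter> closed_face \<sigma>))"
proof -
  let ?L = "\<lambda>U. U \<subseteq> (\<Union>\<sigma>\<in>K. closed_face \<sigma>) \<and>
     (\<forall>\<sigma>\<in>K. openin (subtopology (powertop_real UNIV) (closed_face \<sigma>)) (U \<inter> closed_face \<sigma>))"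
  have "istopology ?L"
    unfolding istopology_def
  proof (rule conjI; intro allI impI)
    fix S T assume S: "?L S" and T: "?L T"
    have "openin (subtopology (powertop_real UNIV) (closed_face \<sigma>)) ((S \<inter> T) \<inter> closed_face \<sigma>)"
      if "\<sigma> \<in> K" for \<sigma>
    proof -
      have "(S \<inter> T) \<inter> closed_face \<sigma> = (S \<inter> closed_face \<sigma>) \<inter> (T \<inter> closed_face \<sigma>)"
        by blast
      with S T that show ?thesis
        by (metis (no_types, lifting) openin_Int)
    qed
    with S show "?L (S \<inter> T)"
      by blast
  next
    fix \<K> assume *: "\<forall>S\<in>\<K>. ?L S"
    have "openin (subtopology (powertop_real UNIV) (closed_face \<sigma>)) (\<Union>\<K> \<inter> closed_face \<sigma>)"
      if "\<sigma> \<in> K" for \<sigma>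
    proof -
      have "\<Union>\<K> \<inter> closed_face \<sigma> = (\<Union>S\<in>\<K>. S \<inter> closed_face \<sigma>)"
        by blast
      with * that show ?thesis
        by (metis (no_types, lifting) imageE openin_Union)
    qed
    moreover have "\<Union>\<K> \<subseteq> (\<Union>\<sigma>\<in>K. closed_face \<sigma>)"
      using * by (meson Union_least)
    ultimately show "?L (\<Union>\<K>)"
      by blast
  qed
  then show ?thesis
    by (simp add: geometric_realization_def)
qed

lemma topspace_geometric_realization:
  "topspace (geometric_realization K) = (\<Union>\<sigma>\<in>K. closed_face \<sigma>)"
proof
  show "topspace (geometric_realization K) \<subseteq> (\<Union>\<sigma>\<in>K. closed_face \<sigma>)"
    using openin_geometric_realization[of K] openin_topspace by blast
  have "openin (subtopology (powertop_real UNIV) (closed_face \<sigma>))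
          ((\<Union>\<tau>\<in>K. closed_face \<tau>) \<inter> closed_face \<sigma>)" if "\<sigma> \<in> K" for \<sigma> :: "'a set"
  proof -
    have "(\<Union>\<tau>\<in>K. closed_face \<tau>) \<inter> closed_face \<sigma> =
          topspace (subtopology (powertop_real UNIV) (closed_face \<sigma>))"
      using that by auto
    then show ?thesis
      by (metis openin_topspace)
  qed
  then have "openin (geometric_realization K) (\<Union>\<sigma>\<in>K. closed_face \<sigma>)"
    by (simp add: openin_geometric_realization)
  then show "(\<Union>\<sigma>\<in>K. closed_face \<sigma>) \<subseteq> topspace (geometric_realization K)"
    by (rule openin_subset)
qed


section \<open>Homotopy-connectedness\<close>

definition sphere_base :: "nat \<Rightarrow> real" where
  "sphere_base = (\<lambda>i. if i = 0 then 1 else 0)"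

lemma sphere_base_in_nsphere: "sphere_base \<in> topspace (nsphere r)"
  unfolding sphere_base_def by (rule in_topspace_nsphere)

text \<open>
  The library's \<open>nsphere r\<close> is the unit sphere of dimension \<open>r\<close>.
\<close>

definition homotopy_connected :: "nat \<Rightarrow> 'a topology \<Rightarrow> bool" where
  "homotopy_connected q Y \<longleftrightarrow>
     topspace Y \<noteq> {} \<and>
     (\<forall>y\<^sub>0\<in>topspace Y. \<forall>r\<le>q. \<forall>f.
        continuous_map (nsphere r) Y f \<and> f sphere_base = y\<^sub>0 \<longrightarrow>
        homotopic_with (\<lambda>h. h sphere_base = y\<^sub>0) (nsphere r) Y f (\<lambda>_. y\<^sub>0))"

end

(*
  The proof shows that every set of at most 2q + 2 nodes almost surely has a common neighbour, and that
  this property makes a clique complex q-connected.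

  Common neighbours. Put w = d(v) + delta. While w > 1, the quantity (T - 1)^(1 - x) / (w - 1) is a
  nonnegative supermartingale, so by the maximal inequality w stays above a random multiple of
  T^(1 - x). Given the past, a new node T is therefore linked to k given nodes with probability at least
  const * T^(-kx), which is at least const / T when k <= 2q + 2; as the harmonic series diverges, this
  happens for some T.

  Connectivity. The complex of common neighbours of a vertex set S is covered by the complexes of common
  neighbours of S + w, where w is itself a common neighbour of S. These are cones, and the intersections
  with finite unions of such pieces are complexes of the same kind with a larger S. An induction with a
  van Kampen type gluing lemma (A, B (d-1)-connected and their intersection (d-2)-connected imply
  their union (d-1)-connected) gives the result.
*)
theory Submission
  imports Defs
begin

section \<open>Colorings by a simplicial complex\<close>

text \<open>The hypotheses enter through k = 2q + 2. A node can be linked to k prescribed nodes only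
  if it sends at least k edges, and probabilities of order \<open>T powr (- k * x)\<close> have
  divergent sum exactly when \<open>k * x \<le> 1\<close>. The number k itself is the vertex budget
  of the connectivity induction: each dimension costs two further vertices, one for a cone point and
  one because the pieces of the intersections are indexed by nodes that need not be adjacent to each
  other. Two obstacles shape the rest. The supermartingale needs w > 1, while a weight is only known
  to be at least m + \<delta>, which may be close to 0. The degrees are therefore shown to be
  unbounded beforehand; for a single target the crude bound m + \<delta> already gives a probability
  of order 1 / T. On the topological side the complex is not locally finite, so maps into the
  realization appear only in one final translation, controlled by compactness, and all gluing is
  done with finite closed covers of cubes.\<close>

text \<open>
  A coloring is a finite closed cover whose nerve lies in the complex \<open>A\<close>. It carries the homotopical
  information of a map into the realization of \<open>A\<close>: a map gives the sets where a barycentric coordinate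
  is not too small, and a slightly thickened cover gives back a map via a partition of unity.
  Colorings extend and paste without any continuity argument.
\<close>

definition coloring :: "'p::topological_space set \<Rightarrow> 'v set set \<Rightarrow> ('p \<Rightarrow> 'v set) \<Rightarrow> bool" where
  "coloring K A c \<longleftrightarrow>
     (\<exists>F. finite F \<and> (\<forall>x\<in>K. c x \<subseteq> F)) \<and> (\<forall>x\<in>K. c x \<in> A) \<and> (\<forall>v. closed {x \<in> K. v \<in> c x})"

lemma coloringI:
  assumes "finite F" "\<And>x. x \<in> K \<Longrightarrow> c x \<subseteq> F" "\<And>x. x \<in> K \<Longrightarrow> c x \<in> A"
    "\<And>v. closed {x \<in> K. v \<in> c x}"
  shows "coloring K A c"
  using assms unfolding coloring_def by blast

lemma coloringE:
  assumes "coloring K A c"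
  obtains F where "finite F" "\<And>x. x \<in> K \<Longrightarrow> c x \<subseteq> F" "\<And>x. x \<in> K \<Longrightarrow> c x \<in> A"
    "\<And>v. closed {x \<in> K. v \<in> c x}"
  using assms unfolding coloring_def by blast

lemma coloring_mem: "coloring K A c \<Longrightarrow> x \<in> K \<Longrightarrow> c x \<in> A"
  by (simp add: coloring_def)

lemma coloring_cong:
  assumes "coloring K A c" "\<And>x. x \<in> K \<Longrightarrow> c' x = c x"
  shows "coloring K A c'"
proof -
  have "{x \<in> K. v \<in> c' x} = {x \<in> K. v \<in> c x}" for v
    using assms(2) by auto
  then show ?thesis
    using assms unfolding coloring_def by auto
qed

lemma coloring_range:
  assumes "coloring K A c" "\<And>x. x \<in> K \<Longrightarrow> c x \<in> B"
  shows "coloring K B c"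
  using assms unfolding coloring_def by auto

lemma coloring_mono: "coloring K A c \<Longrightarrow> A \<subseteq> B \<Longrightarrow> coloring K B c"
  using coloring_range[of K A c B] coloring_mem by blast

lemma coloring_subset:
  assumes "coloring K A c" "L \<subseteq> K" "closed L"
  shows "coloring L A c"
proof -
  have "{x \<in> L. v \<in> c x} = L \<inter> {x \<in> K. v \<in> c x}" for v
    using assms(2) by auto
  then have cl: "closed {x \<in> L. v \<in> c x}" for v
    using assms(1,3) unfolding coloring_def by (simp add: closed_Int)
  obtain F where "finite F" "\<forall>x\<in>K. c x \<subseteq> F"
    using assms(1) unfolding coloring_def by blast
  then show ?thesis
    using assms(2) cl coloring_mem[OF assms(1)] by (intro coloringI[of F]) blast+
qed

text \<open>Color classes are closed in the ambient space and not merely in \<open>K\<close>, so two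
  colorings glue without any condition on how their domains meet.\<close>

lemma coloring_Un:
  assumes "coloring K A c" "coloring L A c"
  shows "coloring (K \<union> L) A c"
proof -
  have "{x \<in> K \<union> L. v \<in> c x} = {x \<in> K. v \<in> c x} \<union> {x \<in> L. v \<in> c x}" for v
    by auto
  then have cl: "closed {x \<in> K \<union> L. v \<in> c x}" for v
    using assms unfolding coloring_def by (simp add: closed_Un)
  obtain F where F: "finite F" "\<forall>x\<in>K. c x \<subseteq> F"
    using assms unfolding coloring_def by blast
  obtain G where G: "finite G" "\<forall>x\<in>L. c x \<subseteq> G"
    using assms unfolding coloring_def by blast
  show ?thesis
    by (rule coloringI[of "F \<union> G"]) (use F G cl assms coloring_mem in blast)+
qed

lemma coloring_paste:
  assumes "coloring K A c1" "coloring L A c2"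
    "\<And>x. x \<in> K \<Longrightarrow> c x = c1 x" "\<And>x. x \<in> L \<Longrightarrow> c x = c2 x"
  shows "coloring (K \<union> L) A c"
  by (meson assms coloring_Un coloring_cong)

lemma coloring_pullback:
  assumes "coloring K A c" "closed K'" "continuous_on K' f" "\<And>x. x \<in> K' \<Longrightarrow> f x \<in> K"
  shows "coloring K' A (\<lambda>x. c (f x))"
proof -
  have "{x \<in> K'. v \<in> c (f x)} = K' \<inter> f -` {x \<in> K. v \<in> c x}" for v
    using assms(4) by auto
  moreover have "closed (K' \<inter> f -` {x \<in> K. v \<in> c x})" for v
    using assms(1) continuous_closed_preimage[OF assms(3,2)] unfolding coloring_def by blast
  ultimately have cl: "closed {x \<in> K'. v \<in> c (f x)}" for v
    by simp
  obtain F where "finite F" "\<forall>x\<in>K. c x \<subseteq> F"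
    using assms unfolding coloring_def by blast
  then show ?thesis
    using assms(1,4) cl by (intro coloringI[of F]) (auto dest: coloring_mem)
qed

lemma coloring_const: "closed K \<Longrightarrow> finite s \<Longrightarrow> s \<in> A \<Longrightarrow> coloring K A (\<lambda>_. s)"
  by (rule coloringI[of s]) (simp_all add: Collect_conj_eq)

text \<open>
  \<open>cell x\<close> is the smallest closed cell of the integer grid that contains \<open>x\<close>; it has dimension
  \<open>card (nonint x)\<close> and is determined by \<open>carrier_cell x\<close>.
\<close>

definition nonint :: "(nat \<Rightarrow> real) \<Rightarrow> nat set" where
  "nonint x = {i. x i \<notin> \<int>}"

definition carrier_cell :: "(nat \<Rightarrow> real) \<Rightarrow> (nat \<Rightarrow> int) \<times> nat set" where
  "carrier_cell x = (\<lambda>i. \<lfloor>x i\<rfloor>, nonint x)"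

definition cell :: "(nat \<Rightarrow> real) \<Rightarrow> (nat \<Rightarrow> real) set" where
  "cell x = {y. \<forall>i. if x i \<in> \<int> then y i = x i else of_int \<lfloor>x i\<rfloor> \<le> y i \<and> y i \<le> of_int \<lfloor>x i\<rfloor> + 1}"

lemma cell_Ints: "y \<in> cell x \<Longrightarrow> x i \<in> \<int> \<Longrightarrow> y i = x i"
  unfolding cell_def by (drule CollectD, drule spec[of _ i]) simp

lemma cell_not_Ints: "y \<in> cell x \<Longrightarrow> x i \<notin> \<int> \<Longrightarrow> of_int \<lfloor>x i\<rfloor> \<le> y i \<and> y i \<le> of_int \<lfloor>x i\<rfloor> + 1"
  unfolding cell_def by (drule CollectD, drule spec[of _ i]) simp

lemma cell_bounds: "y \<in> cell x \<Longrightarrow> of_int \<lfloor>x i\<rfloor> \<le> y i \<and> y i \<le> of_int \<lfloor>x i\<rfloor> + 1"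
  using cell_Ints[of y x i] cell_not_Ints[of y x i]
  by (cases "x i \<in> \<int>") (auto intro: real_of_int_floor_add_one_ge)

lemma floor_between: "n \<le> y \<Longrightarrow> y \<le> n + 1 \<Longrightarrow> (y::real) \<notin> \<int> \<Longrightarrow> n \<in> \<int> \<Longrightarrow> of_int \<lfloor>y\<rfloor> = n"
  by (metis Ints_1 Ints_add Ints_cases floor_of_int floor_unique less_eq_real_def)

lemma mem_cell_self [simp]: "x \<in> cell x"
  unfolding cell_def by (auto intro: real_of_int_floor_add_one_ge)

text \<open>A face of a face is a face. In each non-integral coordinate of \<open>x\<close>, either
  \<open>y i\<close> is an integer, which fixes \<open>z i\<close>, or \<open>y i\<close> is
  interior to the same unit interval and has the same floor as \<open>x i\<close>.\<close>

lemma cell_subset: "y \<in> cell x \<Longrightarrow> cell y \<subseteq> cell x"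
proof
  fix z assume y: "y \<in> cell x" and z: "z \<in> cell y"
  show "z \<in> cell x"
    unfolding cell_def
  proof (intro CollectI allI)
    fix i
    have "of_int \<lfloor>y i\<rfloor> = (of_int \<lfloor>x i\<rfloor> :: real)" if "x i \<notin> \<int>" "y i \<notin> \<int>"
      by (rule floor_between) (use cell_not_Ints[OF y] that in auto)
    then show "if x i \<in> \<int> then z i = x i else of_int \<lfloor>x i\<rfloor> \<le> z i \<and> z i \<le> of_int \<lfloor>x i\<rfloor> + 1"
      using cell_Ints[OF y, of i] cell_Ints[OF z, of i] cell_not_Ints[OF y, of i] cell_not_Ints[OF z, of i]
      by (cases "x i \<in> \<int>"; cases "y i \<in> \<int>") auto
  qed
qed

lemma nonint_mono: "y \<in> cell x \<Longrightarrow> nonint y \<subseteq> nonint x"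
  unfolding nonint_def using cell_Ints by fastforce

text \<open>A point of the closed cell with the same non-integral coordinates lies in the open cell.
  Hence every other point of \<open>cell x\<close> has a strictly smaller set of them, that is, lies
  in a proper face.\<close>

lemma carrier_cell_eqI:
  assumes "y \<in> cell x" "nonint y = nonint x"
  shows "carrier_cell y = carrier_cell x"
proof -
  have "\<lfloor>y i\<rfloor> = \<lfloor>x i\<rfloor>" for i
  proof (cases "x i \<in> \<int>")
    case True
    then show ?thesis using cell_Ints[OF assms(1)] by simp
  next
    case False
    then have "y i \<notin> \<int>" using assms(2) unfolding nonint_def by blast
    have "of_int \<lfloor>y i\<rfloor> = (of_int \<lfloor>x i\<rfloor> :: real)"
      by (rule floor_between) (use False \<open>y i \<notin> \<int>\<close> cell_not_Ints[OF assms(1)] in auto)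
    then show ?thesis by linarith
  qed
  with assms(2) show ?thesis unfolding carrier_cell_def by auto
qed

lemma cell_carrier_cong:
  assumes "carrier_cell x = carrier_cell y"
  shows "cell x = cell y"
proof -
  have f: "\<lfloor>x i\<rfloor> = \<lfloor>y i\<rfloor>" and n: "x i \<in> \<int> \<longleftrightarrow> y i \<in> \<int>" for i
    using assms unfolding carrier_cell_def nonint_def by (auto dest: fun_cong)
  have "x i = y i" if "x i \<in> \<int>" for i
    using f[of i] n[of i] that by (metis Ints_cases floor_of_int)
  then show ?thesis unfolding cell_def by (simp add: f n cong: if_cong)
qed

lemma continuous_on_coord: "continuous_on S (\<lambda>x :: 'a \<Rightarrow> 'b::topological_space. x i)"
  by (rule continuous_on_subset[OF continuous_on_product_coordinates]) simp

lemma closed_coordinate: "closed {x :: nat \<Rightarrow> real. P (x i)}" if "closed {t. P t}"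
proof -
  have "continuous_on UNIV (\<lambda>x :: nat \<Rightarrow> real. x i)"
    by simp
  then have "closed ((\<lambda>x :: nat \<Rightarrow> real. x i) -` {t. P t})"
    using that by (intro closed_vimage)
  then show ?thesis by (simp add: vimage_def)
qed

lemma closed_cell: "closed (cell x)"
proof -
  have "closed {y :: nat \<Rightarrow> real. if x i \<in> \<int> then y i = x i else of_int \<lfloor>x i\<rfloor> \<le> y i \<and> y i \<le> of_int \<lfloor>x i\<rfloor> + 1}"
    for i
  proof (rule closed_coordinate)
    have "{t. of_int \<lfloor>x i\<rfloor> \<le> t \<and> t \<le> of_int \<lfloor>x i\<rfloor> + 1} = {of_int \<lfloor>x i\<rfloor> .. of_int \<lfloor>x i\<rfloor> + (1::real)}"
      by auto
    then show "closed {t. if x i \<in> \<int> then t = x i else of_int \<lfloor>x i\<rfloor> \<le> t \<and> t \<le> of_int \<lfloor>x i\<rfloor> + 1}"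
      by (cases "x i \<in> \<int>") auto
  qed
  then show ?thesis unfolding cell_def by (rule closed_Collect_all)
qed

text \<open>A finite subcomplex of the grid. The points sharing one value of
  \<open>carrier_cell\<close> form an open cell, so the first condition counts cells although
  \<open>P\<close> itself is usually infinite.\<close>

definition cellular :: "(nat \<Rightarrow> real) set \<Rightarrow> bool" where
  "cellular P \<longleftrightarrow> finite (carrier_cell ` P) \<and> (\<forall>x\<in>P. cell x \<subseteq> P)"

lemma cellular_mem:
  assumes "cellular P" "y \<in> P" "carrier_cell x = carrier_cell y"
  shows "x \<in> P"
  using assms cell_carrier_cong[of x y] mem_cell_self[of x] unfolding cellular_def by blast

lemma cellular_Un: "cellular P \<Longrightarrow> cellular Q \<Longrightarrow> cellular (P \<union> Q)"
  unfolding cellular_def by (auto simp: image_Un)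

lemma cellular_subset: "cellular P \<Longrightarrow> Q \<subseteq> P \<Longrightarrow> (\<And>x. x \<in> Q \<Longrightarrow> cell x \<subseteq> Q) \<Longrightarrow> cellular Q"
  unfolding cellular_def by (meson finite_subset image_mono)

lemma cellular_Int: "cellular P \<Longrightarrow> cellular Q \<Longrightarrow> cellular (P \<inter> Q)"
  by (rule cellular_subset[of P]) (auto simp: cellular_def)

lemma cellular_closed:
  assumes "cellular P" shows "closed P"
proof -
  define S where "S = cell ` P"
  have "cell x = cell (inv_into P carrier_cell (carrier_cell x))" if "x \<in> P" for x
    by (rule cell_carrier_cong) (metis f_inv_into_f imageI that)
  then have "S \<subseteq> (\<lambda>e. cell (inv_into P carrier_cell e)) ` (carrier_cell ` P)"
    unfolding S_def by blast
  then have "finite S"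
    using assms unfolding cellular_def by (meson finite_imageI finite_subset)
  moreover have "P = \<Union>S"
    using assms unfolding S_def cellular_def by (auto intro: mem_cell_self)
  moreover have "\<forall>C\<in>S. closed C"
    using closed_cell unfolding S_def by auto
  ultimately show ?thesis by auto
qed

section \<open>Cubes and the extension of colorings over grid complexes\<close>

text \<open>All cubes live in the one space of real sequences: \<open>J\<close> selects the active
  coordinates and the others vanish. Cubes of all dimensions then have the same type, and a further
  coordinate is free when a cylinder is formed.\<close>

definition cube :: "real \<Rightarrow> nat set \<Rightarrow> (nat \<Rightarrow> real) set" where
  "cube N J = {x. \<forall>i. if i \<in> J then \<bar>x i\<bar> \<le> N else x i = 0}"

definition cube_boundary :: "real \<Rightarrow> nat set \<Rightarrow> (nat \<Rightarrow> real) set" where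
  "cube_boundary N J = {x \<in> cube N J. \<exists>i\<in>J. \<bar>x i\<bar> = N}"

lemma cube_in: "x \<in> cube N J \<Longrightarrow> i \<in> J \<Longrightarrow> \<bar>x i\<bar> \<le> N"
  unfolding cube_def by (drule CollectD, drule spec[of _ i]) simp

lemma cube_out: "x \<in> cube N J \<Longrightarrow> i \<notin> J \<Longrightarrow> x i = 0"
  unfolding cube_def by (drule CollectD, drule spec[of _ i]) simp

text \<open>
  \<open>ext_conn d A\<close> says that the complex \<open>A\<close> is \<open>(d - 1)\<close>-connected; for \<open>d = 0\<close> it only says that
  \<open>A\<close> is nonempty, because the boundary of the \<open>0\<close>-cube is empty.
\<close>

definition ext_conn :: "nat \<Rightarrow> 'v set set \<Rightarrow> bool" where
  "ext_conn d A \<longleftrightarrow>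
     (\<forall>J c. finite J \<and> card J \<le> d \<and> coloring (cube_boundary 1 J) A c \<longrightarrow>
        (\<exists>c'. coloring (cube 1 J) A c' \<and> (\<forall>x\<in>cube_boundary 1 J. c' x = c x)))"

lemma closed_cube: "closed (cube N J)"
proof -
  have "closed {y :: nat \<Rightarrow> real. if i \<in> J then \<bar>y i\<bar> \<le> N else y i = 0}" for i
  proof (rule closed_coordinate)
    have "{t. \<bar>t\<bar> \<le> N} = {-N .. N}"
      by auto
    then show "closed {t. if i \<in> J then \<bar>t\<bar> \<le> N else t = 0}"
      by (cases "i \<in> J") auto
  qed
  then show ?thesis unfolding cube_def by (rule closed_Collect_all)
qed

lemma closed_cube_boundary: 
  assumes "finite J" shows "closed (cube_boundary N J)"
proof -
  have "cube_boundary N J = (\<Union>i\<in>J. cube N J \<inter> {x. \<bar>x i\<bar> = N})"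
    unfolding cube_boundary_def by auto
  moreover have "{t. \<bar>t\<bar> = N} = (if N \<ge> 0 then {N, -N} else {})"
    by auto
  then have "closed {x :: nat \<Rightarrow> real. \<bar>x i\<bar> = N}" for i
    by (intro closed_coordinate) (auto simp: closed_insert)
  ultimately show ?thesis
    using assms by (auto intro!: closed_UN closed_Int closed_cube)
qed

text \<open>An affine change of the coordinates in \<open>nonint x\<close> (\<open>\<phi>\<close>,
  with inverse \<open>\<psi>\<close>) carries \<open>cube 1 J\<close> to \<open>cell x\<close> and
  the boundary of the cube to the proper faces, so the extension property passes from cubes to
  cells.\<close>

lemma ext_cell:
  assumes "ext_conn d A" "finite (nonint x)" "card (nonint x) \<le> d"
    and c: "coloring {y \<in> cell x. carrier_cell y \<noteq> carrier_cell x} A c"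
  shows "\<exists>c'. coloring (cell x) A c' \<and> (\<forall>y\<in>cell x. carrier_cell y \<noteq> carrier_cell x \<longrightarrow> c' y = c y)"
proof -
  define J where "J = nonint x"
  define \<phi> :: "(nat \<Rightarrow> real) \<Rightarrow> nat \<Rightarrow> real" where
    "\<phi> u i = (if i \<in> J then of_int \<lfloor>x i\<rfloor> + 1/2 + u i / 2 else x i)" for u i
  define \<psi> :: "(nat \<Rightarrow> real) \<Rightarrow> nat \<Rightarrow> real" where
    "\<psi> y i = (if i \<in> J then 2 * (y i - of_int \<lfloor>x i\<rfloor>) - 1 else 0)" for y i
  have inv: "\<phi> (\<psi> y) = y" if "y \<in> cell x" for y
    using cell_Ints[OF that] unfolding \<phi>_def \<psi>_def J_def nonint_def by (auto simp: field_simps)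
  have phi: "\<phi> u \<in> cell x" if "u \<in> cube 1 J" for u
  proof -
    have "if x i \<in> \<int> then \<phi> u i = x i else of_int \<lfloor>x i\<rfloor> \<le> \<phi> u i \<and> \<phi> u i \<le> of_int \<lfloor>x i\<rfloor> + 1" for i
    proof -
      have "x i \<notin> \<int> \<Longrightarrow> \<bar>u i\<bar> \<le> 1" using cube_in[OF that] unfolding J_def nonint_def by simp
      then show ?thesis unfolding \<phi>_def J_def nonint_def by (auto simp: abs_le_iff)
    qed
    then show ?thesis unfolding cell_def by blast
  qed
  have phib: "carrier_cell (\<phi> u) \<noteq> carrier_cell x" if u: "u \<in> cube_boundary 1 J" for u
  proof -
    obtain i where i: "i \<in> J" "\<bar>u i\<bar> = 1" using u unfolding cube_boundary_def by auto
    then have "u i = 1 \<or> u i = -1" by linarith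
    then have "\<phi> u i = of_int (\<lfloor>x i\<rfloor> + 1) \<or> \<phi> u i = of_int \<lfloor>x i\<rfloor>" using i unfolding \<phi>_def by auto
    then have "\<phi> u i \<in> \<int>" using Ints_of_int by metis
    then show ?thesis using i unfolding carrier_cell_def nonint_def J_def by auto
  qed
  have psi: "\<psi> y \<in> cube 1 J" if "y \<in> cell x" for y
  proof -
    have "if i \<in> J then \<bar>\<psi> y i\<bar> \<le> 1 else \<psi> y i = 0" for i
    proof -
      have "i \<in> J \<Longrightarrow> of_int \<lfloor>x i\<rfloor> \<le> y i \<and> y i \<le> of_int \<lfloor>x i\<rfloor> + 1"
        using cell_bounds[OF that] by blast
      then show ?thesis unfolding \<psi>_def by (auto simp: abs_le_iff)
    qed
    then show ?thesis unfolding cube_def by blast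
  qed
  have psib: "\<psi> y \<in> cube_boundary 1 J" if y: "y \<in> cell x" "carrier_cell y \<noteq> carrier_cell x" for y
  proof -
    obtain i where i: "i \<in> J" "y i \<in> \<int>"
      using carrier_cell_eqI[OF y(1)] y nonint_mono[OF y(1)] unfolding J_def nonint_def by auto
    have "of_int \<lfloor>x i\<rfloor> \<le> y i \<and> y i \<le> of_int \<lfloor>x i\<rfloor> + 1"
      using cell_bounds[OF y(1)] by blast
    with i(2) have "y i = of_int \<lfloor>x i\<rfloor> \<or> y i = of_int \<lfloor>x i\<rfloor> + 1"
      by (elim Ints_cases) (simp, linarith)
    then have "\<bar>\<psi> y i\<bar> = 1" unfolding \<psi>_def using i by auto
    with i psi[OF y(1)] show ?thesis unfolding cube_boundary_def by auto
  qed
  have "coloring (cube_boundary 1 J) A (\<lambda>u. c (\<phi> u))"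
  proof (rule coloring_pullback[OF c])
    show "closed (cube_boundary 1 J)" using assms(2) by (simp add: J_def closed_cube_boundary)
    show "continuous_on (cube_boundary 1 J) \<phi>"
    proof (rule continuous_on_coordinatewise_then_product)
      fix i
      show "continuous_on (cube_boundary 1 J) (\<lambda>u. \<phi> u i)"
        unfolding \<phi>_def by (cases "i \<in> J") (auto intro!: continuous_intros continuous_on_coord)
    qed
    show "\<phi> u \<in> {y \<in> cell x. carrier_cell y \<noteq> carrier_cell x}" if "u \<in> cube_boundary 1 J" for u
      using that phi phib unfolding cube_boundary_def by auto
  qed
  then obtain c1 where c1: "coloring (cube 1 J) A c1" "\<forall>u\<in>cube_boundary 1 J. c1 u = c (\<phi> u)"
    using assms unfolding ext_conn_def J_def by blast
  have "coloring (cell x) A (\<lambda>y. c1 (\<psi> y))"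
  proof (rule coloring_pullback[OF c1(1) closed_cell])
    show "continuous_on (cell x) \<psi>"
    proof (rule continuous_on_coordinatewise_then_product)
      fix i
      show "continuous_on (cell x) (\<lambda>u. \<psi> u i)"
        unfolding \<psi>_def by (cases "i \<in> J") (auto intro!: continuous_intros continuous_on_coord)
    qed
  qed (use psi in auto)
  moreover have "c1 (\<psi> y) = c y" if "y \<in> cell x" "carrier_cell y \<noteq> carrier_cell x" for y
    using c1(2) psib[OF that] inv that by auto
  ultimately show ?thesis by blast
qed

text \<open>A cell having \<open>e\<close> in its closure lies outside \<open>Q\<close>, because
  \<open>Q\<close> is a subcomplex, and has dimension at most that of \<open>e\<close> by
  maximality; so it is the cell of \<open>e\<close> itself. Hence no remaining cell has the removed
  one as a face.\<close>

lemma cellular_remove_cell: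
  assumes P: "cellular P" "Q \<subseteq> P" "cellular Q" and e: "e \<in> P" "e \<notin> Q"
    and fin: "\<And>x. x \<in> P \<Longrightarrow> finite (nonint x)"
    and max: "\<And>x. x \<in> P \<Longrightarrow> x \<notin> Q \<Longrightarrow> card (nonint x) \<le> card (nonint e)"
  shows "cellular {x \<in> P. carrier_cell x \<noteq> carrier_cell e}"
proof (rule cellular_subset[OF P(1)])
  fix x assume "x \<in> {x \<in> P. carrier_cell x \<noteq> carrier_cell e}"
  then have x: "x \<in> P" "carrier_cell x \<noteq> carrier_cell e" by auto
  show "cell x \<subseteq> {x \<in> P. carrier_cell x \<noteq> carrier_cell e}"
  proof
    fix y assume y: "y \<in> cell x"
    then have yP: "y \<in> P" using x P(1) unfolding cellular_def by blast
    have "carrier_cell y \<noteq> carrier_cell e"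
    proof
      assume eq: "carrier_cell y = carrier_cell e"
      then have "y \<notin> Q" using cellular_mem[OF P(3), of y e] e cellular_mem[OF P(3), of e y] by metis
      then have "x \<notin> Q" using y P(3) unfolding cellular_def by blast
      then have le: "card (nonint x) \<le> card (nonint e)" using max x by blast
      have ne: "nonint y = nonint e" using eq unfolding carrier_cell_def by simp
      have "nonint y = nonint x"
        using card_seteq[OF fin[OF x(1)] nonint_mono[OF y]] le ne by simp
      then show False using carrier_cell_eqI[OF y] eq x(2) by simp
    qed
    with yP show "y \<in> {x \<in> P. carrier_cell x \<noteq> carrier_cell e}" by blast
  qed
qed auto

text \<open>The induction takes off a cell of maximal dimension outside \<open>Q\<close>, so that
  its whole boundary is already colored when it is put back with \<open>ext_cell\<close>.\<close>

lemma ext_cellular: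
  assumes A: "ext_conn d A"
    and "cellular P" "cellular Q" "Q \<subseteq> P" "coloring Q A c"
    and "\<And>x. x \<in> P \<Longrightarrow> finite (nonint x)" "\<And>x. x \<in> P \<Longrightarrow> x \<notin> Q \<Longrightarrow> card (nonint x) \<le> d"
  shows "\<exists>c'. coloring P A c' \<and> (\<forall>x\<in>Q. c' x = c x)"
  using assms(2-)
proof (induction "card (carrier_cell ` P)" arbitrary: P rule: less_induct)
  case less
  show ?case
  proof (cases "P \<subseteq> Q")
    case True
    with less.prems have "P = Q" by blast
    then show ?thesis using less.prems by blast
  next
    case False
    define D where "D = (\<lambda>x. card (nonint x)) ` (P - Q)"
    have "D \<subseteq> {..d}" using less.prems(6) unfolding D_def by auto
    then have finD: "finite D" using finite_subset by blast
    moreover have "D \<noteq> {}" using False unfolding D_def by auto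
    ultimately have "Max D \<in> D" by (rule Max_in)
    then obtain e where e: "e \<in> P" "e \<notin> Q" "card (nonint e) = Max D" unfolding D_def by auto
    have mx: "card (nonint x) \<le> card (nonint e)" if "x \<in> P" "x \<notin> Q" for x
      using that Max_ge[OF finD] unfolding e(3) D_def by auto
    define P' where "P' = {x \<in> P. carrier_cell x \<noteq> carrier_cell e}"
    have cel: "cellular P'"
      unfolding P'_def using less.prems e mx by (intro cellular_remove_cell[where Q = Q]) auto
    have "carrier_cell e \<notin> carrier_cell ` P'" "carrier_cell ` P' \<subseteq> carrier_cell ` P"
      unfolding P'_def by auto
    then have "carrier_cell ` P' \<subset> carrier_cell ` P"
      using e(1) by blast
    then have "card (carrier_cell ` P') < card (carrier_cell ` P)"
      using less.prems(1) unfolding cellular_def by (simp add: psubset_card_mono)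
    moreover have QP': "Q \<subseteq> P'"
      using less.prems(3) e cellular_mem[OF less.prems(2)] unfolding P'_def by force
    ultimately obtain c1 where c1: "coloring P' A c1" "\<forall>x\<in>Q. c1 x = c x"
      using less.hyps[of P'] cel less.prems unfolding P'_def by auto
    have bd: "{y \<in> cell e. carrier_cell y \<noteq> carrier_cell e} = cell e \<inter> P'"
      using less.prems(1) e unfolding P'_def cellular_def by auto
    have "coloring {y \<in> cell e. carrier_cell y \<noteq> carrier_cell e} A c1"
      unfolding bd by (rule coloring_subset[OF c1(1)]) (auto intro: closed_Int closed_cell cellular_closed cel)
    then obtain c2 where c2: "coloring (cell e) A c2"
      "\<forall>y\<in>cell e. carrier_cell y \<noteq> carrier_cell e \<longrightarrow> c2 y = c1 y"
      using ext_cell[OF A, of e c1] less.prems e by blast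
    define c' where "c' x = (if carrier_cell x = carrier_cell e then c2 x else c1 x)" for x
    have "coloring (P' \<union> cell e) A c'"
      by (rule coloring_paste[OF c1(1) c2(1)]) (use c2 in \<open>auto simp: c'_def P'_def\<close>)
    moreover have "P' \<union> cell e = P"
      using cell_carrier_cong[of _ e] mem_cell_self less.prems(1) e unfolding P'_def cellular_def by blast
    ultimately have "coloring P A c'" by simp
    moreover have "\<forall>x\<in>Q. c' x = c x"
      using c1(2) QP' unfolding c'_def P'_def by auto
    ultimately show ?thesis by blast
  qed
qed

section \<open>Gluing\<close>

lemma ext_connD:
  assumes "ext_conn d A" "finite J" "card J \<le> d" "coloring (cube_boundary 1 J) A c"
  obtains c' where "coloring (cube 1 J) A c'" "\<And>x. x \<in> cube_boundary 1 J \<Longrightarrow> c' x = c x"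
  using assms(1)[unfolded ext_conn_def, THEN spec[of _ J], THEN spec[of _ c]] assms(2-4) by auto

text \<open>This is the case \<open>J = {}\<close>: the cube is a single point with empty boundary,
  and the extension of the empty coloring picks a simplex there. It is finite because a coloring
  uses finitely many colors.\<close>

lemma ext_conn_nonempty:
  assumes "ext_conn d A"
  obtains s where "s \<in> A" "finite s"
proof -
  have *: "coloring (cube_boundary 1 {}) A (\<lambda>_. {})"
    unfolding coloring_def cube_boundary_def by auto
  obtain c where c: "coloring (cube 1 {}) A c"
    by (rule ext_connD[OF assms finite.emptyI _ *]) auto
  moreover have "(\<lambda>_. 0) \<in> cube 1 {}"
    unfolding cube_def by simp
  ultimately show ?thesis
    using that[of "c (\<lambda>_. 0)"] unfolding coloring_def by (auto dest: finite_subset)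
qed

section \<open>Radial coordinates and null-homotopies of colorings\<close>

lemma continuous_on_Max:
  fixes f :: "'i \<Rightarrow> 'a::topological_space \<Rightarrow> real"
  assumes "finite J" "J \<noteq> {}" "\<And>i. i \<in> J \<Longrightarrow> continuous_on S (f i)"
  shows "continuous_on S (\<lambda>x. Max ((\<lambda>i. f i x) ` J))"
  using assms by (induction rule: finite_ne_induct) (auto intro: continuous_on_max)

text \<open>For finite nonempty \<open>J\<close> this is the maximum norm in the active coordinates,
  whose unit sphere is the boundary of \<open>cube 1 J\<close>; it serves as the radial coordinate
  of the cube.\<close>

definition maxabs :: "nat set \<Rightarrow> (nat \<Rightarrow> real) \<Rightarrow> real" where
  "maxabs J x = Max ((\<lambda>i. \<bar>x i\<bar>) ` J)"

lemma continuous_on_maxabs: "finite J \<Longrightarrow> J \<noteq> {} \<Longrightarrow> continuous_on S (maxabs J)"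
  unfolding maxabs_def by (rule continuous_on_Max) (auto intro: continuous_on_rabs continuous_on_coord)

lemma maxabs_ge: "finite J \<Longrightarrow> i \<in> J \<Longrightarrow> \<bar>x i\<bar> \<le> maxabs J x"
  unfolding maxabs_def by simp

lemma maxabs_attained:
  assumes "finite J" "J \<noteq> {}" obtains i where "i \<in> J" "\<bar>x i\<bar> = maxabs J x"
proof -
  have "maxabs J x \<in> (\<lambda>i. \<bar>x i\<bar>) ` J"
    unfolding maxabs_def using assms by (intro Max_in) auto
  then show ?thesis using that by auto
qed

lemma maxabs_le: "finite J \<Longrightarrow> J \<noteq> {} \<Longrightarrow> (\<And>i. i \<in> J \<Longrightarrow> \<bar>x i\<bar> \<le> a) \<Longrightarrow> maxabs J x \<le> a"
  unfolding maxabs_def by simp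

lemma maxabs_cube_boundary:
  assumes J: "finite J" "J \<noteq> {}" and x: "x \<in> cube_boundary 1 J"
  shows "maxabs J x = 1"
proof (rule antisym)
  have xc: "x \<in> cube 1 J" using x unfolding cube_boundary_def by blast
  show "maxabs J x \<le> 1" using maxabs_le[OF J] cube_in[OF xc] by blast
  obtain i where "i \<in> J" "\<bar>x i\<bar> = 1" using x unfolding cube_boundary_def by blast
  then show "1 \<le> maxabs J x" using maxabs_ge[OF J(1), of i x] by simp
qed

lemma cube_mem_iff: "x \<in> cube N J \<longleftrightarrow> (\<forall>i\<in>J. \<bar>x i\<bar> \<le> N) \<and> (\<forall>i. i \<notin> J \<longrightarrow> x i = 0)"
  unfolding cube_def by (auto split: if_splits)

lemma scaled_in_cube_boundary:
  assumes J: "finite J" "J \<noteq> {}" and x: "\<And>i. i \<notin> J \<Longrightarrow> x i = 0" and pos: "0 < maxabs J x"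
  shows "(\<lambda>i. x i / maxabs J x) \<in> cube_boundary 1 J"
proof -
  obtain i where i: "i \<in> J" "\<bar>x i\<bar> = maxabs J x" using maxabs_attained[OF J] .
  have "(\<lambda>i. x i / maxabs J x) \<in> cube 1 J"
    unfolding cube_mem_iff using maxabs_ge[OF J(1), of _ x] x pos by (auto simp: abs_divide)
  moreover have "\<bar>x i / maxabs J x\<bar> = 1" using i pos by (simp add: abs_divide)
  ultimately show ?thesis using i unfolding cube_boundary_def by blast
qed

lemma closed_Collect_continuous_ge:
  fixes f :: "'a::topological_space \<Rightarrow> real"
  assumes "closed S" "continuous_on S f"
  shows "closed {x \<in> S. a \<le> f x}" "closed {x \<in> S. f x \<le> a}"
proof -
  have "closed (S \<inter> f -` {a..})" "closed (S \<inter> f -` {..a})"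
    using assms by (auto intro!: continuous_closed_preimage)
  then show "closed {x \<in> S. a \<le> f x}" "closed {x \<in> S. f x \<le> a}"
    by (simp_all add: Int_def vimage_def Collect_conj_eq[symmetric])
qed

text \<open>The shell \<open>1/2 \<le> \<rho>\<close> carries \<open>h\<close> along the radii, with
  time \<open>2 - 2 * \<rho>\<close>, and the inner cube is filled with the constant
  \<open>s\<close>.\<close>

lemma null_ext:
  assumes J: "finite J" "J \<noteq> {}"
    and h: "coloring (cube_boundary 1 J \<times> {0..1::real}) A h"
    and h0: "\<And>x. x \<in> cube_boundary 1 J \<Longrightarrow> h (x, 0) = c x"
    and h1: "\<And>x. x \<in> cube_boundary 1 J \<Longrightarrow> h (x, 1) = s"
    and s: "s \<in> A" "finite s"
  shows "\<exists>c'. coloring (cube 1 J) A c' \<and> (\<forall>x\<in>cube_boundary 1 J. c' x = c x)"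
proof -
  define \<rho> where "\<rho> = maxabs J"
  have cont: "continuous_on S \<rho>" for S
    unfolding \<rho>_def by (rule continuous_on_maxabs[OF J])
  have le1: "\<rho> x \<le> 1" if "x \<in> cube 1 J" for x
    unfolding \<rho>_def using maxabs_le[OF J] cube_in[OF that] by blast
  have bd1: "\<rho> x = 1" if "x \<in> cube_boundary 1 J" for x
    unfolding \<rho>_def by (rule maxabs_cube_boundary[OF J that])
  define K1 where "K1 = {x \<in> cube 1 J. 1/2 \<le> \<rho> x}"
  define K2 where "K2 = {x \<in> cube 1 J. \<rho> x \<le> 1/2}"
  have cl: "closed K1" "closed K2"
    unfolding K1_def K2_def by (rule closed_Collect_continuous_ge[OF closed_cube cont])+
  define c' where "c' x = (if 1/2 \<le> \<rho> x then h (\<lambda>i. x i / \<rho> x, 2 - 2 * \<rho> x) else s)" for x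
  have bd: "(\<lambda>i. x i / \<rho> x) \<in> cube_boundary 1 J" if "x \<in> K1" for x
    using that cube_out[of x 1 J] unfolding K1_def \<rho>_def by (intro scaled_in_cube_boundary J) auto
  have "coloring K1 A (\<lambda>x. h (\<lambda>i. x i / \<rho> x, 2 - 2 * \<rho> x))"
  proof (rule coloring_pullback[OF h cl(1), where f = "\<lambda>x. (\<lambda>i. x i / \<rho> x, 2 - 2 * \<rho> x)"])
    show "continuous_on K1 (\<lambda>x. (\<lambda>i. x i / \<rho> x, 2 - 2 * \<rho> x))"
    proof (intro continuous_on_Pair continuous_on_coordinatewise_then_product continuous_on_divide)
      show "continuous_on K1 (\<lambda>x. 2 - 2 * \<rho> x)"
        by (intro continuous_intros cont)
      show "\<forall>x\<in>K1. \<rho> x \<noteq> 0" unfolding K1_def by auto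
    qed (auto intro: cont continuous_on_coord)
    show "(\<lambda>i. x i / \<rho> x, 2 - 2 * \<rho> x) \<in> cube_boundary 1 J \<times> {0..1}" if "x \<in> K1" for x
      using that bd[OF that] le1[of x] unfolding K1_def by auto
  qed
  moreover have "coloring K2 A (\<lambda>_. s)"
    by (rule coloring_const[OF cl(2) s(2,1)])
  moreover have "c' x = h (\<lambda>i. x i / \<rho> x, 2 - 2 * \<rho> x)" if "x \<in> K1" for x
    using that unfolding c'_def K1_def by simp
  moreover have "c' x = s" if "x \<in> K2" for x
  proof (cases "1/2 \<le> \<rho> x")
    case True
    then have "\<rho> x = 1/2" "x \<in> K1" using that unfolding K1_def K2_def by auto
    then have "(\<lambda>i. x i / \<rho> x, 2 - 2 * \<rho> x) = (\<lambda>i. x i / \<rho> x, 1)" by simp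
    with h1[OF bd[OF \<open>x \<in> K1\<close>]] show ?thesis unfolding c'_def using True by metis
  qed (simp add: c'_def)
  ultimately have "coloring (K1 \<union> K2) A c'"
    by (rule coloring_paste)
  moreover have "K1 \<union> K2 = cube 1 J"
    unfolding K1_def K2_def by auto
  moreover have "c' x = c x" if "x \<in> cube_boundary 1 J" for x
    using bd1[OF that] h0[OF that] unfolding c'_def by simp
  ultimately show ?thesis by auto
qed

lemma ext_conn_cone:
  assumes v: "{v} \<in> A" and ins: "\<And>s. s \<in> A \<Longrightarrow> insert v s \<in> A"
  shows "ext_conn d A"
  unfolding ext_conn_def
proof (intro allI impI, elim conjE)
  fix J c
  assume J: "finite J" and c: "coloring (cube_boundary 1 J) A c"
  show "\<exists>c'. coloring (cube 1 J) A c' \<and> (\<forall>x\<in>cube_boundary 1 J. c' x = c x)"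
  proof (cases "J = {}")
    case True
    have "coloring (cube 1 J) A (\<lambda>_. {v})"
      by (rule coloring_const) (auto simp: closed_cube v)
    moreover have "cube_boundary 1 J = {}"
      using True unfolding cube_boundary_def by simp
    ultimately show ?thesis by blast
  next
    case False
    \<comment> \<open>The two patterns occupy the times \<open>{0..1/2}\<close> and
      \<open>{1/2..1}\<close>. At time 1/2 both are present, which keeps the color classes closed
      and is where \<open>insert v\<close> of a simplex has to be a simplex.\<close>
    define h where "h p = (if snd p < (1/2::real) then c (fst p)
       else if snd p = 1/2 then insert v (c (fst p)) else {v})" for p
    have "coloring (cube_boundary 1 J \<times> {0..1}) A h"
    proof -
      obtain F where F: "finite F" "\<And>x. x \<in> cube_boundary 1 J \<Longrightarrow> c x \<subseteq> F"
        using c unfolding coloring_def by blast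
      have "{p \<in> cube_boundary 1 J \<times> {0..1}. u \<in> h p} =
        {x \<in> cube_boundary 1 J. u \<in> c x} \<times> {0..1/2} \<union> (if u = v then cube_boundary 1 J \<times> {1/2..1} else {})"
        for u
        unfolding h_def by (auto split: if_splits)
      moreover have "closed {x \<in> cube_boundary 1 J. u \<in> c x}" for u
        using c unfolding coloring_def by blast
      ultimately have "closed {p \<in> cube_boundary 1 J \<times> {0..1}. u \<in> h p}" for u
        by (auto intro!: closed_Un closed_Times closed_cube_boundary J)
      then show ?thesis
      proof (rule coloringI[of "insert v F", rotated -1])
        show "finite (insert v F)" using F by simp
        show "h p \<subseteq> insert v F" if "p \<in> cube_boundary 1 J \<times> {0..1}" for p
          using F(2)[of "fst p"] that unfolding h_def by auto
        show "h p \<in> A" if "p \<in> cube_boundary 1 J \<times> {0..1}" for p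
          using coloring_mem[OF c, of "fst p"] that v ins unfolding h_def by auto
      qed
    qed
    then show ?thesis
      by (rule null_ext[where s = "{v}", OF J False]) (auto simp: h_def v)
  qed
qed

section \<open>Subdividing a cube boundary along two subcomplexes\<close>

text \<open>The empty set is excluded as a simplex, so that the color classes of a coloring by
  \<open>A\<close> cover its domain.\<close>

definition down_closed :: "'v set set \<Rightarrow> bool" where
  "down_closed A \<longleftrightarrow> {} \<notin> A \<and> (\<forall>s\<in>A. \<forall>t. t \<noteq> {} \<and> t \<subseteq> s \<longrightarrow> t \<in> A)"

text \<open>A value \<open>c x\<close> fails to be a simplex of \<open>A\<close> exactly when it
  contains some nonempty non-simplex, and the finite palette \<open>F\<close> offers finitely many
  candidates. This makes the set a finite union of intersections of color classes.\<close>

lemma closed_not_in: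
  assumes c: "coloring K C c" and "closed K" and A: "down_closed A" and C: "{} \<notin> C"
  shows "closed {x \<in> K. c x \<notin> A}"
proof -
  obtain F where F: "finite F" "\<And>x. x \<in> K \<Longrightarrow> c x \<subseteq> F" and clv: "\<And>v. closed {x \<in> K. v \<in> c x}"
    using c unfolding coloring_def by blast
  have "{x \<in> K. c x \<notin> A} = (\<Union>s\<in>Pow F - A - {{}}. \<Inter>v\<in>s. {x \<in> K. v \<in> c x})" (is "?L = ?R")
  proof
    show "?L \<subseteq> ?R"
    proof
      fix x assume x: "x \<in> ?L"
      then have "c x \<in> Pow F - A - {{}}" using F(2) coloring_mem[OF c, of x] C by auto
      moreover have "x \<in> (\<Inter>v\<in>c x. {x \<in> K. v \<in> c x})" using x by auto
      ultimately show "x \<in> ?R" by blast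
    qed
    show "?R \<subseteq> ?L"
    proof
      fix x assume "x \<in> ?R"
      then obtain s where s: "s \<notin> A" "s \<noteq> {}" "\<And>v. v \<in> s \<Longrightarrow> x \<in> K \<and> v \<in> c x" by auto
      then have "s \<subseteq> c x" "x \<in> K" by auto
      with s A show "x \<in> ?L" unfolding down_closed_def by blast
    qed
  qed
  moreover have "closed ?R"
    using F(1) clv by (intro closed_UN) auto
  ultimately show ?thesis by simp
qed

lemma compact_cube: "compact (cube N J)"
proof -
  have "cube N J = PiE UNIV (\<lambda>i. if i \<in> J then {-N..N} else {0})"
    unfolding cube_def PiE_def Pi_def by (auto simp: abs_le_iff split: if_splits)
  moreover have "compactin (product_topology (\<lambda>i. euclideanreal) UNIV)
      (PiE UNIV (\<lambda>i::nat. if i \<in> J then {-N..N} else {0}))"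
    unfolding compactin_PiE by (auto simp: compactin_euclidean_iff)
  ultimately show ?thesis
    by (simp add: euclidean_product_topology compactin_euclidean_iff)
qed

lemma compact_cube_boundary: "finite J \<Longrightarrow> compact (cube_boundary N J)"
  using compact_Int_closed[OF compact_cube[of N J] closed_cube_boundary[of J N]]
  by (simp add: Int_absorb1 cube_boundary_def)

text \<open>The points where \<open>c\<close> leaves \<open>A\<close> and those where it leaves
  \<open>B\<close> form disjoint compact sets, since every value lies in \<open>A\<close> or in
  \<open>B\<close>. Pairs of such points coming arbitrarily close in all coordinates would produce a
  common limit; so \<open>1 / N\<close> acts as a Lebesgue number.\<close>

lemma lebesgue_coloring:
  fixes c :: "(nat \<Rightarrow> real) \<Rightarrow> 'v set"
  assumes K: "compact K" and c: "coloring K (A \<union> B) c" and A: "down_closed A" and B: "down_closed B"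
  shows "\<exists>N::nat. N > 0 \<and> (\<forall>x\<in>K. \<forall>y\<in>K. (\<forall>i. \<bar>x i - y i\<bar> \<le> 1 / real N) \<longrightarrow> c x \<in> A \<or> c y \<in> B)"
proof (rule ccontr)
  assume *: "\<not> ?thesis"
  have "\<exists>p. fst p \<in> K \<and> snd p \<in> K \<and> (\<forall>i. \<bar>fst p i - snd p i\<bar> \<le> 1 / real (Suc n)) \<and> c (fst p) \<notin> A \<and> c (snd p) \<notin> B"
    for n
  proof -
    have "\<not> (\<forall>x\<in>K. \<forall>y\<in>K. (\<forall>i. \<bar>x i - y i\<bar> \<le> 1 / real (Suc n)) \<longrightarrow> c x \<in> A \<or> c y \<in> B)"
      using * by blast
    then obtain x y where "x \<in> K" "y \<in> K" "\<forall>i. \<bar>x i - y i\<bar> \<le> 1 / real (Suc n)" "c x \<notin> A" "c y \<notin> B"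
      by blast
    then show ?thesis by (intro exI[of _ "(x, y)"]) simp
  qed
  then obtain p where p: "\<And>n. fst (p n) \<in> K" "\<And>n. snd (p n) \<in> K"
    "\<And>n i. \<bar>fst (p n) i - snd (p n) i\<bar> \<le> 1 / real (Suc n)" "\<And>n. c (fst (p n)) \<notin> A" "\<And>n. c (snd (p n)) \<notin> B"
    by metis
  have clK: "closed K" using K by (rule compact_imp_closed)
  have e: "{} \<notin> A \<union> B" using A B unfolding down_closed_def by blast
  define S where "S = {x \<in> K. c x \<notin> A}"
  define T where "T = {x \<in> K. c x \<notin> B}"
  have cl: "closed S" "closed T"
    unfolding S_def T_def using closed_not_in[OF c clK A e] closed_not_in[OF c clK B e] by auto
  have "compact (S \<times> T)"
    using compact_Int_closed[OF K cl(1)] compact_Int_closed[OF K cl(2)]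
    by (intro compact_Times) (auto simp: S_def T_def Int_def)
  moreover have "p n \<in> S \<times> T" for n
    using p(1)[of n] p(2)[of n] p(4)[of n] p(5)[of n] unfolding S_def T_def by (cases "p n") auto
  ultimately obtain l r where l: "l \<in> S \<times> T" "strict_mono (r :: nat \<Rightarrow> nat)" "(p \<circ> r) \<longlonglongrightarrow> l"
    unfolding compact_def by metis
  have "fst l i = snd l i" for i
  proof -
    have c1: "continuous_on UNIV (\<lambda>q :: (nat \<Rightarrow> real) \<times> (nat \<Rightarrow> real). fst q i - snd q i)"
      by (intro continuous_intros continuous_on_product_then_coordinatewise)
    have "(\<lambda>n. fst (p (r n)) i - snd (p (r n)) i) \<longlonglongrightarrow> fst l i - snd l i"
      using continuous_on_tendsto_compose[OF c1 l(3)] by simp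
    moreover have "(\<lambda>n. fst (p (r n)) i - snd (p (r n)) i) \<longlonglongrightarrow> 0"
    proof (rule Lim_null_comparison)
      show "\<forall>\<^sub>F n in sequentially. norm (fst (p (r n)) i - snd (p (r n)) i) \<le> 1 / real (Suc n)"
      proof (rule always_eventually, rule allI)
        fix n
        have "n \<le> r n" using l(2) by (rule seq_suble)
        then have "1 / real (Suc (r n)) \<le> 1 / real (Suc n)" by (simp add: field_simps)
        then show "norm (fst (p (r n)) i - snd (p (r n)) i) \<le> 1 / real (Suc n)"
          using p(3)[of "r n" i] by simp
      qed
      show "(\<lambda>n. 1 / real (Suc n)) \<longlonglongrightarrow> 0"
        using LIMSEQ_inverse_real_of_nat by (simp add: inverse_eq_divide)
    qed
    ultimately show ?thesis
      using LIMSEQ_unique by fastforce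
  qed
  then have "fst l = snd l" by auto
  then have "fst l \<in> S" "fst l \<in> T" using l(1) by auto
  then show False using coloring_mem[OF c, of "fst l"] unfolding S_def T_def by auto
qed

text \<open>Because \<open>N\<close> is an integer, a coordinate equal to \<open>N\<close> or
  \<open>- N\<close> is constant on the whole cell, and a non-integral coordinate stays between
  \<open>- N\<close> and \<open>N\<close>.\<close>

lemma cellular_cube_boundary:
  assumes J: "finite J"
  shows "cellular (cube_boundary (real N) J)"
  unfolding cellular_def
proof (intro conjI ballI subsetI)
  let ?S = "{f. \<forall>i. (i \<in> J \<longrightarrow> f i \<in> {- int N..int N}) \<and> (i \<notin> J \<longrightarrow> f i = 0)} \<times> Pow J"
  have "carrier_cell ` cube_boundary (real N) J \<subseteq> ?S"
  proof
    fix e assume "e \<in> carrier_cell ` cube_boundary (real N) J"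
    then obtain x where x: "e = carrier_cell x" "x \<in> cube (real N) J"
      unfolding cube_boundary_def by auto
    have "- int N \<le> \<lfloor>x i\<rfloor> \<and> \<lfloor>x i\<rfloor> \<le> int N" if "i \<in> J" for i
      using cube_in[OF x(2) that] by linarith
    moreover have "nonint x \<subseteq> J"
      using cube_out[OF x(2)] unfolding nonint_def by fastforce
    ultimately show "e \<in> ?S"
      using cube_out[OF x(2)] unfolding x(1) carrier_cell_def by auto
  qed
  moreover have "finite ?S"
    using J by (intro finite_cartesian_product finite_set_of_finite_funs) auto
  ultimately show "finite (carrier_cell ` cube_boundary (real N) J)"
    by (rule finite_subset)
next
  fix x y assume x: "x \<in> cube_boundary (real N) J" and y: "y \<in> cell x"
  then have xc: "x \<in> cube (real N) J" unfolding cube_boundary_def by auto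
  obtain i where i: "i \<in> J" "\<bar>x i\<bar> = real N" using x unfolding cube_boundary_def by auto
  then have "x i = real N \<or> x i = - real N" by linarith
  then have "x i \<in> \<int>" by auto
  then have "y i = x i" using cell_Ints[OF y] by simp
  moreover have "\<bar>y j\<bar> \<le> real N" if "j \<in> J" for j
  proof (cases "x j \<in> \<int>")
    case True
    then show ?thesis using cell_Ints[OF y] cube_in[OF xc that] by simp
  next
    case False
    then have "x j \<noteq> real N" by auto
    then have "- int N \<le> \<lfloor>x j\<rfloor>" "\<lfloor>x j\<rfloor> < int N" using cube_in[OF xc that] by linarith+
    then have "- real N \<le> of_int \<lfloor>x j\<rfloor>" "of_int \<lfloor>x j\<rfloor> + 1 \<le> real N" by linarith+
    then show ?thesis using cell_bounds[OF y, of j] by auto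
  qed
  moreover have "y j = 0" if "j \<notin> J" for j
    using cell_Ints[OF y, of j] cube_out[OF xc that] by simp
  ultimately show "y \<in> cube_boundary (real N) J"
    using i unfolding cube_boundary_def cube_mem_iff by (intro CollectI conjI bexI[of _ i]) auto
qed

section \<open>Cylinders over grid complexes\<close>

text \<open>The product of \<open>P\<close> with the unit interval inside the same sequence space:
  coordinate \<open>k\<close>, on which \<open>P\<close> is meant to vanish, becomes the time. A
  cylinder is again a grid complex, so \<open>ext_cellular\<close> also produces homotopies.\<close>

definition cylinder :: "nat \<Rightarrow> (nat \<Rightarrow> real) set \<Rightarrow> (nat \<Rightarrow> real) set" where
  "cylinder k P = {x. x(k := 0) \<in> P \<and> 0 \<le> x k \<and> x k \<le> 1}"

definition cylinder_ends :: "nat \<Rightarrow> (nat \<Rightarrow> real) set \<Rightarrow> (nat \<Rightarrow> real) set" where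
  "cylinder_ends k P = {x. x(k := 0) \<in> P \<and> (x k = 0 \<or> x k = 1)}"

lemma cell_fun_upd: "y \<in> cell x \<Longrightarrow> y(k := 0) \<in> cell (x(k := 0))"
  unfolding cell_def by auto

lemma cellular_cylinder:
  assumes P: "cellular P"
  shows "cellular (cylinder k P)"
  unfolding cellular_def
proof (intro conjI ballI subsetI)
  \<comment> \<open>The open cell of \<open>x\<close> is recovered from the base cell, the floor of
    the time coordinate (0 or 1) and a flag telling whether that coordinate is non-integral.\<close>
  let ?f = "\<lambda>(e, n, b). ((fst e)(k := n), if b then insert k (snd e) else snd e - {k})"
  have "carrier_cell ` cylinder k P \<subseteq> ?f ` (carrier_cell ` P \<times> {0..1::int} \<times> UNIV)"
  proof
    fix e assume "e \<in> carrier_cell ` cylinder k P"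
    then obtain x where x: "e = carrier_cell x" "x(k := 0) \<in> P" "0 \<le> x k" "x k \<le> 1"
      unfolding cylinder_def by auto
    have "nonint (x(k := 0)) = nonint x - {k}"
      unfolding nonint_def by auto
    moreover have "(\<lambda>i. \<lfloor>(x(k := 0)) i\<rfloor>)(k := \<lfloor>x k\<rfloor>) = (\<lambda>i. \<lfloor>x i\<rfloor>)"
      by auto
    ultimately have "e = ?f (carrier_cell (x(k := 0)), \<lfloor>x k\<rfloor>, k \<in> nonint x)"
      unfolding x(1) carrier_cell_def by (cases "k \<in> nonint x") (simp_all add: insert_absorb)
    moreover have "\<lfloor>x k\<rfloor> \<in> {0..1}"
      using x(3,4) by (auto simp: le_floor_iff floor_le_iff)
    ultimately show "e \<in> ?f ` (carrier_cell ` P \<times> {0..1} \<times> UNIV)"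
      using x(2) by blast
  qed
  moreover have "finite (carrier_cell ` P \<times> {0..1::int} \<times> (UNIV :: bool set))"
    using P unfolding cellular_def by auto
  ultimately show "finite (carrier_cell ` cylinder k P)"
    using finite_surj by blast
next
  fix x y assume x: "x \<in> cylinder k P" and y: "y \<in> cell x"
  have "y(k := 0) \<in> P"
    using cell_fun_upd[OF y, of k] x P unfolding cylinder_def cellular_def by blast
  moreover have "0 \<le> y k \<and> y k \<le> 1"
  proof (cases "x k \<in> \<int>")
    case True
    then show ?thesis using cell_Ints[OF y] x unfolding cylinder_def by simp
  next
    case False
    then have "x k \<noteq> 1" by auto
    then have "\<lfloor>x k\<rfloor> = 0" using x unfolding cylinder_def by (simp add: floor_eq_iff)
    then show ?thesis using cell_bounds[OF y, of k] by auto
  qed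
  ultimately show "y \<in> cylinder k P" unfolding cylinder_def by simp
qed

lemma cylinder_ends_subset: "cylinder_ends k P \<subseteq> cylinder k P"
  unfolding cylinder_ends_def cylinder_def by auto

lemma cellular_cylinder_ends:
  assumes P: "cellular P"
  shows "cellular (cylinder_ends k P)"
proof (rule cellular_subset[OF cellular_cylinder[OF P] cylinder_ends_subset])
  fix x assume x: "x \<in> cylinder_ends k P"
  show "cell x \<subseteq> cylinder_ends k P"
  proof
    fix y assume y: "y \<in> cell x"
    have "x k \<in> \<int>" using x unfolding cylinder_ends_def by auto
    then have "y k = x k" using cell_Ints[OF y] by simp
    moreover have "y(k := 0) \<in> P"
      using cell_fun_upd[OF y, of k] x P unfolding cylinder_ends_def cellular_def by blast
    ultimately show "y \<in> cylinder_ends k P" using x unfolding cylinder_ends_def by auto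
  qed
qed

lemma nonint_cylinder: "nonint x \<subseteq> insert k (nonint (x(k := 0)))"
  unfolding nonint_def by auto

lemma continuous_on_fun_upd_zero:
  "continuous_on S (\<lambda>x :: nat \<Rightarrow> real. x(k := 0))"
proof (rule continuous_on_coordinatewise_then_product)
  fix i show "continuous_on S (\<lambda>x. (x(k := 0)) i)"
    by (cases "i = k") (auto intro: continuous_on_coord)
qed

lemma coloring_cylinder_ends:
  assumes c: "coloring P A c" and P: "closed P" and s: "s \<in> A" "finite s"
  shows "coloring (cylinder_ends k P) A (\<lambda>x. if x k = 0 then c (x(k := 0)) else s)"
proof -
  define E where "E a = (\<lambda>x. x(k := 0)) -` P \<inter> {x. x k = a}" for a :: real
  have cl: "closed (E a)" for a
    unfolding E_def by (intro closed_Int closed_vimage P continuous_on_fun_upd_zero closed_coordinate) simp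
  have "coloring (E 0) A (\<lambda>x. c (x(k := 0)))"
    by (rule coloring_pullback[OF c cl continuous_on_fun_upd_zero]) (simp add: E_def)
  moreover have "coloring (E 1) A (\<lambda>_. s)"
    by (rule coloring_const[OF cl s(2,1)])
  moreover have "cylinder_ends k P = E 0 \<union> E 1"
    unfolding cylinder_ends_def E_def by auto
  ultimately show ?thesis
    by (auto intro!: coloring_paste simp: E_def)
qed

text \<open>
  Subdivide the boundary of the cube into grid cells so small that each of them is colored in \<open>A\<close> or in \<open>B\<close>.
  The union \<open>PA\<close> of the cells colored in \<open>A\<close> and the union \<open>PB\<close> of the other cells meet in codimension one,
  so the coloring of \<open>PA \<inter> PB\<close> can be contracted in \<open>A \<inter> B\<close>; then those of \<open>PA\<close> and \<open>PB\<close> can be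
  contracted, compatibly, in \<open>A\<close> and in \<open>B\<close>.
\<close>

lemma ext_conn_Un:
  assumes A: "ext_conn d A" and B: "ext_conn d B" and AB: "d > 0 \<Longrightarrow> ext_conn (d - 1) (A \<inter> B)"
    and dA: "down_closed A" and dB: "down_closed B"
  shows "ext_conn d (A \<union> B)"
  unfolding ext_conn_def
proof (intro allI impI, elim conjE)
  fix J c
  assume J: "finite J" "card J \<le> d" and c: "coloring (cube_boundary 1 J) (A \<union> B) c"
  show "\<exists>c'. coloring (cube 1 J) (A \<union> B) c' \<and> (\<forall>x\<in>cube_boundary 1 J. c' x = c x)"
  proof (cases "J = {}")
    case True
    obtain s where "s \<in> A" "finite s" using ext_conn_nonempty[OF A] .
    then have "coloring (cube 1 J) (A \<union> B) (\<lambda>_. s)"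
      by (intro coloring_const closed_cube) auto
    moreover have "cube_boundary 1 J = {}"
      using True unfolding cube_boundary_def by simp
    ultimately show ?thesis by blast
  next
    case False
    then have "card J > 0" using J by auto
    then have d: "d > 0" using J by linarith
    note AB = AB[OF d]
    \<comment> \<open>The common final value of all contractions; it has to lie in both
      complexes.\<close>
    obtain s where s: "s \<in> A" "s \<in> B" "finite s" using ext_conn_nonempty[OF AB] by blast
    obtain N :: nat where N: "N > 0" "\<And>x y. x \<in> cube_boundary 1 J \<Longrightarrow> y \<in> cube_boundary 1 J \<Longrightarrow>
        (\<forall>i. \<bar>x i - y i\<bar> \<le> 1 / real N) \<Longrightarrow> c x \<in> A \<or> c y \<in> B"
      using lebesgue_coloring[OF compact_cube_boundary[OF J(1)] c dA dB] by blast
    define P where "P = cube_boundary (real N) J"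
    define sc where "sc x = (\<lambda>i. x i / real N)" for x :: "nat \<Rightarrow> real"
    have sc: "sc x \<in> cube_boundary 1 J" if "x \<in> P" for x
    proof -
      obtain i where "i \<in> J" "\<bar>x i\<bar> = real N" using \<open>x \<in> P\<close> unfolding P_def cube_boundary_def by blast
      then show ?thesis
        using that N(1) unfolding P_def sc_def cube_boundary_def cube_mem_iff
        by (intro CollectI conjI bexI[of _ i]) (auto simp: abs_divide)
    qed
    have celP: "cellular P" unfolding P_def using J by (intro cellular_cube_boundary)
    have ctsc: "continuous_on S sc" for S
      unfolding sc_def using N(1)
      by (intro continuous_on_coordinatewise_then_product continuous_on_divide continuous_on_const continuous_on_coord) auto
    define c1 where "c1 x = c (sc x)" for x
    have c1: "coloring P (A \<union> B) c1"
      unfolding c1_def using sc by (intro coloring_pullback[OF c] cellular_closed[OF celP] ctsc)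
    define PA where "PA = {x \<in> P. \<forall>y\<in>cell x. c1 y \<in> A}"
    define PB where "PB = (\<Union>x\<in>P - PA. cell x)"
    have cellP: "y \<in> P" if "x \<in> P" "y \<in> cell x" for x y
      using celP that unfolding cellular_def by blast
    have celPA: "cellular PA"
      by (rule cellular_subset[OF celP]) (use cell_subset cellP in \<open>unfold PA_def, blast+\<close>)
    have celPB: "cellular PB"
      by (rule cellular_subset[OF celP]) (use cell_subset cellP in \<open>unfold PB_def, blast+\<close>)
    have PAB: "P = PA \<union> PB"
      using cellP mem_cell_self unfolding PA_def PB_def by blast
    have inA: "c1 y \<in> A" if "y \<in> PA" for y
      using that unfolding PA_def by auto
    have inB: "c1 y \<in> B" if "y \<in> PB" for y
    proof -
      obtain x where x: "x \<in> P" "x \<notin> PA" "y \<in> cell x" using \<open>y \<in> PB\<close> unfolding PB_def by auto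
      \<comment> \<open>The cell of \<open>x\<close> leaves \<open>A\<close> at some
        \<open>z\<close>. After scaling, \<open>z\<close> and \<open>y\<close> differ by at most
        \<open>1 / N\<close> in each coordinate, so the choice of \<open>N\<close> puts the color of
        \<open>y\<close> in \<open>B\<close>.\<close>
      then obtain z where z: "z \<in> cell x" "c1 z \<notin> A" unfolding PA_def by auto
      have "\<bar>sc z i - sc y i\<bar> \<le> 1 / real N" for i
      proof -
        have "\<bar>z i - y i\<bar> \<le> 1"
          using cell_bounds[OF z(1), of i] cell_bounds[OF x(3), of i] by linarith
        then have "\<bar>z i - y i\<bar> / real N \<le> 1 / real N"
          by (rule divide_right_mono) simp
        then show ?thesis unfolding sc_def by (simp add: diff_divide_distrib[symmetric] abs_divide)
      qed
      then show ?thesis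
        using N(2)[of "sc z" "sc y"] sc cellP x z unfolding c1_def by blast
    qed
    define Q where "Q = PA \<inter> PB"
    have celQ: "cellular Q" unfolding Q_def by (rule cellular_Int[OF celPA celPB])
    \<comment> \<open>On the boundary some coordinate is \<open>N\<close> or \<open>- N\<close>; so
      the cells of \<open>P\<close> have dimension at most \<open>d - 1\<close>, which leaves one
      dimension for the time.\<close>
    have nP: "nonint x \<subset> J" if "x \<in> P" for x
    proof -
      obtain i where i: "i \<in> J" "\<bar>x i\<bar> = real N" using \<open>x \<in> P\<close> unfolding P_def cube_boundary_def by blast
      then have "x i = real N \<or> x i = - real N" by linarith
      then have "i \<notin> nonint x" unfolding nonint_def by auto
      moreover have "nonint x \<subseteq> J"
        using that unfolding P_def cube_boundary_def cube_mem_iff nonint_def by auto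
      ultimately show ?thesis using i by blast
    qed
    have cP: "finite (nonint x) \<and> card (nonint x) + 1 \<le> d" if "x \<in> P" for x
      using psubset_card_mono[OF J(1) nP[OF that]] J finite_subset[of "nonint x" J] nP[OF that] by auto
    \<comment> \<open>A cell of \<open>Q\<close> is a proper face of a cell of \<open>P\<close>
      outside \<open>PA\<close>, so it loses one dimension more. Its cylinder has dimension at most
      \<open>d - 1\<close>, which is what the hypothesis on \<open>A \<inter> B\<close> can
      fill.\<close>
    have cQ: "card (nonint y) + 1 \<le> d - 1" if "y \<in> Q" for y
    proof -
      obtain x where x: "x \<in> P" "x \<notin> PA" "y \<in> cell x" using \<open>y \<in> Q\<close> unfolding Q_def PB_def by auto
      have "nonint y \<noteq> nonint x"
      proof
        assume "nonint y = nonint x"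
        then have "carrier_cell x = carrier_cell y" using carrier_cell_eqI[OF x(3)] by simp
        then have "x \<in> PA" using cellular_mem[OF celPA, of y x] that unfolding Q_def by auto
        then show False using x by simp
      qed
      then have "card (nonint y) < card (nonint x)"
        using nonint_mono[OF x(3)] cP[OF x(1)] by (intro psubset_card_mono) auto
      then show ?thesis using cP[OF x(1)] by linarith
    qed
    obtain k where k: "k \<notin> J" using ex_new_if_finite[OF _ J(1)] by auto
    have Pk: "x k = 0" if "x \<in> P" for x
      using that k unfolding P_def cube_boundary_def by (auto dest: cube_out)
    define c0 where "c0 x = (if x k = 0 then c1 (x(k := 0)) else s)" for x :: "nat \<Rightarrow> real"
    have sub: "PA \<subseteq> P" "PB \<subseteq> P" "Q \<subseteq> PA" "Q \<subseteq> PB" "Q \<subseteq> P"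
      using PAB unfolding Q_def by auto
    have cylfin: "finite (nonint x)" "card (nonint x) \<le> card (nonint (x(k := 0))) + 1" if "x \<in> cylinder k P" for x
    proof -
      have f: "finite (nonint (x(k := 0)))" using cP that unfolding cylinder_def by blast
      then show "finite (nonint x)" using nonint_cylinder[of x k] by (meson finite_insert finite_subset)
      have "card (nonint x) \<le> card (insert k (nonint (x(k := 0))))"
        using f nonint_cylinder[of x k] by (intro card_mono) auto
      also have "\<dots> \<le> card (nonint (x(k := 0))) + 1"
        using f by (simp add: card_insert_if)
      finally show "card (nonint x) \<le> card (nonint (x(k := 0))) + 1" .
    qed
    have cylmono: "cylinder k X \<subseteq> cylinder k Y" "cylinder_ends k X \<subseteq> cylinder_ends k Y" if "X \<subseteq> Y" for X Y
      using that unfolding cylinder_def cylinder_ends_def by auto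
    have c0ends: "coloring (cylinder_ends k X) C c0"
      if "X \<subseteq> P" "cellular X" "\<And>x. x \<in> X \<Longrightarrow> c1 x \<in> C" "s \<in> C" for X C
    proof -
      have "coloring X C c1"
        using coloring_subset[OF c1 that(1) cellular_closed[OF that(2)]] that(3) by (rule coloring_range)
      then show ?thesis
        using coloring_cylinder_ends[OF _ cellular_closed[OF that(2)] that(4) s(3), of c1 k] unfolding c0_def by blast
    qed
    have "\<exists>c'. coloring (cylinder k Q) (A \<inter> B) c' \<and> (\<forall>x\<in>cylinder_ends k Q. c' x = c0 x)"
    proof (rule ext_cellular[OF AB cellular_cylinder[OF celQ] cellular_cylinder_ends[OF celQ] cylinder_ends_subset])
      show "coloring (cylinder_ends k Q) (A \<inter> B) c0"
        using inA inB s sub by (intro c0ends celQ) (auto simp: Q_def)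
      show "finite (nonint x)" if "x \<in> cylinder k Q" for x
        using cylfin that cylmono[OF sub(5)] by blast
      show "card (nonint x) \<le> d - 1" if "x \<in> cylinder k Q" for x
        using cylfin(2)[of x] cQ[of "x(k := 0)"] that cylmono[OF sub(5)] unfolding cylinder_def by fastforce
    qed
    then obtain cQ where cQ: "coloring (cylinder k Q) (A \<inter> B) cQ" "\<And>x. x \<in> cylinder_ends k Q \<Longrightarrow> cQ x = c0 x"
      by blast
    \<comment> \<open>The contraction over \<open>Q\<close> is among the prescribed values for both
      halves, which forces the two results to agree on the overlap.\<close>
    define c2 where "c2 x = (if x \<in> cylinder k Q then cQ x else c0 x)" for x
    have half: "\<exists>c'. coloring (cylinder k X) C c' \<and> (\<forall>x\<in>cylinder_ends k X \<union> cylinder k Q. c' x = c2 x)"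
      if C: "ext_conn d C" "A \<inter> B \<subseteq> C" and X: "X \<subseteq> P" "cellular X" "Q \<subseteq> X"
        and c1X: "\<And>x. x \<in> X \<Longrightarrow> c1 x \<in> C" for X C
    proof (rule ext_cellular[OF C(1) cellular_cylinder[OF X(2)]])
      show "cellular (cylinder_ends k X \<union> cylinder k Q)"
        by (intro cellular_Un cellular_cylinder_ends cellular_cylinder X celQ)
      show "cylinder_ends k X \<union> cylinder k Q \<subseteq> cylinder k X"
        using cylinder_ends_subset cylmono[OF X(3)] by blast
      show "coloring (cylinder_ends k X \<union> cylinder k Q) C c2"
      proof (rule coloring_paste)
        show "coloring (cylinder_ends k X) C c0" using X c1X s C by (intro c0ends) auto
        show "coloring (cylinder k Q) C cQ" using coloring_mono[OF cQ(1) C(2)] .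
        show "c2 x = c0 x" if "x \<in> cylinder_ends k X" for x
        proof (cases "x \<in> cylinder k Q")
          case True
          then have "x \<in> cylinder_ends k Q" using that unfolding cylinder_ends_def cylinder_def by auto
          then show ?thesis using cQ(2) unfolding c2_def by simp
        qed (simp add: c2_def)
      qed (simp add: c2_def)
      show "finite (nonint x)" if "x \<in> cylinder k X" for x
        using cylfin that cylmono[OF X(1)] by blast
      show "card (nonint x) \<le> d" if "x \<in> cylinder k X" for x
        using cylfin(2)[of x] cP[of "x(k := 0)"] that cylmono[OF X(1)] X(1) unfolding cylinder_def by fastforce
    qed
    obtain cA where cA: "coloring (cylinder k PA) A cA" "\<And>x. x \<in> cylinder_ends k PA \<union> cylinder k Q \<Longrightarrow> cA x = c2 x"
      using half[OF A _ sub(1) celPA sub(3) inA] by blast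
    obtain cB where cB: "coloring (cylinder k PB) B cB" "\<And>x. x \<in> cylinder_ends k PB \<union> cylinder k Q \<Longrightarrow> cB x = c2 x"
      using half[OF B _ sub(2) celPB sub(4) inB] by blast
    define c3 where "c3 x = (if x \<in> cylinder k PA then cA x else cB x)" for x
    have c3B: "c3 x = cB x" if "x \<in> cylinder k PB" for x
    proof (cases "x \<in> cylinder k PA")
      case True
      then have "x \<in> cylinder k Q" using that unfolding cylinder_def Q_def by auto
      then show ?thesis using cA(2) cB(2) True unfolding c3_def by auto
    qed (simp add: c3_def)
    have c3A: "c3 x = cA x" if "x \<in> cylinder k PA" for x
      using that unfolding c3_def by simp
    have "coloring (cylinder k PA \<union> cylinder k PB) (A \<union> B) c3"
      by (rule coloring_paste[OF coloring_mono[OF cA(1)] coloring_mono[OF cB(1)] c3A c3B]) auto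
    moreover have "cylinder k PA \<union> cylinder k PB = cylinder k P"
      unfolding PAB cylinder_def by auto
    ultimately have c3: "coloring (cylinder k P) (A \<union> B) c3" by simp
    have c3e: "c3 x = c0 x" if "x \<in> cylinder_ends k P" for x
    proof -
      have "c2 x = c0 x"
      proof (cases "x \<in> cylinder k Q")
        case True
        then have "x \<in> cylinder_ends k Q" using that unfolding cylinder_ends_def cylinder_def by auto
        then show ?thesis using cQ(2) unfolding c2_def by simp
      qed (simp add: c2_def)
      moreover consider "x \<in> cylinder_ends k PA" | "x \<in> cylinder_ends k PB"
        using \<open>x \<in> cylinder_ends k P\<close> unfolding PAB cylinder_ends_def by blast
      then have "c3 x = c2 x"
      proof cases
        case 1
        then show ?thesis using c3A cA(2) cylinder_ends_subset[of k PA] by (simp add: subset_iff)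
      next
        case 2
        then show ?thesis using c3B cB(2) cylinder_ends_subset[of k PB] by (simp add: subset_iff)
      qed
      ultimately show ?thesis by simp
    qed
    \<comment> \<open>Undoes the scaling by \<open>N\<close> and stores the time in coordinate
      \<open>k\<close>.\<close>
    define g where "g p = (\<lambda>i. fst p i * real N)(k := snd p)" for p :: "(nat \<Rightarrow> real) \<times> real"
    have gP: "(\<lambda>i. x i * real N) \<in> P" if "x \<in> cube_boundary 1 J" for x
    proof -
      obtain i where "i \<in> J" "\<bar>x i\<bar> = 1" using \<open>x \<in> cube_boundary 1 J\<close> unfolding cube_boundary_def by blast
      then show ?thesis
        using that unfolding P_def cube_boundary_def cube_mem_iff
        by (intro CollectI conjI bexI[of _ i]) (auto simp: abs_mult mult_left_le_one_le)
    qed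
    have g0: "(g p)(k := 0) = (\<lambda>i. fst p i * real N)" if "fst p \<in> cube_boundary 1 J" for p
      using Pk[OF gP[OF that]] unfolding g_def by auto
    have gk: "g p k = snd p" for p
      unfolding g_def by simp
    have "coloring (cube_boundary 1 J \<times> {0..1}) (A \<union> B) (\<lambda>p. c3 (g p))"
    proof (rule coloring_pullback[OF c3])
      show "closed (cube_boundary 1 J \<times> {0..1::real})"
        by (intro closed_Times closed_cube_boundary J) simp
      show "continuous_on (cube_boundary 1 J \<times> {0..1}) g"
      proof (rule continuous_on_coordinatewise_then_product)
        fix i
        have "continuous_on S (\<lambda>p :: (nat \<Rightarrow> real) \<times> real. fst p i)" for S
          by (rule continuous_on_product_then_coordinatewise[OF continuous_on_fst[OF continuous_on_id]])
        then show "continuous_on (cube_boundary 1 J \<times> {0..1}) (\<lambda>p. g p i)"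
          unfolding g_def by (cases "i = k") (simp_all add: continuous_on_mult_right continuous_on_snd continuous_on_id)
      qed
      show "g p \<in> cylinder k P" if "p \<in> cube_boundary 1 J \<times> {0..1}" for p
        using that g0[of p] gP[of "fst p"] unfolding cylinder_def by (auto simp: gk)
    qed
    moreover have "c3 (g (x, 0)) = c x" if "x \<in> cube_boundary 1 J" for x
    proof -
      have "g (x, 0) \<in> cylinder_ends k P"
        using g0[of "(x, 0)"] gP[OF that] that unfolding cylinder_ends_def by (auto simp: gk)
      then have "c3 (g (x, 0)) = c1 ((g (x, 0))(k := 0))"
        using c3e unfolding c0_def by (simp add: gk)
      also have "\<dots> = c x"
        using g0[of "(x, 0)"] that N(1) unfolding c1_def sc_def by simp
      finally show ?thesis .
    qed
    moreover have "c3 (g (x, 1)) = s" if "x \<in> cube_boundary 1 J" for x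
    proof -
      have "g (x, 1) \<in> cylinder_ends k P"
        using g0[of "(x, 1)"] gP[OF that] that unfolding cylinder_ends_def by (auto simp: gk)
      then show ?thesis
        using c3e unfolding c0_def by (simp add: gk)
    qed
    ultimately show ?thesis
      using s by (intro null_ext[where s = s and h = "\<lambda>p. c3 (g p)", OF J(1) False]) auto
  qed
qed

section \<open>Clique complexes with common neighbours\<close>

lemma ext_conn_0:
  assumes "s \<in> A" "finite s"
  shows "ext_conn 0 A"
  unfolding ext_conn_def
proof (intro allI impI, elim conjE)
  fix J :: "nat set" and c :: "(nat \<Rightarrow> real) \<Rightarrow> 'a set" assume "finite J" "card J \<le> 0"
  then have "cube_boundary 1 J = {}" unfolding cube_boundary_def by simp
  moreover have "coloring (cube 1 J) A (\<lambda>_. s)"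
    using assms by (intro coloring_const closed_cube)
  ultimately show "\<exists>c'. coloring (cube 1 J) A c' \<and> (\<forall>x\<in>cube_boundary 1 J. c' x = c x)" by blast
qed

text \<open>\<open>R\<close> stands for adjacency made reflexive. A vertex then counts as its own
  neighbour, so a common neighbour \<open>w\<close> of \<open>S\<close> is also one of
  \<open>insert w S\<close> and can serve as a cone point.\<close>

definition cliques :: "('v \<Rightarrow> 'v \<Rightarrow> bool) \<Rightarrow> 'v set \<Rightarrow> 'v set set" where
  "cliques R W = {s. finite s \<and> s \<noteq> {} \<and> s \<subseteq> W \<and> (\<forall>u\<in>s. \<forall>v\<in>s. R u v)}"

definition common_nbrs :: "'v set \<Rightarrow> ('v \<Rightarrow> 'v \<Rightarrow> bool) \<Rightarrow> 'v set \<Rightarrow> 'v set" where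
  "common_nbrs V R S = {v \<in> V. \<forall>s\<in>S. R s v}"

lemma down_closed_cliques: "down_closed (cliques R W)"
  unfolding down_closed_def cliques_def by (auto intro: finite_subset)

lemma down_closed_UN: "(\<And>w. w \<in> F \<Longrightarrow> down_closed (A w)) \<Longrightarrow> down_closed (\<Union>w\<in>F. A w)"
  unfolding down_closed_def by blast

lemma ext_conn_cliques:
  fixes R :: "'v \<Rightarrow> 'v \<Rightarrow> bool"
  assumes refl: "\<And>v. R v v" and sym: "\<And>u v. R u v \<Longrightarrow> R v u"
    and nbr: "\<And>S. finite S \<Longrightarrow> S \<subseteq> V \<Longrightarrow> card S \<le> n \<Longrightarrow> common_nbrs V R S \<noteq> {}"
    and S: "finite S" "S \<subseteq> V" "card S + 2 * d \<le> n"
  shows "ext_conn d (cliques R (common_nbrs V R S))"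
proof -
  define L where "L S = cliques R (common_nbrs V R S)" for S
  define U where "U S F = (\<Union>w\<in>F. L (insert w S))" for S F
  text \<open>
    \<open>L S\<close> is covered by the sets \<open>L (insert w S)\<close> with \<open>w\<close> in \<open>common_nbrs V R S\<close>, which are cones, and finitely many of
    them suffice for a given coloring. The intersection of \<open>L (insert w S)\<close> with a union \<open>U S F\<close> is \<open>U (insert w S) F\<close>,
    which allows an induction on \<open>d\<close> through repeated use of \<open>ext_conn_Un\<close>.
  \<close>
  have star: "ext_conn d (L (insert w S))" if "w \<in> common_nbrs V R S" for w S d
  proof (rule ext_conn_cone[where v = w])
    show "{w} \<in> L (insert w S)"
      using that refl unfolding L_def cliques_def common_nbrs_def by auto
    show "insert w s \<in> L (insert w S)" if s: "s \<in> L (insert w S)" for s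
      using s \<open>w \<in> common_nbrs V R S\<close> refl sym unfolding L_def cliques_def common_nbrs_def by auto
  qed
  have dL: "down_closed (L S)" for S unfolding L_def by (rule down_closed_cliques)
  have dU: "down_closed (U S F)" for S F unfolding U_def by (intro down_closed_UN dL)
  have L_Int: "L S \<inter> L T = L (S \<union> T)" for S T
    unfolding L_def cliques_def common_nbrs_def by auto
  have U_insert: "U S (insert w F) = L (insert w S) \<union> U S F" for S w F
    unfolding U_def by simp
  have U_Int: "L (insert w S) \<inter> U S F = U (insert w S) F" for S w F
  proof -
    have "L (insert w S) \<inter> U S F = (\<Union>u\<in>F. L (insert w S) \<inter> L (insert u S))"
      unfolding U_def by blast
    also have "\<dots> = (\<Union>u\<in>F. L (insert u (insert w S)))"
      unfolding L_Int by (intro SUP_cong refl arg_cong[of _ _ L]) auto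
    finally show ?thesis unfolding U_def .
  qed
  \<comment> \<open>The second claim does not ask \<open>F\<close> to consist of common neighbours
    of \<open>S\<close>: in \<open>U (insert w S) F\<close> the other elements of \<open>F\<close>
    need not be adjacent to \<open>w\<close>. Its pieces may fail to be cones and are handled by the
    first claim for \<open>insert w S\<close>, at the price of one more vertex. The first claim for
    \<open>Suc d\<close> and \<open>S\<close> uses the second for \<open>d\<close> and
    \<open>insert w S\<close>, and
    \<open>(card S + 1) + 2 * d + 1 = card S + 2 * Suc d\<close>.\<close>
  have "(\<forall>S. finite S \<and> S \<subseteq> V \<and> card S + 2 * d \<le> n \<longrightarrow> ext_conn d (L S)) \<and>
        (\<forall>S F. finite S \<and> S \<subseteq> V \<and> card S + 2 * d + 1 \<le> n \<and> finite F \<and> F \<noteq> {} \<and> F \<subseteq> V \<longrightarrow> ext_conn d (U S F))"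
    (is "?E d \<and> ?H d")
  proof (induction d)
    case 0
    have E: "?E 0"
    proof (intro allI impI, elim conjE)
      fix S :: "'v set" assume "finite S" "S \<subseteq> V" "card S + 2 * 0 \<le> n"
      then obtain v where "v \<in> common_nbrs V R S" using nbr[of S] by auto
      then have "{v} \<in> L S" using refl unfolding L_def cliques_def by auto
      then show "ext_conn 0 (L S)" by (rule ext_conn_0) simp
    qed
    have "?H 0"
    proof (intro allI impI, elim conjE)
      fix S F :: "'v set" assume S: "finite S" "S \<subseteq> V" "card S + 2 * 0 + 1 \<le> n" and "F \<noteq> {}" "F \<subseteq> V"
      then obtain w where w: "w \<in> F" "w \<in> V" by auto
      have "card (insert w S) + 2 * 0 \<le> n" using S by (simp add: card_insert_if)
      then have "ext_conn 0 (L (insert w S))" using E S w by auto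
      then obtain s where "s \<in> L (insert w S)" "finite s" by (rule ext_conn_nonempty)
      then show "ext_conn 0 (U S F)" using w unfolding U_def by (intro ext_conn_0[of s]) auto
    qed
    with E show ?case by simp
  next
    case (Suc d)
    have E: "?E (Suc d)"
    proof (intro allI impI, elim conjE)
      fix S :: "'v set" assume S: "finite S" "S \<subseteq> V" "card S + 2 * Suc d \<le> n"
      show "ext_conn (Suc d) (L S)"
        unfolding ext_conn_def
      proof (intro allI impI, elim conjE)
        fix J c
        assume J: "finite J" "card J \<le> Suc d" and c: "coloring (cube_boundary 1 J) (L S) c"
        show "\<exists>c'. coloring (cube 1 J) (L S) c' \<and> (\<forall>x\<in>cube_boundary 1 J. c' x = c x)"
        proof (cases "cube_boundary 1 J = {}")
          case True
          obtain v where "v \<in> common_nbrs V R S" using nbr[of S] S by auto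
          then have "{v} \<in> L S" using refl unfolding L_def cliques_def by auto
          then have "coloring (cube 1 J) (L S) (\<lambda>_. {v})"
            by (intro coloring_const closed_cube) auto
          with True show ?thesis by blast
        next
          case False
          obtain F0 where F0: "finite F0" "\<And>x. x \<in> cube_boundary 1 J \<Longrightarrow> c x \<subseteq> F0"
            using c unfolding coloring_def by blast
          \<comment> \<open>Any vertex \<open>w\<close> of \<open>c x\<close> is a common neighbour
            of \<open>S\<close> and belongs to the finite palette, and \<open>c x\<close> lies in
            the cone with apex \<open>w\<close>. So the cones over \<open>F\<close> contain all
            values of \<open>c\<close>.\<close>
          define F where "F = F0 \<inter> common_nbrs V R S"
          have F: "finite F" "F \<subseteq> V" "\<And>w. w \<in> F \<Longrightarrow> w \<in> common_nbrs V R S"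
            using F0(1) unfolding F_def common_nbrs_def by auto
          have cU: "c x \<in> U S F" if x: "x \<in> cube_boundary 1 J" for x
          proof -
            have cx: "c x \<in> L S" using coloring_mem[OF c x] .
            then obtain w where w: "w \<in> c x" unfolding L_def cliques_def by blast
            then have "w \<in> F" using F0(2)[OF x] cx unfolding F_def L_def cliques_def by blast
            moreover have "c x \<in> L (insert w S)"
              using cx w unfolding L_def cliques_def common_nbrs_def by blast
            ultimately show ?thesis unfolding U_def by blast
          qed
          have "F \<noteq> {}" using False cU unfolding U_def by blast
          have "ext_conn (Suc d) (U S F)"
            using F(1) \<open>F \<noteq> {}\<close> F(2,3)
          proof (induction F rule: finite_ne_induct)
            case (singleton w)
            then show ?case using star[of w S "Suc d"] unfolding U_def by simp
          next
            case (insert w F)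
            have "card (insert w S) + 2 * d + 1 \<le> n" using S by (simp add: card_insert_if)
            then have "ext_conn d (U (insert w S) F)"
              using Suc S insert by simp
            then show ?case
              unfolding U_insert using insert U_Int[of w S F]
              by (intro ext_conn_Un star dL dU) auto
          qed
          moreover have "coloring (cube_boundary 1 J) (U S F) c"
            using c cU by (rule coloring_range)
          ultimately obtain c' where c': "coloring (cube 1 J) (U S F) c'"
            "\<And>x. x \<in> cube_boundary 1 J \<Longrightarrow> c' x = c x"
            using ext_connD[OF _ J] by blast
          moreover have "U S F \<subseteq> L S"
            unfolding U_def L_def cliques_def common_nbrs_def by blast
          ultimately show ?thesis using coloring_mono by blast
        qed
      qed
    qed
    have "?H (Suc d)"
    proof (intro allI impI, elim conjE)
      fix S F :: "'v set"
      assume S: "finite S" "S \<subseteq> V" "card S + 2 * Suc d + 1 \<le> n" and F: "finite F" "F \<noteq> {}" "F \<subseteq> V"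
      have LS: "ext_conn (Suc d) (L (insert w S))" if "w \<in> V" for w
      proof -
        have "card (insert w S) + 2 * Suc d \<le> n" using S by (simp add: card_insert_if)
        then show ?thesis using E S that by simp
      qed
      show "ext_conn (Suc d) (U S F)"
        using F
      proof (induction F rule: finite_ne_induct)
        case (singleton w)
        then show ?case using LS unfolding U_def by simp
      next
        case (insert w F)
        have "card (insert w S) + 2 * d + 1 \<le> n" using S by (simp add: card_insert_if)
        then have "ext_conn d (U (insert w S) F)"
          using Suc S insert by simp
        then show ?case
          unfolding U_insert using insert U_Int[of w S F]
          by (intro ext_conn_Un LS dL dU) auto
      qed
    qed
    with E show ?case by blast
  qed
  then show ?thesis using S unfolding L_def by blast
qed

section \<open>From colorings to maps into the realization\<close>

lemma positive_lower_bound: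
  fixes f :: "'p::topological_space \<Rightarrow> real"
  assumes "compact K" "continuous_on K f" "\<And>x. x \<in> K \<Longrightarrow> 0 < f x"
  shows "\<exists>e>0. \<forall>x\<in>K. e \<le> f x"
proof (cases "K = {}")
  case True
  then show ?thesis by (intro exI[of _ 1]) auto
next
  case False
  then obtain x where "x \<in> K" "\<forall>y\<in>K. f x \<le> f y"
    using continuous_attains_inf[OF assms(1) _ assms(2)] by blast
  then show ?thesis using assms(3) by blast
qed

lemma uniform_positive:
  assumes "finite I" "\<And>i. i \<in> I \<Longrightarrow> \<exists>e>0. \<forall>x\<in>K i. e \<le> (f i x :: real)"
  shows "\<exists>e>0. \<forall>i\<in>I. \<forall>x\<in>K i. e \<le> f i x"
  using assms
proof (induction I rule: finite_induct)
  case empty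
  then show ?case by (intro exI[of _ 1]) auto
next
  case (insert i I)
  obtain e1 where "e1 > 0" "\<forall>x\<in>K i. e1 \<le> f i x" using insert.prems[of i] by auto
  moreover have "\<exists>e>0. \<forall>i\<in>I. \<forall>x\<in>K i. e \<le> f i x" using insert.prems by (intro insert.IH) auto
  then obtain e2 where "e2 > 0" "\<forall>i\<in>I. \<forall>x\<in>K i. e2 \<le> f i x" by blast
  ultimately show ?case by (intro exI[of _ "min e1 e2"]) fastforce
qed

text \<open>Each color class gets a bump function of width \<open>e\<close>, and the bumps are
  normalised. For a non-simplex \<open>s\<close> no point of \<open>Q\<close> lies in all classes of
  \<open>s\<close>, so by compactness the average distance to them is bounded below; with
  \<open>e\<close> at most that bound, the bumps positive at one point form a simplex. The sets
  \<open>Z v\<close> prescribe where the function of \<open>v\<close> has to vanish.\<close>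

lemma coloring_partition_of_unity:
  fixes Q :: "'p::metric_space set"
  assumes Q: "compact Q" and c: "coloring Q A c" and A: "down_closed A"
    and Z: "\<And>v. compact (Z v)" "\<And>v. Z v \<inter> {x \<in> Q. v \<in> c x} = {}"
  shows "\<exists>(g :: 'p \<Rightarrow> 'v \<Rightarrow> real) F. finite F \<and> (\<forall>v. continuous_on Q (\<lambda>x. g x v)) \<and>
    (\<forall>x\<in>Q. \<forall>v. 0 \<le> g x v) \<and> (\<forall>x\<in>Q. {v. g x v \<noteq> 0} \<in> A) \<and>
    (\<forall>x\<in>Q. {v. g x v \<noteq> 0} \<subseteq> F) \<and> (\<forall>x\<in>Q. sum (g x) F = 1) \<and>
    (\<forall>v. \<forall>x\<in>Q \<inter> Z v. g x v = 0)"
proof -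
  obtain F where F: "finite F" "\<And>x. x \<in> Q \<Longrightarrow> c x \<subseteq> F" and cA: "\<And>x. x \<in> Q \<Longrightarrow> c x \<in> A"
    and cl: "\<And>v. closed {x \<in> Q. v \<in> c x}"
    using c by (rule coloringE) blast
  define C where "C v = {x \<in> Q. v \<in> c x}" for v
  have clC: "closed (C v)" for v unfolding C_def by (rule cl)
  \<comment> \<open>Colors with empty class are dropped, because \<open>infdist\<close> to the empty
    set is 0 and would look like membership.\<close>
  define G where "G = {v \<in> F. C v \<noteq> {}}"
  have G: "finite G" using F unfolding G_def by simp
  have cG: "c x \<subseteq> G" if "x \<in> Q" for x
    using F(2)[OF that] that unfolding G_def C_def by auto
  have contC: "continuous_on S (\<lambda>x. infdist x (C v))" for S v
    by (intro continuous_intros)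
  have zero: "infdist x (C v) = 0 \<longleftrightarrow> x \<in> C v" if "v \<in> G" for x v
    using that clC[of v] unfolding G_def by (simp add: in_closed_iff_infdist_zero)
  have pos: "0 < infdist x (C v)" if "v \<in> G" "x \<notin> C v" for x v
    using zero[OF that(1), of x] that(2) infdist_nonneg[of x "C v"] by linarith
  have "\<exists>e>0. \<forall>v\<in>G. \<forall>x\<in>Z v. e \<le> infdist x (C v)"
  proof (rule uniform_positive[OF G])
    fix v assume v: "v \<in> G"
    have "0 < infdist x (C v)" if "x \<in> Z v" for x
      using Z(2)[of v] that by (intro pos[OF v]) (auto simp: C_def)
    then show "\<exists>e>0. \<forall>x\<in>Z v. e \<le> infdist x (C v)"
      by (intro positive_lower_bound Z(1) contC)
  qed
  then obtain e1 where e1: "e1 > 0" "\<And>v x. v \<in> G \<Longrightarrow> x \<in> Z v \<Longrightarrow> e1 \<le> infdist x (C v)" by blast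
  have "\<exists>e>0. \<forall>s\<in>Pow G - A - {{}}. \<forall>x\<in>Q. e \<le> (\<Sum>v\<in>s. infdist x (C v)) / card s"
  proof (rule uniform_positive)
    show "finite (Pow G - A - {{}})" using G by simp
    fix s assume s: "s \<in> Pow G - A - {{}}"
    have fs: "finite s" using s G finite_subset by auto
    have "0 < (\<Sum>v\<in>s. infdist x (C v)) / card s" if x: "x \<in> Q" for x
    proof -
      have "\<exists>v\<in>s. x \<notin> C v"
      proof (rule ccontr)
        assume "\<not> ?thesis"
        then have "s \<subseteq> c x" unfolding C_def by auto
        then have "s \<in> A" using A cA[OF x] s unfolding down_closed_def by blast
        then show False using s by blast
      qed
      then obtain v where v: "v \<in> s" "x \<notin> C v" by blast
      have "0 < infdist x (C v)" using pos v s by blast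
      also have "\<dots> \<le> (\<Sum>v\<in>s. infdist x (C v))"
        using v fs by (intro member_le_sum) (auto simp: infdist_nonneg)
      finally have "0 < (\<Sum>v\<in>s. infdist x (C v))" .
      moreover have "0 < real (card s)" using fs v by (auto simp: card_gt_0_iff)
      ultimately show ?thesis by (rule divide_pos_pos)
    qed
    then show "\<exists>e>0. \<forall>x\<in>Q. e \<le> (\<Sum>v\<in>s. infdist x (C v)) / card s"
      by (intro positive_lower_bound Q continuous_on_divide continuous_on_sum continuous_on_const contC)
         (use fs s in auto)
  qed
  then obtain e2 where e2: "e2 > 0"
    "\<And>s x. s \<subseteq> G \<Longrightarrow> s \<notin> A \<Longrightarrow> s \<noteq> {} \<Longrightarrow> x \<in> Q \<Longrightarrow> e2 \<le> (\<Sum>v\<in>s. infdist x (C v)) / card s"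
    by blast
  define e where "e = min e1 e2"
  have e: "e > 0" "e \<le> e1" "e \<le> e2" using e1 e2 unfolding e_def by auto
  define h where "h x v = (if v \<in> G then max 0 (e - infdist x (C v)) else 0)" for x v
  define g where "g x v = h x v / sum (h x) G" for x v
  have h0: "0 \<le> h x v" for x v unfolding h_def by simp
  have hc: "h x v > 0" if "x \<in> Q" "v \<in> c x" for x v
  proof -
    have "v \<in> G" "x \<in> C v" using cG that unfolding C_def by auto
    then show ?thesis using zero[of v x] e unfolding h_def by simp
  qed
  have sumpos: "sum (h x) G > 0" if x: "x \<in> Q" for x
  proof -
    have "c x \<noteq> {}" using cA[OF x] A unfolding down_closed_def by auto
    then obtain v where v: "v \<in> c x" by blast
    then have "v \<in> G" using cG x by blast
    then have "h x v \<le> sum (h x) G" using G h0 by (intro member_le_sum) auto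
    then show ?thesis using hc[OF x v] by linarith
  qed
  have conth: "continuous_on Q (\<lambda>x. h x v)" for v
    unfolding h_def by (cases "v \<in> G") (auto intro!: continuous_on_max continuous_on_diff continuous_on_const contC)
  show ?thesis
  proof (intro exI conjI allI ballI)
    show "finite G" by (rule G)
    show "continuous_on Q (\<lambda>x. g x v)" for v
      unfolding g_def
      by (intro continuous_on_divide conth continuous_on_sum) (use sumpos in fastforce)
    show "0 \<le> g x v" if "x \<in> Q" for x v
      unfolding g_def using h0 by (simp add: sum_nonneg)
    show "{v. g x v \<noteq> 0} \<subseteq> G" if "x \<in> Q" for x
      unfolding g_def h_def by auto
    show "sum (g x) G = 1" if "x \<in> Q" for x
      unfolding g_def using sumpos[OF that] by (simp add: sum_divide_distrib[symmetric])
    show "g x v = 0" if "x \<in> Q \<inter> Z v" for x v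
    proof (cases "v \<in> G")
      case True
      then have "e \<le> infdist x (C v)" using e1(2)[OF True, of x] that e by auto
      then show ?thesis unfolding g_def h_def by simp
    qed (simp add: g_def h_def)
    show "{v. g x v \<noteq> 0} \<in> A" if x: "x \<in> Q" for x
    proof (rule ccontr)
      assume nA: "{v. g x v \<noteq> 0} \<notin> A"
      have eq: "{v. g x v \<noteq> 0} = {v \<in> G. infdist x (C v) < e}"
        unfolding g_def h_def using sumpos[OF x] by (auto simp: h_def)
      define s where "s = {v \<in> G. infdist x (C v) < e}"
      have ne: "s \<noteq> {}"
      proof -
        have "c x \<noteq> {}" using cA[OF x] A unfolding down_closed_def by auto
        then obtain v where v: "v \<in> c x" by blast
        then have "g x v \<noteq> 0" using hc[OF x v] sumpos[OF x] unfolding g_def by simp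
        then show ?thesis using eq unfolding s_def by auto
      qed
      have fs: "finite s" using G unfolding s_def by simp
      have "(\<Sum>v\<in>s. infdist x (C v)) < (\<Sum>v\<in>s. e)"
        using ne fs by (intro sum_strict_mono) (auto simp: s_def)
      then have "(\<Sum>v\<in>s. infdist x (C v)) / card s < e"
        using ne fs by (simp add: divide_less_eq card_gt_0_iff mult.commute)
      moreover have "e2 \<le> (\<Sum>v\<in>s. infdist x (C v)) / card s"
        using nA eq ne x by (intro e2) (auto simp: s_def)
      ultimately show False using e by linarith
    qed
  qed
qed

section \<open>Points, maps and compact sets in the realization\<close>

definition simplicial :: "'v set set \<Rightarrow> bool" where
  "simplicial K \<longleftrightarrow> down_closed K \<and> (\<forall>s\<in>K. finite s)"

lemma simplicial_subset: "simplicial K \<Longrightarrow> s \<in> K \<Longrightarrow> t \<subseteq> s \<Longrightarrow> t \<noteq> {} \<Longrightarrow> t \<in> K"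
  unfolding simplicial_def down_closed_def by simp

lemma simplicial_finite: "simplicial K \<Longrightarrow> s \<in> K \<Longrightarrow> finite s"
  unfolding simplicial_def by simp

lemma simplicial_nonempty: "simplicial K \<Longrightarrow> s \<in> K \<Longrightarrow> s \<noteq> {}"
  unfolding simplicial_def down_closed_def by auto

lemma powertop_eq_euclidean: "powertop_real UNIV = (euclidean :: ('v \<Rightarrow> real) topology)"
  by (rule euclidean_product_topology)

lemma realization_point:
  assumes K: "simplicial K"
  shows "x \<in> topspace (geometric_realization K) \<longleftrightarrow>
    (\<forall>v. 0 \<le> x v) \<and> {v. x v \<noteq> 0} \<in> K \<and> sum x {v. x v \<noteq> 0} = 1"
proof
  assume "x \<in> topspace (geometric_realization K)"
  then obtain s where s: "s \<in> K" "x \<in> closed_face s"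
    unfolding topspace_geometric_realization by auto
  have "finite s" using s K unfolding simplicial_def by auto
  have sub: "{v. x v \<noteq> 0} \<subseteq> s" using s unfolding closed_face_def by auto
  have sum: "sum x {v. x v \<noteq> 0} = 1"
  proof -
    have "sum x {v. x v \<noteq> 0} = sum x s"
      using sub \<open>finite s\<close> by (intro sum.mono_neutral_left) auto
    then show ?thesis using s unfolding closed_face_def by simp
  qed
  then have "{v. x v \<noteq> 0} \<noteq> {}" by force
  then have "{v. x v \<noteq> 0} \<in> K"
    by (rule simplicial_subset[OF K s(1) sub])
  with sum show "(\<forall>v. 0 \<le> x v) \<and> {v. x v \<noteq> 0} \<in> K \<and> sum x {v. x v \<noteq> 0} = 1"
    using s unfolding closed_face_def by auto
next
  assume "(\<forall>v. 0 \<le> x v) \<and> {v. x v \<noteq> 0} \<in> K \<and> sum x {v. x v \<noteq> 0} = 1"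
  then show "x \<in> topspace (geometric_realization K)"
    unfolding topspace_geometric_realization closed_face_def
    by (intro UN_I[of "{v. x v \<noteq> 0}"]) auto
qed

lemma closed_closed_face:
  assumes "finite s"
  shows "closed (closed_face (s :: 'v set))"
proof -
  have 1: "closed {x :: 'v \<Rightarrow> real. 0 \<le> x v}" for v
    by (intro closed_Collect_le continuous_on_const continuous_on_coord)
  have 2: "closed {x :: 'v \<Rightarrow> real. v \<notin> s \<longrightarrow> x v = 0}" for v
    by (cases "v \<in> s") (auto intro!: closed_Collect_eq continuous_on_const continuous_on_coord)
  have 3: "closed {x :: 'v \<Rightarrow> real. (\<Sum>v\<in>s. x v) = 1}"
    by (intro closed_Collect_eq continuous_on_sum continuous_on_const continuous_on_coord)
  show ?thesis
    unfolding closed_face_def by (intro closed_Collect_conj closed_Collect_all 1 2 3)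
qed

lemma continuous_map_realization_coord:
  "continuous_map (geometric_realization K) euclideanreal (\<lambda>x. x v)"
  unfolding continuous_map_def
proof (intro conjI allI impI)
  fix U :: "real set" assume "openin euclideanreal U"
  then have U: "open U" by simp
  have cont: "continuous_on UNIV (\<lambda>x. x v)" for v :: 'a
    by (rule continuous_on_coord)
  have o: "open ((\<lambda>x. x v) -` U)" for v :: 'a
    using open_vimage[OF U cont] .
  have "openin (top_of_set (closed_face s))
      ({x \<in> topspace (geometric_realization K). x v \<in> U} \<inter> closed_face s)" if "s \<in> K" for s
  proof -
    have "{x \<in> topspace (geometric_realization K). x v \<in> U} \<inter> closed_face s = closed_face s \<inter> (\<lambda>x. x v) -` U"
      using that unfolding topspace_geometric_realization by auto
    then show ?thesis using o by (simp add: openin_open_Int)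
  qed
  then show "openin (geometric_realization K) {x \<in> topspace (geometric_realization K). x v \<in> U}"
    unfolding openin_geometric_realization powertop_eq_euclidean
    by (auto simp: topspace_geometric_realization)
qed simp

text \<open>Coordinatewise continuity does not suffice for the weak topology in general. Here all
  supports lie in the finite set \<open>F\<close>, so the preimage of a closed set is a union over
  the finitely many simplices inside \<open>F\<close>, and a single closed face has the topology of
  the coordinates.\<close>

lemma continuous_map_into_realization:
  fixes g :: "'p::topological_space \<Rightarrow> 'v \<Rightarrow> real"
  assumes K: "simplicial K" and g: "\<And>v. continuous_on S (\<lambda>x. g x v)"
    and img: "\<And>x. x \<in> S \<Longrightarrow> g x \<in> topspace (geometric_realization K)"
    and F: "finite F" "\<And>x. x \<in> S \<Longrightarrow> {v. g x v \<noteq> 0} \<subseteq> F"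
  shows "continuous_map (top_of_set S) (geometric_realization K) g"
  unfolding continuous_map_closedin
proof (intro conjI allI impI)
  show "g \<in> topspace (top_of_set S) \<rightarrow> topspace (geometric_realization K)"
    using img by auto
  fix C assume C: "closedin (geometric_realization K) C"
  have cg: "continuous_on S g" using g by (rule continuous_on_coordinatewise_then_product)
  have clC: "closed (C \<inter> closed_face s)" if s: "s \<in> K" for s
  proof -
    let ?T = "topspace (geometric_realization K)"
    have "openin (geometric_realization K) (?T - C)" using C by blast
    then have "openin (top_of_set (closed_face s)) ((?T - C) \<inter> closed_face s)"
      using s unfolding openin_geometric_realization powertop_eq_euclidean by blast
    moreover have "closed_face s - (?T - C) \<inter> closed_face s = C \<inter> closed_face s"
      using s unfolding topspace_geometric_realization by blast
    ultimately have "closedin (top_of_set (closed_face s)) (C \<inter> closed_face s)"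
      by (metis closedin_diff closedin_topspace topspace_euclidean_subtopology)
    then show ?thesis
      using closed_closed_face s K unfolding simplicial_def by (meson closedin_closed_trans)
  qed
  have "{x \<in> topspace (top_of_set S). g x \<in> C} = (\<Union>s\<in>K \<inter> Pow F. S \<inter> g -` (C \<inter> closed_face s))"
  proof
    show "{x \<in> topspace (top_of_set S). g x \<in> C} \<subseteq> (\<Union>s\<in>K \<inter> Pow F. S \<inter> g -` (C \<inter> closed_face s))"
    proof
      fix x assume "x \<in> {x \<in> topspace (top_of_set S). g x \<in> C}"
      then have x: "x \<in> S" "g x \<in> C" by auto
      have p: "(\<forall>v. 0 \<le> g x v) \<and> {v. g x v \<noteq> 0} \<in> K \<and> sum (g x) {v. g x v \<noteq> 0} = 1"
        using img[OF x(1)] realization_point[OF K] by blast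
      then have "g x \<in> closed_face {v. g x v \<noteq> 0}" unfolding closed_face_def by auto
      then show "x \<in> (\<Union>s\<in>K \<inter> Pow F. S \<inter> g -` (C \<inter> closed_face s))"
        using p x F(2)[OF x(1)] by blast
    qed
  qed auto
  moreover have "closedin (top_of_set S) (\<Union>s\<in>K \<inter> Pow F. S \<inter> g -` (C \<inter> closed_face s))"
  proof (rule closedin_Union)
    show "finite ((\<lambda>s. S \<inter> g -` (C \<inter> closed_face s)) ` (K \<inter> Pow F))" using F(1) by simp
    show "closedin (top_of_set S) T" if "T \<in> (\<lambda>s. S \<inter> g -` (C \<inter> closed_face s)) ` (K \<inter> Pow F)" for T
      using that continuous_closedin_preimage[OF cg clC] by blast
  qed
  ultimately show "closedin (top_of_set S) {x \<in> topspace (top_of_set S). g x \<in> C}" by simp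
qed

lemma sum_over_support: "finite T \<Longrightarrow> {v. x v \<noteq> 0} \<subseteq> T \<Longrightarrow> sum x T = sum x {v. x v \<noteq> (0::real)}"
  by (rule sum.mono_neutral_right) auto

text \<open>Otherwise there are points of \<open>C\<close> each having a vertex that no earlier
  point has. A closed face contains only finitely many of them, so every set of these points is
  closed in the weak topology and the sequence has no accumulation point, contrary to
  compactness.\<close>

lemma finite_support_of_compactin_realization:
  fixes K :: "'v::countable set set"
  assumes K: "simplicial K" and C: "compactin (geometric_realization K) C"
  shows "finite (\<Union>x\<in>C. {v. x v \<noteq> 0})"
proof (rule ccontr)
  let ?Y = "geometric_realization K"
  assume inf: "infinite (\<Union>x\<in>C. {v. x v \<noteq> 0})"
  have CY: "C \<subseteq> topspace ?Y" using C compactin_subset_topspace by blast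
  have fin: "finite {v. x v \<noteq> 0}" if "x \<in> C" for x
    using that CY realization_point[OF K, of x] simplicial_finite[OF K] by auto
  have "\<exists>x v. x \<in> C \<and> x v \<noteq> 0 \<and> v \<notin> F" if "finite F" for F
  proof (rule ccontr)
    assume "\<not> ?thesis"
    then have "(\<Union>x\<in>C. {v. x v \<noteq> 0}) \<subseteq> F" by blast
    then show False using inf that finite_subset by blast
  qed
  then obtain X V where XV: "\<And>F. finite F \<Longrightarrow> X F \<in> C \<and> X F (V F) \<noteq> 0 \<and> V F \<notin> F"
    by metis
  \<comment> \<open>\<open>G n\<close> collects the supports of the first \<open>n\<close> points;
    \<open>V (G n)\<close> is a vertex outside it that the next point \<open>X (G n)\<close>
    uses.\<close>
  define G where "G = rec_nat {} (\<lambda>_ F. F \<union> {v. X F v \<noteq> 0})"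
  have G: "G 0 = {}" "G (Suc n) = G n \<union> {v. X (G n) v \<noteq> 0}" for n
    unfolding G_def by auto
  have finG: "finite (G n)" for n
    by (induction n) (use fin XV in \<open>auto simp: G\<close>)
  define x where "x n = X (G n)" for n
  define u where "u n = V (G n)" for n
  have xC: "x n \<in> C" and xu: "x n (u n) \<noteq> 0" and uG: "u n \<notin> G n" for n
    using XV[OF finG[of n]] unfolding x_def u_def by auto
  have uG': "u n \<in> G m" if "n < m" for n m
    using that
  proof (induction m)
    case (Suc m)
    then show ?case using xu[of n] unfolding G x_def by (cases "n = m") auto
  qed simp
  have injd: "inj u"
    using uG uG' by (metis injI linorder_neqE_nat)
  have D: "finite (range x \<inter> closed_face s)" if s: "s \<in> K" for s
  proof -
    have "u n \<in> s" if "x n \<in> closed_face s" for n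
      using that xu[of n] unfolding closed_face_def by auto
    then have "u ` {n. x n \<in> closed_face s} \<subseteq> s" by auto
    then have "finite {n. x n \<in> closed_face s}"
      using simplicial_finite[OF K s] injd by (meson finite_imageD finite_subset inj_on_subset subset_UNIV)
    moreover have "range x \<inter> closed_face s = x ` {n. x n \<in> closed_face s}" by auto
    ultimately show ?thesis by simp
  qed
  have "infinite (range x)"
  proof
    assume fr: "finite (range x)"
    have "range u \<subseteq> (\<Union>y\<in>range x. {v. y v \<noteq> 0})" using xu by auto
    moreover have "finite (\<Union>y\<in>range x. {v. y v \<noteq> 0})" by (rule finite_UN_I[OF fr]) (use fin xC in auto)
    ultimately have "finite (range u)" by (rule finite_subset)
    then show False using injd finite_imageD by blast
  qed
  moreover have "range x \<subseteq> C" using xC by auto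
  ultimately obtain y where y: "y \<in> ?Y derived_set_of range x"
    using compactin_imp_Bolzano_Weierstrass[OF C] by blast
  define T where "T = topspace ?Y - (range x - {y})"
  have "openin (top_of_set (closed_face s)) (T \<inter> closed_face s)" if s: "s \<in> K" for s
  proof -
    have "T \<inter> closed_face s = closed_face s \<inter> - ((range x - {y}) \<inter> closed_face s)"
      using s unfolding T_def topspace_geometric_realization by auto
    moreover have "finite ((range x - {y}) \<inter> closed_face s)"
      using D[OF s] by (rule rev_finite_subset) auto
    then have "open (- ((range x - {y}) \<inter> closed_face s))"
      by (intro open_Compl finite_imp_closed)
    ultimately show ?thesis
      using openin_open_Int by metis
  qed
  then have "openin ?Y T"
    unfolding openin_geometric_realization powertop_eq_euclidean
    by (auto simp: T_def topspace_geometric_realization)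
  moreover have "y \<in> T"
    using y unfolding T_def derived_set_of_def by auto
  ultimately obtain z where "z \<noteq> y" "z \<in> range x" "z \<in> T"
    using y unfolding derived_set_of_def by blast
  then show False unfolding T_def by blast
qed

lemma nsphere_top_of_set:
  "nsphere r = top_of_set {x. (\<Sum>i\<le>r. x i ^ 2) = 1 \<and> (\<forall>i>r. x i = 0)}"
  unfolding nsphere powertop_eq_euclidean ..

text \<open>A map of the sphere is read as a coloring of the cube boundary by its large coordinates.
  The extended coloring gives a map \<open>g\<close> of the cube, and a straight-line homotopy in a
  collar corrects \<open>g\<close> to the given map on the boundary. The resulting map
  \<open>H\<close> of the whole cube allows the sphere to be contracted along segments of the
  cube.\<close>

lemma homotopy_connected_realization:
  fixes K :: "'v::countable set set"
  assumes K: "simplicial K" and ext: "ext_conn (Suc q) K"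
  shows "homotopy_connected q (geometric_realization K)"
  unfolding homotopy_connected_def
proof (intro conjI ballI allI impI, goal_cases)
  case 1
  obtain s where "s \<in> K" using ext_conn_nonempty[OF ext] by blast
  then obtain v where v: "v \<in> s" using simplicial_nonempty[OF K] by blast
  have "{v} \<in> K" by (rule simplicial_subset[OF K \<open>s \<in> K\<close>]) (use v in auto)
  then have "(\<lambda>u. if u = v then 1 else 0) \<in> topspace (geometric_realization K)"
    unfolding topspace_geometric_realization closed_face_def by (intro UN_I[of "{v}"]) auto
  then show ?case by blast
next
  case (2 y0 r f)
  let ?Y = "geometric_realization K"
  define S where "S = {x :: nat \<Rightarrow> real. (\<Sum>i\<le>r. x i ^ 2) = 1 \<and> (\<forall>i>r. x i = 0)}"
  have nS: "nsphere r = top_of_set S" unfolding S_def by (rule nsphere_top_of_set)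
  have f: "continuous_map (top_of_set S) ?Y f" "f sphere_base = y0" using 2 nS by auto
  have base: "sphere_base \<in> S" using sphere_base_in_nsphere[of r] nS by simp
  have fY: "f x \<in> topspace ?Y" if "x \<in> S" for x
    using f(1) that unfolding continuous_map_def by auto
  define J where "J = {..r}"
  have J: "finite J" "J \<noteq> {}" "card J \<le> Suc q" using 2 unfolding J_def by auto
  let ?B = "cube_boundary 1 J" and ?Q = "cube 1 J"
  \<comment> \<open>\<open>p\<close> and \<open>h\<close> are the radial maps between the boundary
    of the cube and the round sphere.\<close>
  define p where "p x i = x i / sqrt (\<Sum>j\<le>r. x j ^ 2)" for x :: "nat \<Rightarrow> real" and i
  define h where "h x i = x i / maxabs J x" for x :: "nat \<Rightarrow> real" and i
  have sumpos: "(\<Sum>j\<le>r. x j ^ 2) > 0" if "x \<in> ?B" for x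
  proof -
    obtain i where i: "i \<in> J" "\<bar>x i\<bar> = 1" using \<open>x \<in> ?B\<close> unfolding cube_boundary_def by blast
    then have "x i ^ 2 \<noteq> 0" by auto
    then show ?thesis using i unfolding J_def by (intro sum_pos2[of _ i]) auto
  qed
  have pS: "p x \<in> S" if "x \<in> ?B" for x
  proof -
    have "(\<Sum>i\<le>r. p x i ^ 2) = (\<Sum>i\<le>r. x i ^ 2) / (\<Sum>j\<le>r. x j ^ 2)"
      unfolding p_def power_divide sum_divide_distrib using sumpos[OF that] by simp
    also have "\<dots> = 1" using sumpos[OF that] by simp
    finally show ?thesis
      using that unfolding S_def p_def cube_boundary_def cube_mem_iff J_def by auto
  qed
  have contp: "continuous_on ?B p"
  proof (rule continuous_on_coordinatewise_then_product)
    fix i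
    show "continuous_on ?B (\<lambda>x. p x i)"
      unfolding p_def using sumpos
      by (intro continuous_on_divide continuous_on_real_sqrt continuous_on_sum continuous_on_power continuous_on_coord)
         fastforce
  qed
  have maxpos: "maxabs J x > 0" if "x \<in> S" for x
  proof (rule ccontr)
    assume "\<not> ?thesis"
    then have "x i = 0" if "i \<le> r" for i
      using maxabs_ge[OF J(1), of i x] that unfolding J_def by auto
    then show False using \<open>x \<in> S\<close> unfolding S_def by simp
  qed
  have hB: "h x \<in> ?B" if "x \<in> S" for x
    unfolding h_def using that maxpos[OF that]
    by (intro scaled_in_cube_boundary J) (auto simp: S_def J_def)
  have ph: "p (h x) = x" if "x \<in> S" for x
  proof
    fix i
    have "(\<Sum>j\<le>r. h x j ^ 2) = (\<Sum>j\<le>r. x j ^ 2) / maxabs J x ^ 2"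
      unfolding h_def power_divide sum_divide_distrib ..
    also have "\<dots> = 1 / maxabs J x ^ 2" using that unfolding S_def by simp
    finally have "sqrt (\<Sum>j\<le>r. h x j ^ 2) = 1 / maxabs J x"
      using maxpos[OF that] by (simp add: real_sqrt_divide)
    then show "p (h x) i = x i"
      unfolding p_def using maxpos[OF that] by (simp add: h_def)
  qed
  have conth: "continuous_on S h"
  proof (rule continuous_on_coordinatewise_then_product)
    fix i
    show "continuous_on S (\<lambda>x. h x i)"
      unfolding h_def using maxpos
      by (intro continuous_on_divide continuous_on_coord continuous_on_maxabs J) fastforce
  qed
  have "compact S"
  proof -
    have "closed S"
      unfolding S_def
      by (intro closed_Collect_conj closed_Collect_all closed_Collect_imp closed_Collect_eq continuous_on_sum
          continuous_on_power continuous_on_coord continuous_on_const) auto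
    moreover have "x \<in> ?Q" if "x \<in> S" for x
    proof -
      have "\<bar>x i\<bar> \<le> 1" if "i \<le> r" for i
      proof -
        have "x i ^ 2 \<le> (\<Sum>i\<le>r. x i ^ 2)" using that by (intro member_le_sum) auto
        then show ?thesis using \<open>x \<in> S\<close> unfolding S_def by (simp add: abs_square_le_1)
      qed
      then show ?thesis using that unfolding cube_mem_iff J_def S_def by auto
    qed
    then have "S \<subseteq> ?Q" by blast
    ultimately show ?thesis using compact_Int_closed[OF compact_cube[of 1 J], of S] by (simp add: Int_absorb1)
  qed
  define F where "F = (\<Union>x\<in>f ` S. {v. x v \<noteq> 0})"
  have finF: "finite F"
  proof -
    have "compactin ?Y (f ` S)"
      using \<open>compact S\<close> by (intro image_compactin[OF _ f(1)]) (simp add: compactin_subtopology compactin_euclidean_iff)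
    then show ?thesis unfolding F_def by (rule finite_support_of_compactin_realization[OF K])
  qed
  have f_pt: "0 \<le> f x v" "{v. f x v \<noteq> 0} \<in> K" "sum (f x) {v. f x v \<noteq> 0} = 1" "{v. f x v \<noteq> 0} \<subseteq> F"
    if "x \<in> S" for x v
    using fY[OF that] realization_point[OF K, of "f x"] that unfolding F_def by auto
  have contf: "continuous_on S (\<lambda>x. f x v)" for v
    using continuous_map_compose[OF f(1) continuous_map_realization_coord[of K v]] by (simp add: o_def)
  define f' where "f' x = f (p x)" for x
  have contf': "continuous_on ?B (\<lambda>x. f' x v)" for v
    unfolding f'_def by (rule continuous_on_compose2[OF contf contp]) (use pS in auto)
  have "F \<noteq> {}"
  proof -
    have "{v. f sphere_base v \<noteq> 0} \<noteq> {}" using f_pt(3)[OF base] by force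
    then show ?thesis using f_pt(4)[OF base] by auto
  qed
  \<comment> \<open>The \<open>card F\<close> coordinates of a point add up to 1, so one of them is
    at least \<open>\<eta>\<close> and every point receives a color.\<close>
  define \<eta> where "\<eta> = 1 / real (card F)"
  have \<eta>: "\<eta> > 0" using finF \<open>F \<noteq> {}\<close> unfolding \<eta>_def by (auto simp: card_gt_0_iff)
  define c where "c x = {v \<in> F. \<eta> \<le> f' x v}" for x
  have clB: "closed ?B" by (rule closed_cube_boundary[OF J(1)])
  have "coloring ?B K c"
  proof (rule coloringI[OF finF])
    show "closed {x \<in> ?B. v \<in> c x}" for v
      using closed_Collect_continuous_ge(1)[OF clB contf', of \<eta> v] unfolding c_def by (cases "v \<in> F") auto
    show "c x \<in> K" if x: "x \<in> ?B" for x
    proof (rule simplicial_subset[OF K f_pt(2)[OF pS[OF x]]])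
      show "c x \<subseteq> {v. f (p x) v \<noteq> 0}" using \<eta> unfolding c_def f'_def by auto
      show "c x \<noteq> {}"
      proof
        assume "c x = {}"
        then have "f' x v < \<eta>" if "v \<in> F" for v using that unfolding c_def by force
        then have "sum (f' x) F < (\<Sum>v\<in>F. \<eta>)"
          using finF \<open>F \<noteq> {}\<close> by (intro sum_strict_mono) auto
        also have "\<dots> = 1" using finF \<open>F \<noteq> {}\<close> unfolding \<eta>_def by simp
        finally show False
          using f_pt(3,4)[OF pS[OF x]] sum_over_support[OF finF, of "f' x"] unfolding f'_def by simp
      qed
    qed
  qed (auto simp: c_def)
  then obtain c' where c': "coloring ?Q K c'" "\<And>x. x \<in> ?B \<Longrightarrow> c' x = c x"
    by (rule ext_connD[OF ext J(1,3)]) blast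
  \<comment> \<open>Making \<open>g\<close> vanish wherever \<open>f'\<close> does keeps the support
    of \<open>g\<close> on the boundary inside that of \<open>f'\<close>, so the segment between the
    two values stays in one closed face.\<close>
  define Z where "Z v = {x \<in> ?B. f' x v \<le> 0}" for v
  have Zc: "compact (Z v)" for v
  proof -
    have "closed (Z v)" unfolding Z_def by (rule closed_Collect_continuous_ge(2)[OF clB contf'])
    moreover have "Z v = ?B \<inter> Z v" unfolding Z_def by auto
    ultimately show ?thesis using compact_Int_closed[OF compact_cube_boundary[OF J(1)]] by metis
  qed
  have Zd: "Z v \<inter> {x \<in> ?Q. v \<in> c' x} = {}" for v
    using c'(2) \<eta> unfolding Z_def c_def by auto
  have dK: "down_closed K" using K unfolding simplicial_def by blast
  obtain g :: "(nat \<Rightarrow> real) \<Rightarrow> 'v \<Rightarrow> real" and G where g: "finite G" "\<forall>v. continuous_on ?Q (\<lambda>x. g x v)"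
    "\<forall>x\<in>?Q. \<forall>v. 0 \<le> g x v" "\<forall>x\<in>?Q. {v. g x v \<noteq> 0} \<in> K" "\<forall>x\<in>?Q. {v. g x v \<noteq> 0} \<subseteq> G"
    "\<forall>x\<in>?Q. sum (g x) G = 1" "\<forall>v. \<forall>x\<in>?Q \<inter> Z v. g x v = 0"
    using coloring_partition_of_unity[where Z = Z, OF compact_cube c'(1) dK Zc Zd]
    by (elim exE conjE) (rule that; assumption)
  note G = g(1) and contg = g(2)[rule_format] and g0 = g(3)[rule_format] and gK = g(4)[rule_format]
    and gG = g(5)[rule_format] and g1 = g(6)[rule_format] and gZ = g(7)[rule_format, OF IntI]
  define \<rho> where "\<rho> = maxabs J"
  define n where "n x i = x i / \<rho> x" for x :: "nat \<Rightarrow> real" and i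
  \<comment> \<open>The inner cube of half size carries \<open>g\<close> at double scale; in the
    shell the values move linearly from \<open>g\<close> to \<open>f'\<close>.\<close>
  define H where "H x v = (if \<rho> x \<le> 1/2 then g (\<lambda>i. 2 * x i) v
      else (2 * \<rho> x - 1) * f' (n x) v + (2 - 2 * \<rho> x) * g (n x) v)" for x v
  have contr: "continuous_on T \<rho>" for T unfolding \<rho>_def by (rule continuous_on_maxabs[OF J(1,2)])
  have r1: "\<rho> x \<le> 1" if "x \<in> ?Q" for x
    unfolding \<rho>_def using maxabs_le[OF J(1,2)] cube_in[OF that] by blast
  have nB: "n x \<in> ?B" if "x \<in> ?Q" "1/2 \<le> \<rho> x" for x
    unfolding n_def \<rho>_def using that cube_out[OF that(1)] J
    by (intro scaled_in_cube_boundary) (auto simp: \<rho>_def)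
  have BQ: "?B \<subseteq> ?Q" unfolding cube_boundary_def by auto
  have dbl: "(\<lambda>i. 2 * x i) \<in> ?Q" if "x \<in> ?Q" "\<rho> x \<le> 1/2" for x
    using that maxabs_ge[OF J(1), of _ x] unfolding cube_mem_iff \<rho>_def by (force simp: abs_mult)
  have HY: "H x \<in> topspace ?Y" and HF: "{v. H x v \<noteq> 0} \<subseteq> F \<union> G" if x: "x \<in> ?Q" for x
  proof -
    have "H x \<in> topspace ?Y \<and> {v. H x v \<noteq> 0} \<subseteq> F \<union> G"
    proof (cases "\<rho> x \<le> 1/2")
      case True
      then have "H x = g (\<lambda>i. 2 * x i)" unfolding H_def by auto
      moreover note y = dbl[OF x True]
      ultimately show ?thesis
        using g0[OF y] gK[OF y] gG[OF y] g1[OF y] sum_over_support[OF G gG[OF y]]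
        unfolding realization_point[OF K] by simp blast
    next
      case False
      then have y: "n x \<in> ?B" using nB[OF x] by auto
      define s where "s = {v. f' (n x) v \<noteq> 0}"
      have s: "s \<in> K" "s \<subseteq> F" "sum (f' (n x)) s = 1" and f0: "0 \<le> f' (n x) v" for v
        using f_pt[OF pS[OF y]] unfolding s_def f'_def by auto
      have yQ: "n x \<in> ?Q" using y BQ by blast
      have gs: "{v. g (n x) v \<noteq> 0} \<subseteq> s"
        using gZ[OF yQ] y unfolding s_def Z_def by auto
      have fs: "finite s" using s(2) finF finite_subset by blast
      have "sum (g (n x)) s = 1"
        using sum_over_support[OF fs gs] sum_over_support[OF G gG[OF yQ]] g1[OF yQ] by simp
      then have "sum (H x) s = (2 * \<rho> x - 1) * 1 + (2 - 2 * \<rho> x) * 1"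
        using False s(3) unfolding H_def by (simp add: sum.distrib sum_distrib_left[symmetric])
      moreover have "H x v = 0" if "v \<notin> s" for v
        using that gs False unfolding H_def s_def by auto
      moreover have "0 \<le> H x v" for v
        using False f0 g0[OF yQ] r1[OF x] unfolding H_def by simp
      ultimately have "H x \<in> closed_face s" unfolding closed_face_def by auto
      then show ?thesis
        using s \<open>\<And>v. v \<notin> s \<Longrightarrow> H x v = 0\<close> unfolding topspace_geometric_realization by blast
    qed
    then show "H x \<in> topspace ?Y" "{v. H x v \<noteq> 0} \<subseteq> F \<union> G" by auto
  qed
  have contn: "continuous_on {x \<in> ?Q. 1/2 \<le> \<rho> x} n"
  proof (rule continuous_on_coordinatewise_then_product)
    fix i
    show "continuous_on {x \<in> ?Q. 1/2 \<le> \<rho> x} (\<lambda>x. n x i)"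
      unfolding n_def by (intro continuous_on_divide continuous_on_coord contr) auto
  qed
  have contH: "continuous_on ?Q (\<lambda>x. H x v)" for v
    unfolding H_def
  proof (rule continuous_on_cases_le[OF _ _ contr])
    show "continuous_on {x \<in> ?Q. \<rho> x \<le> 1/2} (\<lambda>x. g (\<lambda>i. 2 * x i) v)"
    proof (rule continuous_on_compose2[OF contg])
      show "continuous_on {x \<in> ?Q. \<rho> x \<le> 1/2} (\<lambda>x i. 2 * x i)"
        by (intro continuous_on_coordinatewise_then_product continuous_on_mult continuous_on_const continuous_on_coord)
    qed (use dbl in auto)
    have "continuous_on {x \<in> ?Q. 1/2 \<le> \<rho> x} (\<lambda>x. f' (n x) v)"
      by (rule continuous_on_compose2[OF contf' contn]) (use nB in auto)
    moreover have "continuous_on {x \<in> ?Q. 1/2 \<le> \<rho> x} (\<lambda>x. g (n x) v)"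
      by (rule continuous_on_compose2[OF contg contn]) (use nB BQ in auto)
    ultimately show "continuous_on {x \<in> ?Q. 1/2 \<le> \<rho> x} (\<lambda>x. (2 * \<rho> x - 1) * f' (n x) v + (2 - 2 * \<rho> x) * g (n x) v)"
      by (intro continuous_on_add continuous_on_mult continuous_on_diff continuous_on_const contr)
    show "g (\<lambda>i. 2 * x i) v = (2 * \<rho> x - 1) * f' (n x) v + (2 - 2 * \<rho> x) * g (n x) v"
      if "x \<in> ?Q" and half: "\<rho> x = 1/2" for x
    proof -
      have "n x = (\<lambda>i. 2 * x i)" unfolding n_def half by auto
      then show ?thesis unfolding half by simp
    qed
  qed
  have Hh: "H (h x) = f x" if "x \<in> S" for x
  proof -
    have "\<rho> (h x) = 1" unfolding \<rho>_def by (rule maxabs_cube_boundary[OF J(1,2) hB[OF that]])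
    moreover from this have "n (h x) = h x" unfolding n_def by simp
    ultimately show ?thesis using ph[OF that] unfolding H_def f'_def by auto
  qed
  \<comment> \<open>Segments in the cube from \<open>h x\<close> to the image of the base point. For
    the base point itself the segment is constant, so the homotopy is relative to it.\<close>
  define k where "k z i = (1 - fst z) * h (snd z) i + fst z * h sphere_base i" for z :: "real \<times> (nat \<Rightarrow> real)" and i
  have kQ: "k z \<in> ?Q" if "z \<in> {0..1} \<times> S" for z
  proof -
    have z: "h (snd z) \<in> ?Q" "h sphere_base \<in> ?Q" "0 \<le> fst z" "fst z \<le> 1"
      using that hB base BQ by auto
    have "\<bar>k z i\<bar> \<le> 1" if "i \<in> J" for i
    proof -
      have "\<bar>k z i\<bar> \<le> (1 - fst z) * \<bar>h (snd z) i\<bar> + fst z * \<bar>h sphere_base i\<bar>"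
        unfolding k_def using z(3,4) by (intro order_trans[OF abs_triangle_ineq]) (simp add: abs_mult)
      also have "\<dots> \<le> (1 - fst z) * 1 + fst z * 1"
        using z(3,4) cube_in[OF z(1) that] cube_in[OF z(2) that] by (intro add_mono mult_left_mono) auto
      finally show ?thesis by simp
    qed
    then show ?thesis
      using cube_out[OF z(1)] cube_out[OF z(2)] unfolding cube_mem_iff k_def by auto
  qed
  have contk: "continuous_on ({0..1} \<times> S) k"
  proof (rule continuous_on_coordinatewise_then_product)
    fix i
    have "continuous_on ({0..1} \<times> S) (\<lambda>z. h (snd z))"
      by (rule continuous_on_compose2[OF conth continuous_on_snd[OF continuous_on_id]]) auto
    then have "continuous_on ({0..1} \<times> S) (\<lambda>z. h (snd z) i)"
      by (rule continuous_on_product_then_coordinatewise)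
    then show "continuous_on ({0..1} \<times> S) (\<lambda>z. k z i)"
      unfolding k_def
      by (intro continuous_on_add continuous_on_mult continuous_on_diff continuous_on_const
          continuous_on_fst continuous_on_id)
  qed
  have "continuous_map (top_of_set ({0..1} \<times> S)) ?Y (\<lambda>z. H (k z))"
  proof (rule continuous_map_into_realization[OF K])
    show "continuous_on ({0..1} \<times> S) (\<lambda>z. H (k z) v)" for v
      by (rule continuous_on_compose2[OF contH contk]) (use kQ in auto)
    show "finite (F \<union> G)" using finF G by simp
  qed (use kQ HY HF in auto)
  moreover have "H (k (0, x)) = f x" if "x \<in> S" for x
    using Hh[OF that] unfolding k_def by simp
  moreover have "H (k (1, x)) = y0" if "x \<in> S" for x
    using Hh[OF base] f(2) unfolding k_def by simp
  moreover have "H (k (t, sphere_base)) = y0" for t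
  proof -
    have "k (t, sphere_base) = h sphere_base" unfolding k_def by (auto simp: algebra_simps)
    then show ?thesis using Hh[OF base] f(2) by simp
  qed
  ultimately show ?case
    unfolding nS
    by (subst homotopic_with) (use base in \<open>auto intro!: exI[of _ "\<lambda>z. H (k z)"]\<close>)
qed

section \<open>Common neighbours in the preferential attachment graph\<close>

lemma (in prob_space) expectation_simple:
  fixes k :: "'b \<Rightarrow> real"
  assumes X: "simple_function M X"
  shows "integrable M (\<lambda>\<omega>. k (X \<omega>))"
    and "(\<integral>\<omega>. k (X \<omega>) \<partial>M) = (\<Sum>x\<in>X ` space M. k x * prob (X -` {x} \<inter> space M))"
proof -
  have fin: "finite (X ` space M)" and meas: "\<And>x. x \<in> X ` space M \<Longrightarrow> X -` {x} \<inter> space M \<in> events"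
    using X unfolding simple_function_def by auto
  have eq: "k (X \<omega>) = (\<Sum>x\<in>X ` space M. k x * indicat_real (X -` {x} \<inter> space M) \<omega>)" if "\<omega> \<in> space M" for \<omega>
  proof -
    have "(\<Sum>x\<in>X ` space M. k x * indicat_real (X -` {x} \<inter> space M) \<omega>) =
        (\<Sum>x\<in>X ` space M. if X \<omega> = x then k x else 0)"
      using that by (intro sum.cong refl) (auto simp: indicator_def)
    also have "\<dots> = k (X \<omega>)"
      using fin that by (subst sum.delta') auto
    finally show ?thesis by simp
  qed
  have int: "integrable M (\<lambda>\<omega>. \<Sum>x\<in>X ` space M. k x * indicat_real (X -` {x} \<inter> space M) \<omega>)"
    using meas by (intro Bochner_Integration.integrable_sum integrable_mult_right integrable_real_indicator)
      (auto simp: emeasure_eq_measure)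
  then show "integrable M (\<lambda>\<omega>. k (X \<omega>))"
    by (subst Bochner_Integration.integrable_cong[OF refl eq])
  have "(\<integral>\<omega>. k (X \<omega>) \<partial>M) = (\<integral>\<omega>. (\<Sum>x\<in>X ` space M. k x * indicat_real (X -` {x} \<inter> space M) \<omega>) \<partial>M)"
    by (rule Bochner_Integration.integral_cong[OF refl eq])
  also have "\<dots> = (\<Sum>x\<in>X ` space M. \<integral>\<omega>. k x * indicat_real (X -` {x} \<inter> space M) \<omega> \<partial>M)"
    using meas by (intro Bochner_Integration.integral_sum integrable_mult_right integrable_real_indicator)
      (auto simp: emeasure_eq_measure)
  also have "\<dots> = (\<Sum>x\<in>X ` space M. k x * prob (X -` {x} \<inter> space M))"
    using meas by (intro sum.cong refl) (auto simp: Int_absorb2)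
  finally show "(\<integral>\<omega>. k (X \<omega>) \<partial>M) = (\<Sum>x\<in>X ` space M. k x * prob (X -` {x} \<inter> space M))" .
qed

lemma (in prob_space) prob_eq_integral_simple:
  assumes X: "simple_function M X"
  shows "{\<omega> \<in> space M. S (X \<omega>)} \<in> events"
    and "prob {\<omega> \<in> space M. S (X \<omega>)} = (\<integral>\<omega>. of_bool (S (X \<omega>)) \<partial>M)"
proof -
  have "simple_function M (\<lambda>\<omega>. S (X \<omega>))" using simple_function_compose1[OF X, of S] by simp
  then have "{\<omega> \<in> space M. S (X \<omega>)} \<in> events" 
    using simple_functionD(2)[of M "\<lambda>\<omega>. S (X \<omega>)" "{True}"] by (simp add: vimage_def Int_def conj_commute)
  then show e: "{\<omega> \<in> space M. S (X \<omega>)} \<in> events" .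
  have "(\<integral>\<omega>. of_bool (S (X \<omega>)) \<partial>M) = (\<integral>\<omega>. indicat_real {\<omega> \<in> space M. S (X \<omega>)} \<omega> \<partial>M)"
    by (intro Bochner_Integration.integral_cong) (auto simp: indicator_def)
  then show "prob {\<omega> \<in> space M. S (X \<omega>)} = (\<integral>\<omega>. of_bool (S (X \<omega>)) \<partial>M)"
    using e by simp
qed

lemma multigraph_degree_add:
  "multigraph_degree (g + h) v = multigraph_degree g v + multigraph_degree h v"
  unfolding multigraph_degree_def by simp

lemma multigraph_degree_single:
  "multigraph_degree {#(s, t)#} v = of_bool (s = v) + of_bool (t = v)"
  unfolding multigraph_degree_def by simp

section \<open>The attachment rule in terms of expectations\<close>

locale admissible_pa = preferential_attachment M m \<delta> E
  for M :: "'w measure" and m :: nat and \<delta> :: real and E :: "nat \<Rightarrow> nat \<Rightarrow> 'w \<Rightarrow> nat" +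
  assumes m_pos: "0 < m" and delta_gt: "- real m < \<delta>"
begin

abbreviation G :: "nat \<Rightarrow> nat \<Rightarrow> 'w \<Rightarrow> (nat \<times> nat) multiset" where
  "G \<equiv> pa_graph m E"

definition weight :: "(nat \<times> nat) multiset \<Rightarrow> nat \<Rightarrow> real" where
  "weight g v = real (multigraph_degree g v) + \<delta>"

text \<open>The total weight of the nodes below \<open>T\<close> just before the
  \<open>\<alpha>\<close>-th edge of \<open>T\<close> is drawn, hence the normaliser of the
  attachment rule.\<close>

definition step_total :: "nat \<Rightarrow> nat \<Rightarrow> real" where
  "step_total T \<alpha> = 2 * (real T - 2) * real m + real \<alpha> - 1 + (real T - 1) * \<delta>"

lemma G_Suc: "G T (Suc \<alpha>) \<omega> = G T \<alpha> \<omega> + {#(T, E T (Suc \<alpha>) \<omega>)#}"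
  unfolding pa_graph_def by (simp add: atLeastAtMostSuc_conv add.commute add.left_commute)

text \<open>Node \<open>T\<close> has sent no edge yet in \<open>G T 0\<close>, which is the graph
  on the nodes below \<open>T\<close>. Statements that advance by whole nodes are phrased at these
  times.\<close>

lemma G_next: "2 \<le> T \<Longrightarrow> G (Suc T) 0 \<omega> = G T m \<omega>"
  unfolding pa_graph_def by (simp add: atLeastLessThanSuc add.commute)

lemma G_2_0: "G 2 0 \<omega> = {#}"
  unfolding pa_graph_def by simp

lemma target_range:
  assumes "2 \<le> T" "1 \<le> \<alpha>" "\<alpha> \<le> m" "\<omega> \<in> space M"
  shows "E T \<alpha> \<omega> \<in> {1..T - 1}"
  using assms initial_target[of \<alpha> \<omega>] target_older[of T \<alpha> \<omega>] by (cases "T = 2") auto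

lemma simple_target:
  assumes "2 \<le> T" "1 \<le> \<alpha>" "\<alpha> \<le> m"
  shows "simple_function M (E T \<alpha>)"
  unfolding simple_function_def
proof (intro conjI ballI)
  have "E T \<alpha> ` space M \<subseteq> {1..T - 1}" using target_range[OF assms] by blast
  then show "finite (E T \<alpha> ` space M)" by (rule finite_subset) simp
  show "E T \<alpha> -` {x} \<inter> space M \<in> events" for x
    using measurable_sets[OF target_measurable[OF assms], of "{x}"] by simp
qed

lemma simple_G: "2 \<le> T \<Longrightarrow> \<alpha> \<le> m \<Longrightarrow> simple_function M (G T \<alpha>)"
proof (induction T arbitrary: \<alpha> rule: dec_induct)
  case base
  then show ?case
  proof (induction \<alpha>)
    case 0
    have "G 2 0 = (\<lambda>_. {#})" using G_2_0 by auto
    then show ?case by simp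
  next
    case (Suc \<alpha>)
    have "simple_function M (\<lambda>\<omega>. G 2 \<alpha> \<omega> + {#(2, E 2 (Suc \<alpha>) \<omega>)#})"
      using Suc by (intro simple_function_compose2[where h = "\<lambda>g v. g + {#(2, v)#}"] simple_target) auto
    then show ?case unfolding G_Suc[abs_def] .
  qed
next
  case (step T)
  note stepT = step
  from step.prems show ?case
  proof (induction \<alpha>)
    case 0
    have "G (Suc T) 0 = G T m" using G_next step by auto
    then show ?case using step.IH[of m] by simp
  next
    case (Suc \<alpha>)
    have "simple_function M (\<lambda>\<omega>. G (Suc T) \<alpha> \<omega> + {#(Suc T, E (Suc T) (Suc \<alpha>) \<omega>)#})"
      using Suc stepT by (intro simple_function_compose2[where h = "\<lambda>g v. g + {#(Suc T, v)#}"] simple_target) auto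
    then show ?case unfolding G_Suc[abs_def] .
  qed
qed

text \<open>Earlier graphs are functions of the current one, obtained by keeping the edges of old
  sources. The attachment rule conditions on the current multigraph only, and this makes it
  applicable to events about the past.\<close>

lemma G_filter:
  assumes "T \<le> T'" "2 \<le> T"
  shows "filter_mset (\<lambda>e. fst e < T) (G T' \<alpha> \<omega>) = G T 0 \<omega>"
proof -
  have f: "filter_mset P (\<Sum>i\<in>I. h i) = (\<Sum>i\<in>I. filter_mset P (h i))"
    if "finite I" for P and I :: "nat set" and h :: "nat \<Rightarrow> (nat \<times> nat) multiset"
    using that by (induction I rule: finite_induct) auto
  have z: "(\<Sum>\<beta>\<in>B. filter_mset (\<lambda>e. fst e < T) {#(s, E s \<beta> \<omega>)#}) =
      (if s < T then \<Sum>\<beta>\<in>B. {#(s, E s \<beta> \<omega>)#} else {#})" for s B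
    by simp
  have "filter_mset (\<lambda>e. fst e < T) (G T' \<alpha> \<omega>) =
      (\<Sum>s\<in>{2..<T'}. if s < T then \<Sum>\<beta>\<in>{1..m}. {#(s, E s \<beta> \<omega>)#} else {#})"
    unfolding pa_graph_def using assms by (simp add: f z del: filter_mset_add_mset One_nat_def)
  also have "\<dots> = (\<Sum>s\<in>{2..<T}. \<Sum>\<beta>\<in>{1..m}. {#(s, E s \<beta> \<omega>)#})"
    using assms by (intro sum.mono_neutral_cong_right) auto
  finally show ?thesis unfolding pa_graph_def by simp
qed

lemma G_subset: "T \<le> T' \<Longrightarrow> 2 \<le> T \<Longrightarrow> G T 0 \<omega> \<subseteq># G T' \<alpha> \<omega>"
  using G_filter[of T T' \<alpha> \<omega>] multiset_filter_subset by metis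

lemma multigraph_degree_mono: "g \<subseteq># h \<Longrightarrow> multigraph_degree g v \<le> multigraph_degree h v"
  by (auto simp: mset_subset_eq_exists_conv multigraph_degree_add)

lemma weight_mono: "T \<le> T' \<Longrightarrow> 2 \<le> T \<Longrightarrow> weight (G T 0 \<omega>) v \<le> weight (G T' \<alpha> \<omega>) v"
  unfolding weight_def using multigraph_degree_mono[OF G_subset] by auto

lemma weight_Suc:
  assumes "v < T"
  shows "weight (G T (Suc \<alpha>) \<omega>) v = weight (G T \<alpha> \<omega>) v + of_bool (E T (Suc \<alpha>) \<omega> = v)"
  unfolding weight_def G_Suc multigraph_degree_add multigraph_degree_single using assms by simp

lemma step_total_pos:
  assumes "3 \<le> T" "1 \<le> \<alpha>"
  shows "0 < step_total T \<alpha>"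
proof -
  have "step_total T \<alpha> = (real T - 3) * (2 * real m + \<delta>) + 2 * (real m + \<delta>) + (real \<alpha> - 1)"
    unfolding step_total_def by (simp add: algebra_simps)
  also have "0 < \<dots>"
  proof (rule add_pos_nonneg[OF add_nonneg_pos])
    show "0 \<le> (real T - 3) * (2 * real m + \<delta>)"
      using assms delta_gt by (intro mult_nonneg_nonneg) auto
  qed (use assms delta_gt in auto)
  finally show ?thesis .
qed

lemma step_total_le:
  assumes "\<alpha> \<le> m"
  shows "step_total T \<alpha> \<le> (2 * real m + \<delta>) * (real T - 1)"
proof -
  have "(2 * real m + \<delta>) * (real T - 1) - step_total T \<alpha> = 2 * real m - real \<alpha> + 1"
    unfolding step_total_def by (simp add: algebra_simps)
  then show ?thesis using assms by linarith
qed

text \<open>The attachment rule integrated against an arbitrary function \<open>k\<close> of the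
  current graph, by summing over the finitely many values of that graph. Values of probability 0,
  about which the rule is silent, contribute nothing to either side.\<close>

lemma attachment_expectation:
  assumes T: "3 \<le> T" and \<alpha>: "Suc \<alpha> \<le> m" and v: "v \<in> {1..T - 1}"
  shows "(\<integral>\<omega>. of_bool (E T (Suc \<alpha>) \<omega> = v) * k (G T \<alpha> \<omega>) \<partial>M) =
    (\<integral>\<omega>. weight (G T \<alpha> \<omega>) v / step_total T (Suc \<alpha>) * k (G T \<alpha> \<omega>) \<partial>M)"
proof -
  have sG: "simple_function M (G T \<alpha>)" using T \<alpha> by (intro simple_G) auto
  have sE: "simple_function M (E T (Suc \<alpha>))" using T \<alpha> by (intro simple_target) auto
  have fin: "finite (G T \<alpha> ` space M)" using sG unfolding simple_function_def by simp
  define A where "A g = {\<omega> \<in> space M. G T \<alpha> \<omega> = g \<and> E T (Suc \<alpha>) \<omega> = v}" for g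
  have evA: "A g \<in> events" for g
  proof -
    have "A g = (G T \<alpha> -` {g} \<inter> space M) \<inter> (E T (Suc \<alpha>) -` {v} \<inter> space M)" unfolding A_def by auto
    then show ?thesis using simple_functionD(2)[OF sG] simple_functionD(2)[OF sE] by auto
  qed
  have pA: "prob (A g) = weight g v / step_total T (Suc \<alpha>) * prob (G T \<alpha> -` {g} \<inter> space M)" for g
  proof -
    have gs: "G T \<alpha> -` {g} \<inter> space M = {\<omega> \<in> space M. G T \<alpha> \<omega> = g}" by auto
    show ?thesis
    proof (cases "prob {\<omega> \<in> space M. G T \<alpha> \<omega> = g} > 0")
      case True
      have "\<P>(\<omega> in M. E T (Suc \<alpha>) \<omega> = v \<bar> G T (Suc \<alpha> - 1) \<omega> = g) =
          (real (multigraph_degree g v) + \<delta>) /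
          (2 * (real T - 2) * real m + real (Suc \<alpha>) - 1 + (real T - 1) * \<delta>)"
        using True T \<alpha> v by (intro attachment_rule) auto
      then have "prob {\<omega> \<in> space M. E T (Suc \<alpha>) \<omega> = v \<and> G T \<alpha> \<omega> = g} / prob {\<omega> \<in> space M. G T \<alpha> \<omega> = g}
          = weight g v / step_total T (Suc \<alpha>)"
        unfolding cond_prob_def weight_def step_total_def by simp
      then show ?thesis
        using True unfolding gs A_def by (simp add: field_simps conj_commute)
    next
      case False
      have "prob (A g) \<le> prob {\<omega> \<in> space M. G T \<alpha> \<omega> = g}"
        using simple_functionD(2)[OF sG, of "{g}"] unfolding gs
        by (intro finite_measure_mono) (auto simp: A_def)
      then have "prob (A g) = 0" "prob {\<omega> \<in> space M. G T \<alpha> \<omega> = g} = 0"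
        using False measure_nonneg[of M "A g"] measure_nonneg[of M "{\<omega> \<in> space M. G T \<alpha> \<omega> = g}"] by linarith+
      then show ?thesis unfolding gs by simp
    qed
  qed
  have "(\<integral>\<omega>. of_bool (E T (Suc \<alpha>) \<omega> = v) * k (G T \<alpha> \<omega>) \<partial>M) =
      (\<integral>\<omega>. (\<Sum>g\<in>G T \<alpha> ` space M. k g * indicat_real (A g) \<omega>) \<partial>M)"
  proof (rule Bochner_Integration.integral_cong[OF refl])
    fix \<omega> assume \<omega>: "\<omega> \<in> space M"
    have "(\<Sum>g\<in>G T \<alpha> ` space M. k g * indicat_real (A g) \<omega>) =
        (\<Sum>g\<in>G T \<alpha> ` space M. if G T \<alpha> \<omega> = g then of_bool (E T (Suc \<alpha>) \<omega> = v) * k g else 0)"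
      using \<omega> by (intro sum.cong refl) (auto simp: indicator_def A_def)
    also have "\<dots> = of_bool (E T (Suc \<alpha>) \<omega> = v) * k (G T \<alpha> \<omega>)"
      using fin \<omega> by (subst sum.delta') auto
    finally show "of_bool (E T (Suc \<alpha>) \<omega> = v) * k (G T \<alpha> \<omega>) =
        (\<Sum>g\<in>G T \<alpha> ` space M. k g * indicat_real (A g) \<omega>)" ..
  qed
  also have "\<dots> = (\<Sum>g\<in>G T \<alpha> ` space M. \<integral>\<omega>. k g * indicat_real (A g) \<omega> \<partial>M)"
    using evA by (intro Bochner_Integration.integral_sum integrable_mult_right integrable_real_indicator)
      (auto simp: emeasure_eq_measure)
  also have "\<dots> = (\<Sum>g\<in>G T \<alpha> ` space M. k g * prob (A g))"
    using evA by (intro sum.cong refl) (simp add: Int_absorb2 sets.sets_into_space)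
  also have "\<dots> = (\<Sum>g\<in>G T \<alpha> ` space M. weight g v / step_total T (Suc \<alpha>) * k g * prob (G T \<alpha> -` {g} \<inter> space M))"
    unfolding pA by (intro sum.cong refl) simp
  also have "\<dots> = (\<integral>\<omega>. weight (G T \<alpha> \<omega>) v / step_total T (Suc \<alpha>) * k (G T \<alpha> \<omega>) \<partial>M)"
    using expectation_simple(2)[OF sG, of "\<lambda>g. weight g v / step_total T (Suc \<alpha>) * k g"] by simp
  finally show ?thesis .
qed

text \<open>
  With \<open>w\<close> the current weight of \<open>v\<close>, \<open>1 / (w - 1)\<close> decreases by \<open>1 / (w (w - 1))\<close> when \<open>v\<close> is hit,
  so its conditional expectation is multiplied by exactly \<open>1 - 1 / step_total\<close>.
\<close>

lemma inverse_weight_step: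
  assumes T: "3 \<le> T" and \<alpha>: "Suc \<alpha> \<le> m" and v: "v \<in> {1..T - 1}"
    and S: "\<And>\<omega>. \<omega> \<in> space M \<Longrightarrow> S (G T 0 \<omega>) \<Longrightarrow> 1 < weight (G T 0 \<omega>) v"
  shows "(\<integral>\<omega>. of_bool (S (G T 0 \<omega>)) * (1 / (weight (G T (Suc \<alpha>) \<omega>) v - 1)) \<partial>M) =
    (1 - 1 / step_total T (Suc \<alpha>)) * (\<integral>\<omega>. of_bool (S (G T 0 \<omega>)) * (1 / (weight (G T \<alpha> \<omega>) v - 1)) \<partial>M)"
proof -
  \<comment> \<open>\<open>S\<close> concerns the graph before \<open>T\<close> sends edges; read
    through the filter it becomes a condition on every \<open>G T \<beta>\<close>.\<close>
  define S' where "S' g = S (filter_mset (\<lambda>e. fst e < T) g)" for g :: "(nat \<times> nat) multiset"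
  have S': "S' (G T \<beta> \<omega>) = S (G T 0 \<omega>)" for \<beta> \<omega> unfolding S'_def using T by (simp add: G_filter)
  define f where "f g = of_bool (S' g) * (1 / (weight g v - 1))" for g
  define k where "k g = of_bool (S' g) * (1 / (weight g v - 1) - 1 / weight g v)" for g
  have vT: "v < T" using v T by auto
  have gt: "1 < weight (G T \<beta> \<omega>) v" if "\<omega> \<in> space M" "S (G T 0 \<omega>)" for \<beta> \<omega>
    using S[OF that] weight_mono[of T T \<omega> v \<beta>] T by simp
  have sG: "simple_function M (G T \<beta>)" if "\<beta> \<le> m" for \<beta> using T that by (intro simple_G) auto
  have sE: "simple_function M (E T (Suc \<alpha>))" using T \<alpha> by (intro simple_target) auto
  have pair: "simple_function M (\<lambda>\<omega>. (E T (Suc \<alpha>) \<omega>, G T \<alpha> \<omega>))"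
    using sE sG[of \<alpha>] \<alpha> by (intro simple_function_compose2[where h = Pair]) auto
  have "(\<integral>\<omega>. f (G T (Suc \<alpha>) \<omega>) \<partial>M) =
      (\<integral>\<omega>. f (G T \<alpha> \<omega>) - of_bool (E T (Suc \<alpha>) \<omega> = v) * k (G T \<alpha> \<omega>) \<partial>M)"
  proof (rule Bochner_Integration.integral_cong[OF refl])
    fix \<omega> assume \<omega>: "\<omega> \<in> space M"
    show "f (G T (Suc \<alpha>) \<omega>) = f (G T \<alpha> \<omega>) - of_bool (E T (Suc \<alpha>) \<omega> = v) * k (G T \<alpha> \<omega>)"
      unfolding f_def k_def S' weight_Suc[OF vT] by simp
  qed
  also have "\<dots> = (\<integral>\<omega>. f (G T \<alpha> \<omega>) \<partial>M) - (\<integral>\<omega>. of_bool (E T (Suc \<alpha>) \<omega> = v) * k (G T \<alpha> \<omega>) \<partial>M)"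
    using expectation_simple(1)[OF sG, of \<alpha> f] \<alpha>
      expectation_simple(1)[OF pair, of "\<lambda>p. of_bool (fst p = v) * k (snd p)"]
    by (intro Bochner_Integration.integral_diff) auto
  also have "(\<integral>\<omega>. of_bool (E T (Suc \<alpha>) \<omega> = v) * k (G T \<alpha> \<omega>) \<partial>M) =
      (\<integral>\<omega>. weight (G T \<alpha> \<omega>) v / step_total T (Suc \<alpha>) * k (G T \<alpha> \<omega>) \<partial>M)"
    by (rule attachment_expectation[OF T \<alpha> v])
  also have "\<dots> = (\<integral>\<omega>. 1 / step_total T (Suc \<alpha>) * f (G T \<alpha> \<omega>) \<partial>M)"
  proof (rule Bochner_Integration.integral_cong[OF refl])
    fix \<omega> assume \<omega>: "\<omega> \<in> space M"
    show "weight (G T \<alpha> \<omega>) v / step_total T (Suc \<alpha>) * k (G T \<alpha> \<omega>) = 1 / step_total T (Suc \<alpha>) * f (G T \<alpha> \<omega>)"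
    proof (cases "S (G T 0 \<omega>)")
      case True
      then have "1 < weight (G T \<alpha> \<omega>) v" using gt \<omega> by blast
      then have "weight (G T \<alpha> \<omega>) v * (1 / (weight (G T \<alpha> \<omega>) v - 1) - 1 / weight (G T \<alpha> \<omega>) v) =
          1 / (weight (G T \<alpha> \<omega>) v - 1)"
        by (simp add: field_simps)
      then show ?thesis unfolding f_def k_def S' using True by simp
    qed (simp add: f_def k_def S')
  qed
  also have "\<dots> = 1 / step_total T (Suc \<alpha>) * (\<integral>\<omega>. f (G T \<alpha> \<omega>) \<partial>M)"
    by (rule Bochner_Integration.integral_mult_right_zero)
  finally show ?thesis
    unfolding f_def S' by (simp only: left_diff_distrib mult_1_left)
qed

text \<open>Each of the \<open>m\<close> edges multiplies the expectation by
  \<open>1 - 1 / step_total\<close>, and \<open>step_total\<close> is at most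
  \<open>(2 * m + \<delta>) * (T - 1)\<close> throughout; the exponential comes from
  \<open>1 - r \<le> exp (- r)\<close>.\<close>

lemma inverse_weight_node:
  assumes T: "3 \<le> T" and v: "v \<in> {1..T - 1}"
    and S: "\<And>\<omega>. \<omega> \<in> space M \<Longrightarrow> S (G T 0 \<omega>) \<Longrightarrow> 1 < weight (G T 0 \<omega>) v"
  shows "(\<integral>\<omega>. of_bool (S (G T 0 \<omega>)) * (1 / (weight (G (Suc T) 0 \<omega>) v - 1)) \<partial>M) \<le>
    exp (- (real m / ((2 * real m + \<delta>) * (real T - 1)))) *
      (\<integral>\<omega>. of_bool (S (G T 0 \<omega>)) * (1 / (weight (G T 0 \<omega>) v - 1)) \<partial>M)"
proof -
  define I where "I \<alpha> = (\<integral>\<omega>. of_bool (S (G T 0 \<omega>)) * (1 / (weight (G T \<alpha> \<omega>) v - 1)) \<partial>M)" for \<alpha>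
  define r where "r = 1 / ((2 * real m + \<delta>) * (real T - 1))"
  have gt: "1 < weight (G T \<beta> \<omega>) v" if "\<omega> \<in> space M" "S (G T 0 \<omega>)" for \<beta> \<omega>
    using S[OF that] weight_mono[of T T \<omega> v \<beta>] T by simp
  have nonneg: "0 \<le> I \<alpha>" for \<alpha>
    unfolding I_def
  proof (rule Bochner_Integration.integral_nonneg)
    fix \<omega> assume "\<omega> \<in> space M"
    then show "0 \<le> of_bool (S (G T 0 \<omega>)) * (1 / (weight (G T \<alpha> \<omega>) v - 1))"
      using gt[of \<omega> \<alpha>] by (cases "S (G T 0 \<omega>)") auto
  qed
  have step: "I (Suc \<alpha>) \<le> exp (- r) * I \<alpha>" if \<alpha>: "Suc \<alpha> \<le> m" for \<alpha>
  proof -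
    have "I (Suc \<alpha>) = (1 - 1 / step_total T (Suc \<alpha>)) * I \<alpha>"
      unfolding I_def by (rule inverse_weight_step[OF T \<alpha> v S])
    also have "\<dots> \<le> exp (- r) * I \<alpha>"
    proof (rule mult_right_mono[OF _ nonneg])
      have "r \<le> 1 / step_total T (Suc \<alpha>)"
        unfolding r_def using step_total_pos[OF T, of "Suc \<alpha>"] step_total_le[OF \<alpha>, of T]
        by (intro divide_left_mono) auto
      then show "1 - 1 / step_total T (Suc \<alpha>) \<le> exp (- r)"
        using exp_ge_add_one_self[of "- r"] by linarith
    qed
    finally show ?thesis .
  qed
  have "I \<alpha> \<le> exp (- (real \<alpha> * r)) * I 0" if "\<alpha> \<le> m" for \<alpha>
    using that
  proof (induction \<alpha>)
    case (Suc \<alpha>)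
    have "I (Suc \<alpha>) \<le> exp (- r) * I \<alpha>" by (rule step[OF Suc.prems])
    also have "\<dots> \<le> exp (- r) * (exp (- (real \<alpha> * r)) * I 0)"
      using Suc by (intro mult_left_mono) auto
    also have "\<dots> = exp (- (real (Suc \<alpha>) * r)) * I 0"
      by (simp add: exp_add[symmetric] algebra_simps)
    finally show ?case .
  qed simp
  from this[of m] show ?thesis
    using T by (simp add: I_def r_def G_next)
qed

lemma G_mono: "\<alpha> \<le> \<beta> \<Longrightarrow> G T \<alpha> \<omega> \<subseteq># G T \<beta> \<omega>"
proof (induction \<beta> rule: dec_induct)
  case (step \<beta>)
  then show ?case unfolding G_Suc by (metis mset_subset_eq_add_left subset_mset.order_trans)
qed simp

definition hit :: "nat \<Rightarrow> nat set \<Rightarrow> 'w \<Rightarrow> bool" where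
  "hit T U \<omega> \<longleftrightarrow> (\<forall>u\<in>U. (T, u) \<in># G (Suc T) 0 \<omega>)"

text \<open>It suffices that the \<open>j\<close>-th edge of \<open>T\<close> points to the
  \<open>j\<close>-th element of \<open>U\<close> for every \<open>j\<close> up to
  \<open>card U\<close>. Weights do not decrease while \<open>T\<close> attaches, and the normaliser
  stays at most \<open>(2 * m + \<delta>) * (T - 1)\<close>, so every edge contributes at least the
  same factor.\<close>

lemma hit_prob:
  assumes T: "3 \<le> T" and U: "U \<subseteq> {1..T - 1}" "card U \<le> m" and w: "0 \<le> w"
    and S: "\<And>\<omega> u. \<omega> \<in> space M \<Longrightarrow> S (G T 0 \<omega>) \<Longrightarrow> u \<in> U \<Longrightarrow> w \<le> weight (G T 0 \<omega>) u"
  shows "(w / ((2 * real m + \<delta>) * (real T - 1))) ^ card U * prob {\<omega> \<in> space M. S (G T 0 \<omega>)} \<le>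
    prob {\<omega> \<in> space M. S (G T 0 \<omega>) \<and> hit T U \<omega>}"
proof -
  define p where "p = w / ((2 * real m + \<delta>) * (real T - 1))"
  have p0: "0 \<le> p" unfolding p_def using w T delta_gt by simp
  have "finite U" using U(1) finite_subset by blast
  then obtain us where us: "set us = U" "distinct us" using finite_distinct_list by blast
  have len: "length us = card U" using us distinct_card by metis
  define Q where "Q j g \<longleftrightarrow> S (filter_mset (\<lambda>e. fst e < T) g) \<and> (\<forall>u\<in>set (take j us). (T, u) \<in># g)"
    for j and g :: "(nat \<times> nat) multiset"
  have fil: "filter_mset (\<lambda>e. fst e < T) (G T \<beta> \<omega>) = G T 0 \<omega>" for \<beta> \<omega> using T by (simp add: G_filter)
  have sG: "simple_function M (G T \<beta>)" if "\<beta> \<le> m" for \<beta> using T that by (intro simple_G) auto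
  have claim: "p ^ j * prob {\<omega> \<in> space M. S (G T 0 \<omega>)} \<le> prob {\<omega> \<in> space M. Q j (G T j \<omega>)}"
    if "j \<le> card U" for j
    using that
  proof (induction j)
    case 0
    then show ?case unfolding Q_def fil by simp
  next
    case (Suc j)
    define v where "v = us ! j"
    have vU: "v \<in> U" using Suc.prems us(1) len unfolding v_def by (metis Suc_le_lessD nth_mem)
    have j: "Suc j \<le> m" using Suc.prems U(2) by simp
    have sE: "simple_function M (E T (Suc j))" using T j by (intro simple_target) auto
    have pair: "simple_function M (\<lambda>\<omega>. (E T (Suc j) \<omega>, G T j \<omega>))"
      using sE sG[of j] j by (intro simple_function_compose2[where h = Pair]) auto
    have "p ^ Suc j * prob {\<omega> \<in> space M. S (G T 0 \<omega>)} \<le> p * prob {\<omega> \<in> space M. Q j (G T j \<omega>)}"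
      using Suc p0 by (simp add: mult.assoc mult_left_mono)
    also have "\<dots> = p * (\<integral>\<omega>. of_bool (Q j (G T j \<omega>)) \<partial>M)"
      using prob_eq_integral_simple(2)[OF sG, of j "Q j"] j by simp
    also have "\<dots> = (\<integral>\<omega>. p * of_bool (Q j (G T j \<omega>)) \<partial>M)"
      by (rule Bochner_Integration.integral_mult_right_zero[symmetric])
    also have "\<dots> \<le> (\<integral>\<omega>. weight (G T j \<omega>) v / step_total T (Suc j) * of_bool (Q j (G T j \<omega>)) \<partial>M)"
    proof (rule integral_mono)
      show "integrable M (\<lambda>\<omega>. p * of_bool (Q j (G T j \<omega>)))"
        using expectation_simple(1)[OF sG, of j "\<lambda>g. p * of_bool (Q j g)"] j by simp
      show "integrable M (\<lambda>\<omega>. weight (G T j \<omega>) v / step_total T (Suc j) * of_bool (Q j (G T j \<omega>)))"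
        using expectation_simple(1)[OF sG, of j "\<lambda>g. weight g v / step_total T (Suc j) * of_bool (Q j g)"] j by simp
      fix \<omega> assume \<omega>: "\<omega> \<in> space M"
      show "p * of_bool (Q j (G T j \<omega>)) \<le> weight (G T j \<omega>) v / step_total T (Suc j) * of_bool (Q j (G T j \<omega>))"
      proof (cases "Q j (G T j \<omega>)")
        case True
        then have "S (G T 0 \<omega>)" unfolding Q_def fil by blast
        then have "w \<le> weight (G T 0 \<omega>) v" using S[OF \<omega> _ vU] by blast
        also have "\<dots> \<le> weight (G T j \<omega>) v" using T by (intro weight_mono) auto
        finally have "p \<le> weight (G T j \<omega>) v / step_total T (Suc j)"
          unfolding p_def using w step_total_pos[OF T, of "Suc j"] step_total_le[OF j, of T] by (intro frac_le) auto
        then show ?thesis using True by simp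
      qed simp
    qed
    also have "\<dots> = (\<integral>\<omega>. of_bool (E T (Suc j) \<omega> = v) * of_bool (Q j (G T j \<omega>)) \<partial>M)"
      using vU U(1) by (intro attachment_expectation[OF T j, symmetric]) auto
    also have "\<dots> = (\<integral>\<omega>. of_bool (E T (Suc j) \<omega> = v \<and> Q j (G T j \<omega>)) \<partial>M)"
      by (intro Bochner_Integration.integral_cong) auto
    also have "\<dots> = prob {\<omega> \<in> space M. E T (Suc j) \<omega> = v \<and> Q j (G T j \<omega>)}"
      using prob_eq_integral_simple(2)[OF pair, of "\<lambda>q. fst q = v \<and> Q j (snd q)"] by simp
    also have "\<dots> \<le> prob {\<omega> \<in> space M. Q (Suc j) (G T (Suc j) \<omega>)}"
    proof (rule finite_measure_mono)
      show "{\<omega> \<in> space M. Q (Suc j) (G T (Suc j) \<omega>)} \<in> events"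
        using prob_eq_integral_simple(1)[OF sG[OF j]] .
      have "take (Suc j) us = take j us @ [v]"
        unfolding v_def using Suc.prems len by (intro take_Suc_conv_app_nth) simp
      then show "{\<omega> \<in> space M. E T (Suc j) \<omega> = v \<and> Q j (G T j \<omega>)} \<subseteq> {\<omega> \<in> space M. Q (Suc j) (G T (Suc j) \<omega>)}"
        unfolding Q_def fil by (auto simp: G_Suc)
    qed
    finally show ?case .
  qed
  have "p ^ card U * prob {\<omega> \<in> space M. S (G T 0 \<omega>)} \<le> prob {\<omega> \<in> space M. Q (card U) (G T (card U) \<omega>)}"
    by (rule claim) simp
  also have "\<dots> \<le> prob {\<omega> \<in> space M. S (G T 0 \<omega>) \<and> hit T U \<omega>}"
  proof (rule finite_measure_mono)
    have "{\<omega> \<in> space M. S (G T 0 \<omega>) \<and> hit T U \<omega>} = {\<omega> \<in> space M. Q (card U) (G T m \<omega>)}"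
      unfolding Q_def fil hit_def using T us(1) len by (auto simp: G_next)
    then show "{\<omega> \<in> space M. S (G T 0 \<omega>) \<and> hit T U \<omega>} \<in> events"
      using prob_eq_integral_simple(1)[OF sG, of m] by simp
    show "{\<omega> \<in> space M. Q (card U) (G T (card U) \<omega>)} \<subseteq> {\<omega> \<in> space M. S (G T 0 \<omega>) \<and> hit T U \<omega>}"
      unfolding Q_def fil hit_def using T us(1) len set_mset_mono[OF G_mono[OF U(2)]] by (auto simp: G_next)
  qed
  finally show ?thesis unfolding p_def .
qed

end

text \<open>The decrements dominate a multiple of the harmonic series.\<close>

lemma harmonic_decay:
  fixes a :: "nat \<Rightarrow> real"
  assumes nonneg: "\<And>n. 0 \<le> a n" and c: "0 < c" and \<epsilon>: "0 < \<epsilon>"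
    and step: "\<And>n. n0 \<le> n \<Longrightarrow> a (Suc n) \<le> (1 - c / (real n - 1)) * a n" and n0: "2 \<le> n0"
  shows "\<exists>n\<ge>n0. a n < \<epsilon>"
proof (rule ccontr)
  assume "\<not> ?thesis"
  then have big: "\<epsilon> \<le> a n" if "n0 \<le> n" for n using that by force
  have bound: "a (n0 + k) + c * \<epsilon> * (\<Sum>i<k. 1 / (real (n0 + i) - 1)) \<le> a n0" for k
  proof (induction k)
    case (Suc k)
    have "c / (real (n0 + k) - 1) * \<epsilon> \<le> c / (real (n0 + k) - 1) * a (n0 + k)"
      using c n0 big[of "n0 + k"] by (intro mult_left_mono) auto
    then have "a (Suc (n0 + k)) + c * \<epsilon> * (1 / (real (n0 + k) - 1)) \<le> a (n0 + k)"
      using step[of "n0 + k"] by (simp add: algebra_simps)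
    then show ?case using Suc by (simp add: algebra_simps)
  qed simp
  have "summable (\<lambda>i. 1 / (real (n0 + i) - 1))"
  proof (rule summableI_nonneg_bounded)
    show "0 \<le> 1 / (real (n0 + i) - 1)" for i using n0 by simp
    show "(\<Sum>i<k. 1 / (real (n0 + i) - 1)) \<le> a n0 / (c * \<epsilon>)" for k
      using bound[of k] nonneg[of "n0 + k"] c \<epsilon> by (simp add: pos_le_divide_eq mult.commute)
  qed
  then have "summable (\<lambda>i. inverse (real (i + (n0 - 1))))"
    using n0 by (simp add: inverse_eq_divide of_nat_diff algebra_simps)
  then have "summable (\<lambda>i. inverse (real i))"
    by (subst (asm) summable_iff_shift)
  then show False using not_summable_harmonic[where 'a = real] by simp
qed

section \<open>Hitting a set of nodes, and unboundedness of degrees\<close>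

context admissible_pa
begin

definition past :: "nat \<Rightarrow> (nat \<times> nat) multiset \<Rightarrow> (nat \<times> nat) multiset" where
  "past s g = filter_mset (\<lambda>e. fst e < s) g"

lemma past_G: "s \<le> T \<Longrightarrow> 2 \<le> s \<Longrightarrow> past s (G T \<alpha> \<omega>) = G s 0 \<omega>"
  unfolding past_def by (rule G_filter)

lemma event_G: "2 \<le> T \<Longrightarrow> {\<omega> \<in> space M. S (G T 0 \<omega>)} \<in> events"
  using prob_eq_integral_simple(1)[OF simple_G[of T 0]] by simp

lemma event_hit: "2 \<le> T \<Longrightarrow> {\<omega> \<in> space M. hit T U \<omega>} \<in> events"
  unfolding hit_def by (rule event_G) simp

text \<open>\<open>C\<close> is a condition guaranteeing weights of at least \<open>w T\<close>. On
  the event that it has held so far without a hit, node \<open>T\<close> hits \<open>U\<close> with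
  conditional probability at least \<open>c / (T - 1)\<close>, so \<open>harmonic_decay\<close>
  applies.\<close>

lemma avoid_prob_small:
  assumes T0: "3 \<le> T0" and U: "U \<subseteq> {1..T0 - 1}" "card U \<le> m"
    and w: "\<And>T. T0 \<le> T \<Longrightarrow> 0 \<le> w T"
      "\<And>T \<omega> u. T0 \<le> T \<Longrightarrow> \<omega> \<in> space M \<Longrightarrow> C T (G T 0 \<omega>) \<Longrightarrow> u \<in> U \<Longrightarrow> w T \<le> weight (G T 0 \<omega>) u"
    and c: "0 < c" "\<And>T. T0 \<le> T \<Longrightarrow> c / (real T - 1) \<le> (w T / ((2 * real m + \<delta>) * (real T - 1))) ^ card U"
    and \<epsilon>: "0 < \<epsilon>"
  shows "\<exists>T\<ge>T0. prob {\<omega> \<in> space M. (\<forall>s\<in>{T0..T}. C s (G s 0 \<omega>)) \<and> (\<forall>s\<in>{T0..<T}. \<not> hit s U \<omega>)} < \<epsilon>"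
proof -
  define B where "B T \<omega> \<longleftrightarrow> (\<forall>s\<in>{T0..T}. C s (G s 0 \<omega>)) \<and> (\<forall>s\<in>{T0..<T}. \<not> hit s U \<omega>)" for T \<omega>
  \<comment> \<open>The same event read off from the graph at time \<open>T\<close>, so that
    \<open>hit_prob\<close> can be applied to it.\<close>
  define S where "S T g \<longleftrightarrow> (\<forall>s\<in>{T0..T}. C s (past s g)) \<and>
      (\<forall>s\<in>{T0..<T}. \<not> (\<forall>u\<in>U. (s, u) \<in># past (Suc s) g))" for T g
  have BS: "B T \<omega> \<longleftrightarrow> S T (G T 0 \<omega>)" for T \<omega>
    unfolding B_def S_def hit_def using T0 by (auto simp: past_G)
  define a where "a T = prob {\<omega> \<in> space M. B T \<omega>}" for T
  have step: "a (Suc T) \<le> (1 - c / (real T - 1)) * a T" if T: "T0 \<le> T" for T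
  proof -
    have T3: "3 \<le> T" using T T0 by simp
    have evB: "{\<omega> \<in> space M. B T \<omega>} \<in> events" unfolding BS using T3 by (intro event_G) simp
    have evH: "{\<omega> \<in> space M. B T \<omega> \<and> hit T U \<omega>} \<in> events"
    proof -
      have "{\<omega> \<in> space M. B T \<omega> \<and> hit T U \<omega>} = {\<omega> \<in> space M. B T \<omega>} \<inter> {\<omega> \<in> space M. hit T U \<omega>}" by auto
      then show ?thesis using evB event_hit[of T U] T3 by auto
    qed
    have "c / (real T - 1) * a T \<le> (w T / ((2 * real m + \<delta>) * (real T - 1))) ^ card U * a T"
      unfolding a_def using c(2)[OF T] by (intro mult_right_mono) auto
    also have "\<dots> \<le> prob {\<omega> \<in> space M. B T \<omega> \<and> hit T U \<omega>}"
      unfolding a_def BS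
    proof (rule hit_prob[OF T3 _ U(2) w(1)[OF T]])
      show "U \<subseteq> {1..T - 1}" by (rule order_trans[OF U(1)]) (use T in auto)
      show "w T \<le> weight (G T 0 \<omega>) u" if "\<omega> \<in> space M" "S T (G T 0 \<omega>)" "u \<in> U" for \<omega> u
      proof (rule w(2)[OF T that(1) _ that(3)])
        show "C T (G T 0 \<omega>)" using that(2) T unfolding BS[symmetric] B_def by simp
      qed
    qed
    finally have hit: "c / (real T - 1) * a T \<le> prob {\<omega> \<in> space M. B T \<omega> \<and> hit T U \<omega>}" .
    have "a (Suc T) \<le> prob ({\<omega> \<in> space M. B T \<omega>} - {\<omega> \<in> space M. B T \<omega> \<and> hit T U \<omega>})"
      unfolding a_def
    proof (rule finite_measure_mono)
      show "{\<omega> \<in> space M. B (Suc T) \<omega>} \<subseteq> {\<omega> \<in> space M. B T \<omega>} - {\<omega> \<in> space M. B T \<omega> \<and> hit T U \<omega>}"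
        using T unfolding B_def by auto
    qed (use evB evH in auto)
    also have "\<dots> = a T - prob {\<omega> \<in> space M. B T \<omega> \<and> hit T U \<omega>}"
      unfolding a_def by (rule finite_measure_Diff[OF evB evH]) auto
    finally show ?thesis using hit by (simp add: algebra_simps)
  qed
  have "\<exists>T\<ge>T0. a T < \<epsilon>"
    using T0 by (intro harmonic_decay[of a c \<epsilon> T0] c \<epsilon> step) (auto simp: a_def)
  then show ?thesis unfolding a_def B_def .
qed

lemma event_never_hit: "2 \<le> T0 \<Longrightarrow> {\<omega> \<in> space M. \<forall>s\<ge>T0. \<not> hit s U \<omega>} \<in> events"
proof -
  assume T0: "2 \<le> T0"
  have "{\<omega> \<in> space M. \<forall>s\<ge>T0. \<not> hit s U \<omega>} = space M - (\<Union>s\<in>{T0..}. {\<omega> \<in> space M. hit s U \<omega>})" by auto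
  moreover have "(\<Union>s\<in>{T0..}. {\<omega> \<in> space M. hit s U \<omega>}) \<in> events"
    using T0 event_hit by (intro sets.countable_UN'') auto
  ultimately show ?thesis by auto
qed

lemma multigraph_degree_ge:
  assumes T: "3 \<le> T" and u: "u \<in> {1..T - 1}" and \<omega>: "\<omega> \<in> space M"
  shows "m \<le> multigraph_degree (G T 0 \<omega>) u"
proof -
  have deg_sum: "multigraph_degree (\<Sum>i\<in>I. h i) v = (\<Sum>i\<in>I. multigraph_degree (h i) v)"
    for I :: "nat set" and h :: "nat \<Rightarrow> (nat \<times> nat) multiset" and v
    by (induction I rule: infinite_finite_induct) (auto simp: multigraph_degree_add, auto simp: multigraph_degree_def)
  \<comment> \<open>All \<open>m\<close> edges of node \<open>s\<close> touch \<open>u\<close>: node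
    1 receives those of node 2, and any other node sends its own.\<close>
  define s where "s = max 2 u"
  have s: "s \<in> {2..<T}" using T u unfolding s_def by auto
  have one: "1 \<le> multigraph_degree {#(s, E s \<beta> \<omega>)#} u" if "\<beta> \<in> {1..m}" for \<beta>
  proof (cases "u = 1")
    case True
    then have "s = 2" unfolding s_def by simp
    then have "E s \<beta> \<omega> = u" using initial_target[of \<beta> \<omega>] that \<omega> True by simp
    then show ?thesis by (simp add: multigraph_degree_single)
  next
    case False
    then have "s = u" using u unfolding s_def by auto
    then show ?thesis by (simp add: multigraph_degree_single)
  qed
  have "m = (\<Sum>\<beta>\<in>{1..m}. 1)" by simp
  also have "\<dots> \<le> (\<Sum>\<beta>\<in>{1..m}. multigraph_degree {#(s, E s \<beta> \<omega>)#} u)"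
    using one by (intro sum_mono) auto
  also have "\<dots> = multigraph_degree (\<Sum>\<beta>\<in>{1..m}. {#(s, E s \<beta> \<omega>)#}) u"
    by (simp only: deg_sum)
  also have "\<dots> \<le> (\<Sum>s\<in>{2..<T}. multigraph_degree (\<Sum>\<beta>\<in>{1..m}. {#(s, E s \<beta> \<omega>)#}) u)"
    using s by (intro member_le_sum) auto
  also have "\<dots> = multigraph_degree (G T 0 \<omega>) u"
    unfolding pa_graph_def by (simp add: deg_sum)
  finally show ?thesis .
qed

lemma AE_notin_of_prob_le:
  assumes "A \<in> events" "\<And>\<epsilon>. 0 < \<epsilon> \<Longrightarrow> prob A \<le> \<epsilon>"
  shows "AE \<omega> in M. \<omega> \<notin> A"
proof -
  have "prob A \<le> 0" using assms(2) by (rule field_le_epsilon) simp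
  then have "A \<in> null_sets M"
    using assms(1) measure_nonneg[of M A] by (intro null_setsI) (auto simp: emeasure_eq_measure)
  then show ?thesis by (rule AE_not_in)
qed

text \<open>For a single target the constant lower bound \<open>m + \<delta>\<close> of the weight
  is enough, since the hitting probability is then already of order \<open>1 / T\<close>.\<close>

lemma AE_hit_single:
  assumes u: "u \<in> {1..T0 - 1}" and T0: "3 \<le> T0"
  shows "AE \<omega> in M. \<exists>s\<ge>T0. hit s {u} \<omega>"
proof -
  define A where "A = {\<omega> \<in> space M. \<forall>s\<ge>T0. \<not> hit s {u} \<omega>}"
  have ev: "A \<in> events" unfolding A_def using T0 by (intro event_never_hit) simp
  have "prob A \<le> \<epsilon>" if \<epsilon>: "0 < \<epsilon>" for \<epsilon>
  proof -
    have "\<exists>T\<ge>T0. prob {\<omega> \<in> space M. (\<forall>s\<in>{T0..T}. True) \<and> (\<forall>s\<in>{T0..<T}. \<not> hit s {u} \<omega>)} < \<epsilon>"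
    proof (rule avoid_prob_small[where C = "\<lambda>_ _. True" and w = "\<lambda>_. real m + \<delta>" and c = "(real m + \<delta>) / (2 * real m + \<delta>)", OF T0])
      show "real m + \<delta> \<le> weight (G T 0 \<omega>) v" if "T0 \<le> T" "\<omega> \<in> space M" "v \<in> {u}" for T \<omega> v
        using multigraph_degree_ge[of T v \<omega>] that u T0 unfolding weight_def by auto
      show "0 < (real m + \<delta>) / (2 * real m + \<delta>)" using delta_gt m_pos by (intro divide_pos_pos) auto
    qed (use u delta_gt m_pos \<epsilon> in auto)
    then obtain T where T: "T \<ge> T0" "prob {\<omega> \<in> space M. \<forall>s\<in>{T0..<T}. \<not> hit s {u} \<omega>} < \<epsilon>" by auto
    have "{\<omega> \<in> space M. \<forall>s\<in>{T0..<T}. \<not> hit s {u} \<omega>} \<in> events"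
    proof -
      have "{\<omega> \<in> space M. \<forall>s\<in>{T0..<T}. \<not> hit s {u} \<omega>} =
          space M - (\<Union>s\<in>{T0..<T}. {\<omega> \<in> space M. hit s {u} \<omega>})" by auto
      moreover have "(\<Union>s\<in>{T0..<T}. {\<omega> \<in> space M. hit s {u} \<omega>}) \<in> events"
        using T0 event_hit by (intro sets.finite_UN) auto
      ultimately show ?thesis by auto
    qed
    then have "prob A \<le> prob {\<omega> \<in> space M. \<forall>s\<in>{T0..<T}. \<not> hit s {u} \<omega>}"
      unfolding A_def by (intro finite_measure_mono) auto
    then show ?thesis using T(2) by linarith
  qed
  then have "AE \<omega> in M. \<omega> \<notin> A" by (intro AE_notin_of_prob_le[OF ev])
  then show ?thesis
    by (rule AE_mp) (auto intro!: AE_I2 simp: A_def)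
qed

text \<open>Every hit raises the degree of \<open>u\<close>, and almost surely a hit occurs after
  every time. This brings the weight above 1, where \<open>1 / (w - 1)\<close> becomes
  usable.\<close>

lemma AE_weight_large:
  assumes u: "1 \<le> u"
  shows "AE \<omega> in M. \<exists>T0\<ge>3. \<forall>T\<ge>T0. K \<le> weight (G T 0 \<omega>) u"
proof -
  have "AE \<omega> in M. \<forall>T0\<in>{max 3 (u + 1)..}. \<exists>s\<ge>T0. hit s {u} \<omega>"
    using u by (subst AE_ball_countable) (auto intro!: AE_hit_single)
  then show ?thesis
  proof (rule AE_mp, intro AE_I2 impI)
    fix \<omega> assume \<omega>: "\<omega> \<in> space M" and h: "\<forall>T0\<in>{max 3 (u + 1)..}. \<exists>s\<ge>T0. hit s {u} \<omega>"
    have "\<exists>T\<ge>max 3 (u + 1). N \<le> multigraph_degree (G T 0 \<omega>) u" for N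
    proof (induction N)
      case 0
      then show ?case by auto
    next
      case (Suc N)
      then obtain T where T: "T \<ge> max 3 (u + 1)" "N \<le> multigraph_degree (G T 0 \<omega>) u" by blast
      then obtain s where s: "s \<ge> T" "hit s {u} \<omega>" using h by auto
      then have s': "(s, u) \<in># G (Suc s) 0 \<omega>" "2 \<le> s" using T unfolding hit_def by auto
      have "G s 0 \<omega> + {#(s, u)#} \<subseteq># G (Suc s) 0 \<omega>"
      proof -
        have "G s 0 \<omega> = filter_mset (\<lambda>e. fst e < s) (G (Suc s) 0 \<omega>)" using s' by (simp add: G_filter)
        moreover have "{#(s, u)#} \<subseteq># filter_mset (\<lambda>e. \<not> fst e < s) (G (Suc s) 0 \<omega>)" using s' by simp
        ultimately show ?thesis
          using multiset_partition[of "G (Suc s) 0 \<omega>" "\<lambda>e. fst e < s"] by (metis mset_subset_eq_mono_add_left_cancel)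
      qed
      then have "multigraph_degree (G s 0 \<omega> + {#(s, u)#}) u \<le> multigraph_degree (G (Suc s) 0 \<omega>) u"
        by (rule multigraph_degree_mono)
      then have "multigraph_degree (G s 0 \<omega>) u + 1 \<le> multigraph_degree (G (Suc s) 0 \<omega>) u"
        unfolding multigraph_degree_add multigraph_degree_single by simp
      moreover have "multigraph_degree (G T 0 \<omega>) u \<le> multigraph_degree (G s 0 \<omega>) u"
        using s(1) T by (intro multigraph_degree_mono G_subset) auto
      ultimately have "Suc N \<le> multigraph_degree (G (Suc s) 0 \<omega>) u" using T by linarith
      then show ?case using s(1) T by (intro exI[of _ "Suc s"]) auto
    qed
    then obtain T0 where T0: "T0 \<ge> max 3 (u + 1)" "nat \<lceil>K - \<delta>\<rceil> \<le> multigraph_degree (G T0 0 \<omega>) u" by blast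
    have "K \<le> weight (G T 0 \<omega>) u" if "T \<ge> T0" for T
    proof -
      have "K - \<delta> \<le> real (nat \<lceil>K - \<delta>\<rceil>)" by (rule real_nat_ceiling_ge)
      then have "K \<le> weight (G T0 0 \<omega>) u" using T0(2) unfolding weight_def by linarith
      also have "\<dots> \<le> weight (G T 0 \<omega>) u" using that T0(1) by (intro weight_mono) auto
      finally show ?thesis .
    qed
    then show "\<exists>T0\<ge>3. \<forall>T\<ge>T0. K \<le> weight (G T 0 \<omega>) u"
      using T0(1) by (intro exI[of _ T0]) auto
  qed
qed

section \<open>The supermartingale and common neighbours\<close>

lemma pa_x_eq: "pa_x \<delta> m = (real m + \<delta>) / (2 * real m + \<delta>)" "1 - pa_x \<delta> m = real m / (2 * real m + \<delta>)"
proof -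
  have "2 * real m + \<delta> > 0" using delta_gt m_pos by simp
  then show "pa_x \<delta> m = (real m + \<delta>) / (2 * real m + \<delta>)" "1 - pa_x \<delta> m = real m / (2 * real m + \<delta>)"
    using m_pos unfolding pa_x_def by (simp_all add: field_simps)
qed

lemma pa_x_bounds: "0 < pa_x \<delta> m" "pa_x \<delta> m < 1"
  unfolding pa_x_eq using delta_gt m_pos by simp_all

text \<open>With \<open>x = pa_x \<delta> m\<close>, the decay factors of
  \<open>inverse_weight_node\<close> are \<open>exp (- (1 - x) / (T - 1))\<close>, whose product is
  of order \<open>T powr (- (1 - x))\<close>; this is the compensating factor.\<close>

definition growth :: "nat \<Rightarrow> real" where
  "growth T = (real T - 1) powr (1 - pa_x \<delta> m)"

text \<open>The sum over \<open>U\<close> lets a single maximal inequality bound all the weights of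
  \<open>U\<close> from below.\<close>

definition potential :: "nat set \<Rightarrow> (nat \<times> nat) multiset \<Rightarrow> real" where
  "potential U g = (\<Sum>u\<in>U. 1 / (weight g u - 1))"

lemma growth_pos: "2 \<le> T \<Longrightarrow> 0 < growth T"
  unfolding growth_def by simp

text \<open>After taking logarithms this is \<open>ln T - ln (T - 1) \<le> 1 / (T - 1)\<close>,
  multiplied by the exponent of \<open>growth\<close>.\<close>

lemma growth_Suc_le:
  assumes T: "3 \<le> T"
  shows "growth (Suc T) * exp (- (real m / ((2 * real m + \<delta>) * (real T - 1)))) \<le> growth T"
proof -
  define y where "y = 1 - pa_x \<delta> m"
  have y: "0 < y" unfolding y_def using pa_x_bounds by simp
  have "ln (real T) - ln (real T - 1) = ln (real T / (real T - 1))"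
    using T by (subst ln_div) auto
  also have "\<dots> \<le> real T / (real T - 1) - 1"
    using T by (intro ln_le_minus_one) auto
  also have "\<dots> = 1 / (real T - 1)" using T by (simp add: field_simps)
  finally have "ln (real T) \<le> ln (real T - 1) + 1 / (real T - 1)" by simp
  then have "y * ln (real T) \<le> y * (ln (real T - 1) + 1 / (real T - 1))"
    using y by (intro mult_left_mono) auto
  moreover have "real m / ((2 * real m + \<delta>) * (real T - 1)) = y * (1 / (real T - 1))"
    unfolding y_def pa_x_eq(2) by simp
  ultimately have "y * ln (real T) - real m / ((2 * real m + \<delta>) * (real T - 1)) \<le> y * ln (real T - 1)"
    by (simp add: algebra_simps)
  then have "exp (y * ln (real T) - real m / ((2 * real m + \<delta>) * (real T - 1))) \<le> exp (y * ln (real T - 1))"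
    by simp
  then show ?thesis
    using T unfolding growth_def y_def[symmetric] powr_def by (simp add: exp_diff exp_minus field_simps)
qed

lemma potential_supermartingale:
  assumes T: "3 \<le> T" and U: "U \<subseteq> {1..T - 1}"
    and S: "\<And>\<omega> u. \<omega> \<in> space M \<Longrightarrow> S (G T 0 \<omega>) \<Longrightarrow> u \<in> U \<Longrightarrow> 1 < weight (G T 0 \<omega>) u"
  shows "growth (Suc T) * (\<integral>\<omega>. of_bool (S (G T 0 \<omega>)) * potential U (G (Suc T) 0 \<omega>) \<partial>M) \<le>
    growth T * (\<integral>\<omega>. of_bool (S (G T 0 \<omega>)) * potential U (G T 0 \<omega>) \<partial>M)"
proof -
  define r where "r = exp (- (real m / ((2 * real m + \<delta>) * (real T - 1))))"
  have fU: "finite U" using U finite_subset by blast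
  have sG: "simple_function M (G T 0)" "simple_function M (G (Suc T) 0)" using T by (auto intro!: simple_G)
  have pair: "simple_function M (\<lambda>\<omega>. (G T 0 \<omega>, G (Suc T) 0 \<omega>))"
    using sG by (intro simple_function_compose2[where h = Pair])
  have int1: "integrable M (\<lambda>\<omega>. of_bool (S (G T 0 \<omega>)) * (1 / (weight (G (Suc T) 0 \<omega>) u - 1)))" for u
    using expectation_simple(1)[OF pair, of "\<lambda>p. of_bool (S (fst p)) * (1 / (weight (snd p) u - 1))"] by simp
  have int0: "integrable M (\<lambda>\<omega>. of_bool (S (G T 0 \<omega>)) * (1 / (weight (G T 0 \<omega>) u - 1)))" for u
    using expectation_simple(1)[OF sG(1), of "\<lambda>g. of_bool (S g) * (1 / (weight g u - 1))"] by simp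
  have "(\<integral>\<omega>. of_bool (S (G T 0 \<omega>)) * potential U (G (Suc T) 0 \<omega>) \<partial>M) =
      (\<Sum>u\<in>U. \<integral>\<omega>. of_bool (S (G T 0 \<omega>)) * (1 / (weight (G (Suc T) 0 \<omega>) u - 1)) \<partial>M)"
    unfolding potential_def sum_distrib_left by (rule Bochner_Integration.integral_sum) (rule int1)
  also have "\<dots> \<le> (\<Sum>u\<in>U. r * (\<integral>\<omega>. of_bool (S (G T 0 \<omega>)) * (1 / (weight (G T 0 \<omega>) u - 1)) \<partial>M))"
    unfolding r_def using U S by (intro sum_mono inverse_weight_node T) auto
  also have "\<dots> = r * (\<integral>\<omega>. of_bool (S (G T 0 \<omega>)) * potential U (G T 0 \<omega>) \<partial>M)"
    unfolding potential_def sum_distrib_left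
    by (subst Bochner_Integration.integral_sum) (simp_all only: int0 sum_distrib_left)
  finally have le: "(\<integral>\<omega>. of_bool (S (G T 0 \<omega>)) * potential U (G (Suc T) 0 \<omega>) \<partial>M) \<le>
      r * (\<integral>\<omega>. of_bool (S (G T 0 \<omega>)) * potential U (G T 0 \<omega>) \<partial>M)" .
  have nonneg: "0 \<le> (\<integral>\<omega>. of_bool (S (G T 0 \<omega>)) * potential U (G T 0 \<omega>) \<partial>M)"
  proof (rule Bochner_Integration.integral_nonneg)
    fix \<omega> assume \<omega>: "\<omega> \<in> space M"
    show "0 \<le> of_bool (S (G T 0 \<omega>)) * potential U (G T 0 \<omega>)"
    proof (cases "S (G T 0 \<omega>)")
      case True
      then have "0 \<le> potential U (G T 0 \<omega>)"
        unfolding potential_def using S[OF \<omega> True] by (intro sum_nonneg) (simp add: less_imp_le)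
      then show ?thesis by simp
    qed simp
  qed
  have "growth (Suc T) * (\<integral>\<omega>. of_bool (S (G T 0 \<omega>)) * potential U (G (Suc T) 0 \<omega>) \<partial>M) \<le>
      growth (Suc T) * r * (\<integral>\<omega>. of_bool (S (G T 0 \<omega>)) * potential U (G T 0 \<omega>) \<partial>M)"
    using mult_left_mono[OF le, of "growth (Suc T)"] growth_pos[of "Suc T"] T by (simp add: mult.assoc)
  also have "\<dots> \<le> growth T * (\<integral>\<omega>. of_bool (S (G T 0 \<omega>)) * potential U (G T 0 \<omega>) \<partial>M)"
    using growth_Suc_le[OF T] nonneg unfolding r_def by (rule mult_right_mono)
  finally show ?thesis .
qed

text \<open>Doob's maximal inequality for the supermartingale \<open>growth * potential\<close>, started at time \<open>T0\<close>.\<close>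

lemma potential_maximal:
  fixes \<Lambda> :: real
  assumes T0: "3 \<le> T0" and U: "U \<subseteq> {1..T0 - 1}" and "T0 \<le> T"
  defines "\<Omega>\<^sub>0 \<omega> \<equiv> \<forall>u\<in>U. 2 \<le> weight (G T0 0 \<omega>) u"
    and "good s \<omega> \<equiv> growth s * potential U (G s 0 \<omega>) < \<Lambda>"
  shows "\<Lambda> * prob {\<omega> \<in> space M. \<Omega>\<^sub>0 \<omega> \<and> \<not> (\<forall>s\<in>{T0..T}. good s \<omega>)} \<le>
    growth T0 * (\<integral>\<omega>. of_bool (\<Omega>\<^sub>0 \<omega>) * potential U (G T0 0 \<omega>) \<partial>M)"
proof -
  define C where "C T \<omega> \<longleftrightarrow> \<Omega>\<^sub>0 \<omega> \<and> (\<forall>s\<in>{T0..T}. good s \<omega>)" for T \<omega>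
  define S where "S T g \<longleftrightarrow> (\<forall>u\<in>U. 2 \<le> weight (past T0 g) u) \<and>
      (\<forall>s\<in>{T0..T}. growth s * potential U (past s g) < \<Lambda>)" for T g
  have CS: "C T \<omega> \<longleftrightarrow> S T (G T' 0 \<omega>)" if "T0 \<le> T'" "T \<le> T'" for T T' \<omega>
    unfolding C_def S_def \<Omega>\<^sub>0_def good_def using T0 that by (auto simp: past_G)
  define S0 where "S0 g \<longleftrightarrow> (\<forall>u\<in>U. 2 \<le> weight (past T0 g) u)" for g
  have OS: "\<Omega>\<^sub>0 \<omega> \<longleftrightarrow> S0 (G T' 0 \<omega>)" if "T0 \<le> T'" for T' \<omega>
    unfolding S0_def \<Omega>\<^sub>0_def using T0 that by (simp add: past_G)
  have two: "2 \<le> weight (G T 0 \<omega>) u" if "\<Omega>\<^sub>0 \<omega>" "u \<in> U" "T0 \<le> T" for T \<omega> u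
    using that weight_mono[of T0 T \<omega> u 0] T0 unfolding \<Omega>\<^sub>0_def by force
  have pot0: "0 \<le> potential U (G T 0 \<omega>)" if "\<Omega>\<^sub>0 \<omega>" "T0 \<le> T" for T \<omega>
    unfolding potential_def using two[OF that(1) _ that(2)] by (intro sum_nonneg) fastforce
  define bad where "bad T = {\<omega> \<in> space M. \<Omega>\<^sub>0 \<omega> \<and> \<not> (\<forall>s\<in>{T0..T}. good s \<omega>)}" for T
  have bad_prob: "prob (bad T) = (\<integral>\<omega>. of_bool (S0 (G T 0 \<omega>) \<and> \<not> S T (G T 0 \<omega>)) \<partial>M)" if "T0 \<le> T" for T
  proof -
    have "bad T = {\<omega> \<in> space M. S0 (G T 0 \<omega>) \<and> \<not> S T (G T 0 \<omega>)}"
      unfolding bad_def OS[OF that, symmetric] CS[OF that order_refl, symmetric] C_def by auto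
    then show ?thesis
      using prob_eq_integral_simple(2)[OF simple_G[of T 0], of "\<lambda>g. S0 g \<and> \<not> S T g"] that T0 by simp
  qed
  \<comment> \<open>Mass that turns bad at time \<open>T\<close> has
    \<open>growth * potential \<ge> \<Lambda>\<close> there and enters the second term with the
    factor \<open>\<Lambda>\<close>. So its transfer does not increase the sum, and on the remaining
    good paths the supermartingale inequality applies.\<close>
  have key: "growth T * (\<integral>\<omega>. of_bool (S T (G T 0 \<omega>)) * potential U (G T 0 \<omega>) \<partial>M) + \<Lambda> * prob (bad T)
      \<le> growth T0 * (\<integral>\<omega>. of_bool (S0 (G T0 0 \<omega>)) * potential U (G T0 0 \<omega>) \<partial>M)" if "T0 \<le> T" for T
    using that
  proof (induction T rule: dec_induct)
    case base
    have s: "simple_function M (G T0 0)" using T0 by (intro simple_G) auto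
    have "growth T0 * (\<integral>\<omega>. of_bool (S T0 (G T0 0 \<omega>)) * potential U (G T0 0 \<omega>) \<partial>M) + \<Lambda> * prob (bad T0) =
        (\<integral>\<omega>. growth T0 * (of_bool (S T0 (G T0 0 \<omega>)) * potential U (G T0 0 \<omega>)) +
          \<Lambda> * of_bool (S0 (G T0 0 \<omega>) \<and> \<not> S T0 (G T0 0 \<omega>)) \<partial>M)"
      unfolding bad_prob[OF order_refl]
      using expectation_simple(1)[OF s, of "\<lambda>g. of_bool (S T0 g) * potential U g"]
        expectation_simple(1)[OF s, of "\<lambda>g. of_bool (S0 g \<and> \<not> S T0 g) :: real"]
      by (subst Bochner_Integration.integral_add) auto
    also have "\<dots> \<le> (\<integral>\<omega>. growth T0 * (of_bool (S0 (G T0 0 \<omega>)) * potential U (G T0 0 \<omega>)) \<partial>M)"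
    proof (rule integral_mono)
      show "integrable M (\<lambda>\<omega>. growth T0 * (of_bool (S T0 (G T0 0 \<omega>)) * potential U (G T0 0 \<omega>)) +
          \<Lambda> * of_bool (S0 (G T0 0 \<omega>) \<and> \<not> S T0 (G T0 0 \<omega>)))"
        using expectation_simple(1)[OF s, of "\<lambda>g. growth T0 * (of_bool (S T0 g) * potential U g) +
          \<Lambda> * of_bool (S0 g \<and> \<not> S T0 g)"] .
      show "integrable M (\<lambda>\<omega>. growth T0 * (of_bool (S0 (G T0 0 \<omega>)) * potential U (G T0 0 \<omega>)))"
        using expectation_simple(1)[OF s, of "\<lambda>g. growth T0 * (of_bool (S0 g) * potential U g)"] .
      fix \<omega>
      have "S T0 (G T0 0 \<omega>) \<longleftrightarrow> S0 (G T0 0 \<omega>) \<and> good T0 \<omega>"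
        using CS[OF order_refl order_refl, of \<omega>] OS[OF order_refl, of \<omega>] unfolding C_def by simp
      then show "growth T0 * (of_bool (S T0 (G T0 0 \<omega>)) * potential U (G T0 0 \<omega>)) +
          \<Lambda> * of_bool (S0 (G T0 0 \<omega>) \<and> \<not> S T0 (G T0 0 \<omega>)) \<le>
          growth T0 * (of_bool (S0 (G T0 0 \<omega>)) * potential U (G T0 0 \<omega>))"
        unfolding good_def by auto
    qed
    finally show ?case by simp
  next
    case (step T)
    have T3: "3 \<le> T" using step T0 by simp
    have s: "simple_function M (G (Suc T) 0)" using T3 by (intro simple_G) auto
    have SS: "S T (G T 0 \<omega>) \<longleftrightarrow> S T (G (Suc T) 0 \<omega>)" for \<omega>
      using CS[of T T \<omega>] CS[of "Suc T" T \<omega>] step by simp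
    have S0S: "S0 (G T 0 \<omega>) \<longleftrightarrow> S0 (G (Suc T) 0 \<omega>)" for \<omega>
      using OS[of T \<omega>] OS[of "Suc T" \<omega>] step by simp
    have "growth (Suc T) * (\<integral>\<omega>. of_bool (S (Suc T) (G (Suc T) 0 \<omega>)) * potential U (G (Suc T) 0 \<omega>) \<partial>M)
        + \<Lambda> * prob (bad (Suc T)) =
        (\<integral>\<omega>. growth (Suc T) * (of_bool (S (Suc T) (G (Suc T) 0 \<omega>)) * potential U (G (Suc T) 0 \<omega>)) +
          \<Lambda> * of_bool (S0 (G (Suc T) 0 \<omega>) \<and> \<not> S (Suc T) (G (Suc T) 0 \<omega>)) \<partial>M)"
      using bad_prob[of "Suc T"] step
        expectation_simple(1)[OF s, of "\<lambda>g. of_bool (S (Suc T) g) * potential U g"]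
        expectation_simple(1)[OF s, of "\<lambda>g. of_bool (S0 g \<and> \<not> S (Suc T) g) :: real"]
      by (subst Bochner_Integration.integral_add) auto
    also have "\<dots> \<le> (\<integral>\<omega>. growth (Suc T) * (of_bool (S T (G (Suc T) 0 \<omega>)) * potential U (G (Suc T) 0 \<omega>)) +
          \<Lambda> * of_bool (S0 (G (Suc T) 0 \<omega>) \<and> \<not> S T (G (Suc T) 0 \<omega>)) \<partial>M)"
    proof (rule integral_mono)
      show "integrable M (\<lambda>\<omega>. growth (Suc T) * (of_bool (S (Suc T) (G (Suc T) 0 \<omega>)) * potential U (G (Suc T) 0 \<omega>)) +
          \<Lambda> * of_bool (S0 (G (Suc T) 0 \<omega>) \<and> \<not> S (Suc T) (G (Suc T) 0 \<omega>)))"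
        using expectation_simple(1)[OF s, of "\<lambda>g. growth (Suc T) * (of_bool (S (Suc T) g) * potential U g) +
          \<Lambda> * of_bool (S0 g \<and> \<not> S (Suc T) g)"] .
      show "integrable M (\<lambda>\<omega>. growth (Suc T) * (of_bool (S T (G (Suc T) 0 \<omega>)) * potential U (G (Suc T) 0 \<omega>)) +
          \<Lambda> * of_bool (S0 (G (Suc T) 0 \<omega>) \<and> \<not> S T (G (Suc T) 0 \<omega>)))"
        using expectation_simple(1)[OF s, of "\<lambda>g. growth (Suc T) * (of_bool (S T g) * potential U g) +
          \<Lambda> * of_bool (S0 g \<and> \<not> S T g)"] .
      fix \<omega>
      have "S (Suc T) (G (Suc T) 0 \<omega>) \<longleftrightarrow> S T (G (Suc T) 0 \<omega>) \<and> good (Suc T) \<omega>"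
        using CS[of "Suc T" "Suc T" \<omega>] CS[of "Suc T" T \<omega>] step unfolding C_def
        by (auto simp: le_Suc_eq)
      then show "growth (Suc T) * (of_bool (S (Suc T) (G (Suc T) 0 \<omega>)) * potential U (G (Suc T) 0 \<omega>)) +
          \<Lambda> * of_bool (S0 (G (Suc T) 0 \<omega>) \<and> \<not> S (Suc T) (G (Suc T) 0 \<omega>)) \<le>
          growth (Suc T) * (of_bool (S T (G (Suc T) 0 \<omega>)) * potential U (G (Suc T) 0 \<omega>)) +
          \<Lambda> * of_bool (S0 (G (Suc T) 0 \<omega>) \<and> \<not> S T (G (Suc T) 0 \<omega>))"
        unfolding good_def by (auto simp: S_def S0_def)
    qed
    also have "\<dots> = growth (Suc T) * (\<integral>\<omega>. of_bool (S T (G (Suc T) 0 \<omega>)) * potential U (G (Suc T) 0 \<omega>) \<partial>M) +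
        \<Lambda> * (\<integral>\<omega>. of_bool (S0 (G (Suc T) 0 \<omega>) \<and> \<not> S T (G (Suc T) 0 \<omega>)) \<partial>M)"
      using expectation_simple(1)[OF s, of "\<lambda>g. of_bool (S T g) * potential U g"]
        expectation_simple(1)[OF s, of "\<lambda>g. of_bool (S0 g \<and> \<not> S T g) :: real"]
      by (subst Bochner_Integration.integral_add) auto
    also have "\<dots> = growth (Suc T) * (\<integral>\<omega>. of_bool (S T (G T 0 \<omega>)) * potential U (G (Suc T) 0 \<omega>) \<partial>M) + \<Lambda> * prob (bad T)"
      using bad_prob[of T] step unfolding SS S0S by simp
    also have "growth (Suc T) * (\<integral>\<omega>. of_bool (S T (G T 0 \<omega>)) * potential U (G (Suc T) 0 \<omega>) \<partial>M) \<le>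
        growth T * (\<integral>\<omega>. of_bool (S T (G T 0 \<omega>)) * potential U (G T 0 \<omega>) \<partial>M)"
    proof (rule potential_supermartingale[OF T3])
      show "U \<subseteq> {1..T - 1}" by (rule order_trans[OF U]) (use step in auto)
      show "1 < weight (G T 0 \<omega>) u" if "\<omega> \<in> space M" "S T (G T 0 \<omega>)" "u \<in> U" for \<omega> u
        using two[of \<omega> u T] that CS[of T T \<omega>] step unfolding C_def by simp
    qed
    finally show ?case using step by simp
  qed
  have "0 \<le> growth T * (\<integral>\<omega>. of_bool (S T (G T 0 \<omega>)) * potential U (G T 0 \<omega>) \<partial>M)"
  proof (rule mult_nonneg_nonneg)
    show "0 \<le> growth T" unfolding growth_def by simp
    show "0 \<le> (\<integral>\<omega>. of_bool (S T (G T 0 \<omega>)) * potential U (G T 0 \<omega>) \<partial>M)"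
    proof (rule Bochner_Integration.integral_nonneg)
      fix \<omega>
      show "0 \<le> of_bool (S T (G T 0 \<omega>)) * potential U (G T 0 \<omega>)"
        using pot0[of \<omega> T] CS[of T T \<omega>] \<open>T0 \<le> T\<close> unfolding C_def by auto
    qed
  qed
  then show ?thesis
    using key[OF \<open>T0 \<le> T\<close>] unfolding bad_def OS[OF order_refl, symmetric] by simp
qed

text \<open>Up to an exceptional event of probability at most \<open>\<epsilon> / 2\<close>, the
  maximal inequality keeps the weights in \<open>U\<close> above
  \<open>growth s / \<Lambda>\<close>. While that holds, a hit has conditional probability at least
  a constant times \<open>1 / (s - 1)\<close>, so missing \<open>U\<close> for a long time has
  probability below another \<open>\<epsilon> / 2\<close>.\<close>

lemma AE_hit_from:
  assumes T0: "3 \<le> T0" and U: "U \<subseteq> {1..T0 - 1}" "card U \<le> m" and x: "real (card U) * pa_x \<delta> m \<le> 1"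
  shows "AE \<omega> in M. (\<forall>u\<in>U. 2 \<le> weight (G T0 0 \<omega>) u) \<longrightarrow> (\<exists>s\<ge>T0. hit s U \<omega>)"
proof -
  define \<Omega>\<^sub>0 where "\<Omega>\<^sub>0 \<omega> \<longleftrightarrow> (\<forall>u\<in>U. 2 \<le> weight (G T0 0 \<omega>) u)" for \<omega>
  define A where "A = {\<omega> \<in> space M. \<Omega>\<^sub>0 \<omega> \<and> (\<forall>s\<ge>T0. \<not> hit s U \<omega>)}"
  define K where "K = growth T0 * (\<integral>\<omega>. of_bool (\<Omega>\<^sub>0 \<omega>) * potential U (G T0 0 \<omega>) \<partial>M)"
  have fU: "finite U" using U finite_subset by blast
  have evO: "{\<omega> \<in> space M. \<Omega>\<^sub>0 \<omega>} \<in> events" unfolding \<Omega>\<^sub>0_def using T0 by (intro event_G) simp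
  have evA: "A \<in> events"
  proof -
    have "A = {\<omega> \<in> space M. \<Omega>\<^sub>0 \<omega>} \<inter> {\<omega> \<in> space M. \<forall>s\<ge>T0. \<not> hit s U \<omega>}" unfolding A_def by auto
    also have "\<dots> \<in> events" using T0 by (intro sets.Int evO event_never_hit) simp
    finally show ?thesis .
  qed
  have two: "2 \<le> weight (G T 0 \<omega>) u" if "\<Omega>\<^sub>0 \<omega>" "u \<in> U" "T0 \<le> T" for T \<omega> u
    using that weight_mono[of T0 T \<omega> u 0] T0 unfolding \<Omega>\<^sub>0_def by force
  have small: "prob A \<le> \<epsilon>" if \<epsilon>: "0 < \<epsilon>" for \<epsilon>
  proof -
    \<comment> \<open>Makes \<open>K / \<Lambda>\<close>, the bound from the maximal inequality, at
      most \<open>\<epsilon> / 2\<close>; the maximum with 1 keeps \<open>\<Lambda>\<close>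
      positive.\<close>
    define \<Lambda> where "\<Lambda> = max 1 (2 * K / \<epsilon>)"
    have \<Lambda>: "0 < \<Lambda>" "K / \<Lambda> \<le> \<epsilon> / 2"
    proof -
      show "0 < \<Lambda>" unfolding \<Lambda>_def by simp
      have "2 * K / \<epsilon> \<le> \<Lambda>" unfolding \<Lambda>_def by simp
      then show "K / \<Lambda> \<le> \<epsilon> / 2" using \<epsilon> \<open>0 < \<Lambda>\<close> by (simp add: field_simps)
    qed
    define C where "C s g \<longleftrightarrow> (\<forall>u\<in>U. 2 \<le> weight g u) \<and> growth s * potential U g < \<Lambda>" for s g
    have pos: "0 < 2 * real m + \<delta>" using delta_gt m_pos by simp
    have "\<exists>T\<ge>T0. prob {\<omega> \<in> space M. (\<forall>s\<in>{T0..T}. C s (G s 0 \<omega>)) \<and> (\<forall>s\<in>{T0..<T}. \<not> hit s U \<omega>)} < \<epsilon> / 2"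
    proof (rule avoid_prob_small[where w = "\<lambda>T. growth T / \<Lambda>" and
          c = "(1 / (\<Lambda> * (2 * real m + \<delta>))) ^ card U", OF T0 U])
      show "0 \<le> growth T / \<Lambda>" for T unfolding growth_def using \<Lambda> by simp
      show "0 < (1 / (\<Lambda> * (2 * real m + \<delta>))) ^ card U" using \<Lambda> pos by simp
      show "0 < \<epsilon> / 2" using \<epsilon> by simp
      show "growth T / \<Lambda> \<le> weight (G T 0 \<omega>) u"
        if T: "T0 \<le> T" and C: "C T (G T 0 \<omega>)" and u: "u \<in> U" for T \<omega> u
      proof -
        define v where "v = weight (G T 0 \<omega>) u"
        have v: "2 \<le> v" using C u unfolding C_def v_def by blast
        \<comment> \<open>One summand is at most the whole sum, all weights being at least 2; hence
          \<open>growth T < \<Lambda> * (v - 1)\<close>.\<close>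
        have "1 / (v - 1) \<le> potential U (G T 0 \<omega>)"
          unfolding potential_def v_def using C u fU unfolding C_def by (intro member_le_sum) force+
        then have "growth T * (1 / (v - 1)) \<le> growth T * potential U (G T 0 \<omega>)"
          by (intro mult_left_mono) (auto simp: growth_def)
        also have "\<dots> < \<Lambda>" using C unfolding C_def by blast
        finally have "growth T < \<Lambda> * (v - 1)" using v by (simp add: field_simps)
        also have "\<dots> \<le> \<Lambda> * v" using \<Lambda> by simp
        finally show ?thesis unfolding v_def[symmetric] using \<Lambda> by (simp add: field_simps)
      qed
      show "(1 / (\<Lambda> * (2 * real m + \<delta>))) ^ card U / (real T - 1) \<le>
          (growth T / \<Lambda> / ((2 * real m + \<delta>) * (real T - 1))) ^ card U" if T: "T0 \<le> T" for T
      proof -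
        define t where "t = real T - 1"
        have t: "1 \<le> t" unfolding t_def using T T0 by simp
        have "growth T / t = t powr (- pa_x \<delta> m)"
          unfolding growth_def t_def[symmetric] using t by (simp add: powr_diff powr_minus divide_inverse)
        then have "(growth T / t) ^ card U = t powr (- (real (card U) * pa_x \<delta> m))"
          using t by (simp add: powr_power mult.commute)
        \<comment> \<open>The assumption that \<open>card U * pa_x \<delta> m\<close> is at most 1
          enters here: it makes the power at least \<open>1 / t\<close>.\<close>
        moreover have "t powr (-1) \<le> t powr (- (real (card U) * pa_x \<delta> m))"
          using t x by (intro powr_mono) auto
        ultimately have "1 / t \<le> (growth T / t) ^ card U"
          using t by (simp add: powr_minus divide_inverse)
        then have "(1 / (\<Lambda> * (2 * real m + \<delta>))) ^ card U * (1 / t) \<le>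
            (1 / (\<Lambda> * (2 * real m + \<delta>))) ^ card U * (growth T / t) ^ card U"
          using \<Lambda> pos by (intro mult_left_mono) auto
        also have "\<dots> = (growth T / \<Lambda> / ((2 * real m + \<delta>) * t)) ^ card U"
          unfolding power_mult_distrib[symmetric] by (simp add: mult_ac)
        finally show ?thesis unfolding t_def by simp
      qed
    qed
    then obtain T where T: "T \<ge> T0"
      "prob {\<omega> \<in> space M. (\<forall>s\<in>{T0..T}. C s (G s 0 \<omega>)) \<and> (\<forall>s\<in>{T0..<T}. \<not> hit s U \<omega>)} < \<epsilon> / 2" by blast
    define B where "B = {\<omega> \<in> space M. (\<forall>s\<in>{T0..T}. C s (G s 0 \<omega>)) \<and> (\<forall>s\<in>{T0..<T}. \<not> hit s U \<omega>)}"
    define D where "D = {\<omega> \<in> space M. \<Omega>\<^sub>0 \<omega> \<and> \<not> (\<forall>s\<in>{T0..T}. growth s * potential U (G s 0 \<omega>) < \<Lambda>)}"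
    have "\<Lambda> * prob D \<le> K"
      unfolding D_def K_def \<Omega>\<^sub>0_def by (rule potential_maximal[OF T0 U(1) T(1)])
    then have "prob D \<le> K / \<Lambda>" using \<Lambda> by (simp add: field_simps)
    then have D: "prob D \<le> \<epsilon> / 2" using \<Lambda> by linarith
    have evD: "D \<in> events"
    proof -
      have "D = {\<omega> \<in> space M. (\<forall>u\<in>U. 2 \<le> weight (past T0 (G T 0 \<omega>)) u) \<and>
          \<not> (\<forall>s\<in>{T0..T}. growth s * potential U (past s (G T 0 \<omega>)) < \<Lambda>)}"
        unfolding D_def \<Omega>\<^sub>0_def using T0 T(1) by (auto simp: past_G)
      also have "\<dots> \<in> events" using T0 T(1) by (intro event_G) simp
      finally show ?thesis .
    qed
    have evB: "B \<in> events"
    proof -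
      have "B = {\<omega> \<in> space M. (\<forall>s\<in>{T0..T}. C s (past s (G T 0 \<omega>))) \<and>
          (\<forall>s\<in>{T0..<T}. \<not> (\<forall>u\<in>U. (s, u) \<in># past (Suc s) (G T 0 \<omega>)))}"
        unfolding B_def hit_def using T0 T(1) by (auto simp: past_G)
      also have "\<dots> \<in> events" using T0 T(1) by (intro event_G) simp
      finally show ?thesis .
    qed
    have "A \<subseteq> B \<union> D"
      unfolding A_def B_def D_def C_def using two by auto
    then have "prob A \<le> prob (B \<union> D)" using evB evD by (intro finite_measure_mono) auto
    also have "\<dots> \<le> prob B + prob D" by (rule measure_Un_le[OF evB evD])
    also have "\<dots> \<le> \<epsilon>" using T(2) D unfolding B_def by linarith
    finally show ?thesis .
  qed
  have "AE \<omega> in M. \<omega> \<notin> A" by (rule AE_notin_of_prob_le[OF evA small])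
  then show ?thesis
    by (rule AE_mp) (auto intro!: AE_I2 simp: A_def \<Omega>\<^sub>0_def)
qed

text \<open>The time from which all weights of \<open>U\<close> are at least 2 is random.
  \<open>AE_hit_from\<close> is therefore made to hold simultaneously for the countably many
  deterministic times \<open>T0\<close> from \<open>N\<close> on, and is then used at the time
  belonging to the given outcome.\<close>

lemma AE_hit_finite_set:
  assumes U: "finite U" "U \<subseteq> {1..}" "card U \<le> m" and x: "real (card U) * pa_x \<delta> m \<le> 1"
  shows "AE \<omega> in M. \<exists>s\<ge>3. hit s U \<omega>"
proof -
  define N where "N = max 3 (Suc (Max (insert 0 U)))"
  have UN: "U \<subseteq> {1..T - 1}" if "N \<le> T" for T
  proof
    fix u assume u: "u \<in> U"
    then have "u \<le> Max (insert 0 U)" using U(1) by simp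
    then show "u \<in> {1..T - 1}" using u U(2) that unfolding N_def by auto
  qed
  have a: "AE \<omega> in M. \<forall>u\<in>U. \<exists>T0\<ge>3. \<forall>T\<ge>T0. 2 \<le> weight (G T 0 \<omega>) u"
    using U by (intro AE_finite_allI AE_weight_large) auto
  have b: "AE \<omega> in M. \<forall>T0\<in>{N..}. (\<forall>u\<in>U. 2 \<le> weight (G T0 0 \<omega>) u) \<longrightarrow> (\<exists>s\<ge>T0. hit s U \<omega>)"
  proof (subst AE_ball_countable)
    show "\<forall>T0\<in>{N..}. AE \<omega> in M. (\<forall>u\<in>U. 2 \<le> weight (G T0 0 \<omega>) u) \<longrightarrow> (\<exists>s\<ge>T0. hit s U \<omega>)"
      using UN U(3) x by (intro ballI AE_hit_from) (auto simp: N_def)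
  qed auto
  from a b show ?thesis
  proof eventually_elim
    case (elim \<omega>)
    then obtain t where t: "\<And>u T. u \<in> U \<Longrightarrow> t u \<le> T \<Longrightarrow> 2 \<le> weight (G T 0 \<omega>) u" by metis
    define T0 where "T0 = max N (Max (insert 0 (t ` U)))"
    have "2 \<le> weight (G T0 0 \<omega>) u" if "u \<in> U" for u
    proof (rule t[OF that])
      have "t u \<le> Max (insert 0 (t ` U))" using that U(1) by simp
      then show "t u \<le> T0" unfolding T0_def by simp
    qed
    then obtain s where s: "T0 \<le> s" "hit s U \<omega>" using elim(2) unfolding T0_def by force
    moreover have "3 \<le> T0" unfolding T0_def N_def by simp
    ultimately show ?case by (intro exI[of _ s]) auto
  qed
qed

end

theorem mainTheorem2:
  fixes M :: "'w measure" and q m :: nat and \<delta> :: real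
    and E :: "nat \<Rightarrow> nat \<Rightarrow> 'w \<Rightarrow> nat"
  assumes "preferential_attachment M m \<delta> E"
    and "q \<ge> 1"
    and "m \<ge> 2 * (q + 1)"
    and "\<delta> > - real m"
    and "pa_x \<delta> m \<le> 1 / (2 * real q + 2)"
  shows "AE \<omega> in M. homotopy_connected q (geometric_realization (pa_clique_complex m E \<omega>))"
proof -
  interpret admissible_pa M m \<delta> E
    using assms by (intro admissible_pa.intro admissible_pa_axioms.intro) auto
  \<comment> \<open>There are only countably many finite sets of nodes, so one null set serves all
    of them.\<close>
  have ae: "AE \<omega> in M. \<forall>U\<in>{U. finite U \<and> U \<subseteq> {1..} \<and> card U \<le> 2 * q + 2}. \<exists>s\<ge>3. hit s U \<omega>"
  proof (subst AE_ball_countable)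
    show "countable {U :: nat set. finite U \<and> U \<subseteq> {1..} \<and> card U \<le> 2 * q + 2}"
      by (rule countable_subset[OF _ countable_Collect_finite]) auto
    show "\<forall>U\<in>{U. finite U \<and> U \<subseteq> {1..} \<and> card U \<le> 2 * q + 2}. AE \<omega> in M. \<exists>s\<ge>3. hit s U \<omega>"
    proof
      fix U :: "nat set" assume "U \<in> {U. finite U \<and> U \<subseteq> {1..} \<and> card U \<le> 2 * q + 2}"
      then have U: "finite U" "U \<subseteq> {1..}" "card U \<le> 2 * q + 2" by auto
      have "real (card U) * pa_x \<delta> m \<le> (2 * real q + 2) * (1 / (2 * real q + 2))"
        using U(3) assms(5) pa_x_bounds by (intro mult_mono) auto
      also have "\<dots> = 1" by simp
      finally show "AE \<omega> in M. \<exists>s\<ge>3. hit s U \<omega>"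
        using U assms(3) by (intro AE_hit_finite_set) auto
    qed
  qed
  then show ?thesis
  proof (rule AE_mp, intro AE_I2 impI)
    fix \<omega>
    assume hits: "\<forall>U\<in>{U. finite U \<and> U \<subseteq> {1..} \<and> card U \<le> 2 * q + 2}. \<exists>s\<ge>3. hit s U \<omega>"
    define R where "R u v \<longleftrightarrow> u = v \<or> (u, v) \<in> pa_infinite_edges m E \<omega> \<or> (v, u) \<in> pa_infinite_edges m E \<omega>" for u v
    have K: "pa_clique_complex m E \<omega> = cliques R {1..}"
      unfolding pa_clique_complex_def clique_complex_def cliques_def R_def by auto
    \<comment> \<open>The common neighbours of the empty set are all nodes; for
      \<open>S = {}\<close> and \<open>d = q + 1\<close> the budget \<open>card S + 2 * d\<close> is
      exactly \<open>2 * q + 2\<close>.\<close>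
    have "ext_conn (Suc q) (cliques R (common_nbrs {1..} R {}))"
    proof (rule ext_conn_cliques[where n = "2 * q + 2"])
      fix U :: "nat set" assume "finite U" "U \<subseteq> {1..}" "card U \<le> 2 * q + 2"
      then obtain s where s: "3 \<le> s" "hit s U \<omega>" using hits by blast
      have "(s, u) \<in> pa_infinite_edges m E \<omega>" if "u \<in> U" for u
        using s that unfolding hit_def pa_infinite_edges_def by (auto simp: G_next)
      then have "s \<in> common_nbrs {1..} R U"
        using s(1) unfolding common_nbrs_def R_def by auto
      then show "common_nbrs {1..} R U \<noteq> {}" by blast
    qed (auto simp: R_def)
    then have "ext_conn (Suc q) (cliques R {1..})"
      unfolding common_nbrs_def by (simp add: atLeast_def)
    moreover have "simplicial (cliques R {1..})"
      unfolding simplicial_def using down_closed_cliques by (auto simp: cliques_def)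
    ultimately show "homotopy_connected q (geometric_realization (pa_clique_complex m E \<omega>))"
      unfolding K by (intro homotopy_connected_realization)
  qed
qed

end
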